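(* Let $T\subseteq X\times Y\times Z_A\times Z_B$ be a relation on finite sets, $\varepsilon\in(0,1)$, $r\in\mathbb N$ and $\alpha\in(0,1)$. Then $$QIC^r\!\left(T,\frac{\varepsilon}{\alpha}\right)\le\frac{QIC^r_D(T,\varepsilon)}{1-\alpha}.$$
   Context: Quantum communication model: Alice holds $x\in X$ in register $A_{in}$, Bob holds $y\in Y$ in $B_{in}$. An $r$-round protocol $\Pi$ consists of a shared pure state on registers $T_A,T_B$ of arbitrary finite dimension and isometries $U_1,\dots,U_{r+1}$ applied alternately by Alice (odd rounds) and Bob (even rounds); after round $i$ Alice holds $A_i$, Bob holds $B_i$ (the non-acting party's register is unchanged) and $C_i$ is the message of round $i$; the final isometries produce Alice's output $z_A\in Z_A$ and Bob's output $z_B\in Z_B$. For a distribution $\mu$ on $X\times Y$ the input state $\sum\mu(x,y)|x\rangle\langle x|\otimes|y\rangle\langle y|$ is purified by an untouched reference register $R$, and $QIC(\Pi,\mu)=\sum_{i\text{ odd}}\frac12 I(C_i;R|B_i)+\sum_{i\text{ even}}\frac12 I(C_i;R|A_i)$ (evaluated after round $i$). $\Pi$ errs on $(x,y)$ if $(x,y,z_A,z_B)\notin T$. $QIC^r(T,\mu,\varepsilon)=\inf QIC(\Pi,\mu)$ over $r$-round protocols with error probability averaged over $\mu$ at most $\varepsilon$; $QIC^r_D(T,\varepsilon)=\max_\mu QIC^r(T,\mu,\varepsilon)$; $QIC^r(T,\varepsilon)=\inf_\Pi\max_\mu QIC(\Pi,\mu)$ over $r$-round protocols whose error probability is at most $\varepsilon$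 on every input $(x,y)$. *)

theory Defs
  imports "HOL-Probability.Probability_Mass_Function" "Jordan_Normal_Form.Char_Poly"
begin

section \<open>Entropic quantities\<close>

text \<open>
  A register with orthonormal basis J, a finite set of labels, has state space \<open>\<complex>\<^sup>J\<close>; a joint register
  has the product set as its basis. An operator is given by its matrix entries
  \<open>\<rho> j k = \<langle>j|\<rho>|k\<rangle>\<close>, of which only those with labels in the relevant bases are ever used.
  The characteristic polynomial does not depend on the enumeration of the basis chosen here.
\<close>

definition op_mat :: "'j set \<Rightarrow> ('j \<Rightarrow> 'j \<Rightarrow> complex) \<Rightarrow> complex mat" where
  "op_mat J \<rho> = mat (card J) (card J) (\<lambda>(m, n). \<rho> (from_nat_into J m) (from_nat_into J n))"

text \<open>
  Von Neumann entropy in bits: the sum runs over the eigenvalues with multiplicity, which are real for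
  a density operator. The convention 0 log 0 = 0 holds automatically.
\<close>

definition vn_entropy :: "'j set \<Rightarrow> ('j \<Rightarrow> 'j \<Rightarrow> complex) \<Rightarrow> real" where
  "vn_entropy J \<rho> = - (\<Sum>z\<in>#proots (char_poly (op_mat J \<rho>)). Re z * log 2 (Re z))"

text \<open>
  \<open>I(C;R|M) = S(CM) + S(RM) - S(M) - S(CRM)\<close> for a density operator on the registers C, R, M;
  the inner sums are the partial traces.
\<close>

definition cond_mutual_info ::
    "'c set \<Rightarrow> 'q set \<Rightarrow> 'm set \<Rightarrow> ('c \<times> 'q \<times> 'm \<Rightarrow> 'c \<times> 'q \<times> 'm \<Rightarrow> complex) \<Rightarrow> real" where
  "cond_mutual_info C R M \<rho> =
       vn_entropy (C \<times> M) (\<lambda>(c, m) (c', m'). \<Sum>q\<in>R. \<rho> (c, q, m) (c', q, m'))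
     + vn_entropy (R \<times> M) (\<lambda>(q, m) (q', m'). \<Sum>c\<in>C. \<rho> (c, q, m) (c, q', m'))
     - vn_entropy M (\<lambda>m m'. \<Sum>c\<in>C. \<Sum>q\<in>R. \<rho> (c, q, m) (c, q, m'))
     - vn_entropy (C \<times> R \<times> M) \<rho>"

text \<open>\<open>U m k = \<langle>m|U|k\<rangle>\<close> is an isometry from \<open>\<complex>\<^sup>J\<close> into \<open>\<complex>\<^sup>K\<close>, that is, \<open>U\<^sup>* U = 1\<close>.\<close>

definition isometry :: "'j set \<Rightarrow> 'k set \<Rightarrow> ('k \<Rightarrow> 'j \<Rightarrow> complex) \<Rightarrow> bool" where
  "isometry J K U \<longleftrightarrow>
     (\<forall>j\<in>J. \<forall>j'\<in>J. (\<Sum>k\<in>K. cnj (U k j) * U k j') = (if j = j' then 1 else 0))"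


section \<open>Protocols\<close>

text \<open>
  Basis labels of a player's register: \<open>Inp x t\<close> for the input register and the player's half of the
  shared state (\<open>A\<^sub>i\<^sub>n T\<^sub>A\<close>), \<open>Mem k\<close> for memory between rounds, \<open>Out z k\<close> for the output register
  together with the register left over at the end.
\<close>

datatype ('i, 'o) label = Inp 'i nat | Mem nat | Out 'o nat

text \<open>
  Isometry i is \<open>alice_op i\<close> for odd i and \<open>bob_op i\<close> for even i, acting on the
  player's register and the message; \<open>mem_dim i\<close> is the dimension of the memory it creates (of the
  left-over register if it creates an output), \<open>msg_dim i\<close> that of the message.
\<close>

record ('x, 'y, 'za, 'zb) protocol =
  rounds :: nat
  dim_TA :: nat
  dim_TB :: nat
  shared :: "nat \<Rightarrow> nat \<Rightarrow> complex"
  mem_dim :: "nat \<Rightarrow> nat"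
  msg_dim :: "nat \<Rightarrow> nat"
  alice_op :: "nat \<Rightarrow> ('x, 'za) label \<times> nat \<Rightarrow> ('x, 'za) label \<times> nat \<Rightarrow> complex"
  bob_op :: "nat \<Rightarrow> ('y, 'zb) label \<times> nat \<Rightarrow> ('y, 'zb) label \<times> nat \<Rightarrow> complex"

text \<open>There is no message before round 1 nor after the last isometry: one-dimensional register.\<close>

definition msg_reg :: "('x, 'y, 'za, 'zb) protocol \<Rightarrow> nat \<Rightarrow> nat set" where
  "msg_reg P i = (if 1 \<le> i \<and> i \<le> rounds P then {..<msg_dim P i} else {0})"

definition input_reg :: "nat \<Rightarrow> ('i, 'o) label set" where
  "input_reg d = {Inp x t | x t. t < d}"

text \<open>
  Register created by isometry i. With r rounds, isometries r and r + 1 are the last ones of the two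
  players and create the outputs.
\<close>

definition new_reg :: "('x, 'y, 'za, 'zb) protocol \<Rightarrow> nat \<Rightarrow> ('i, 'o) label set" where
  "new_reg P i =
     (if rounds P \<le> i then {Out z k | z k. k < mem_dim P i} else {Mem k | k. k < mem_dim P i})"

text \<open>
  \<open>A\<^sub>i\<close> and \<open>B\<^sub>i\<close>. If there are 0 rounds, Alice's only isometry is number 1, and Bob produces his output
  with the local isometry \<open>bob_op 0\<close>, which plays no role when there is at least one round.
\<close>

primrec alice_reg :: "('x, 'y, 'za, 'zb) protocol \<Rightarrow> nat \<Rightarrow> ('x, 'za) label set" where
  "alice_reg P 0 = input_reg (dim_TA P)"
| "alice_reg P (Suc i) = (if odd (Suc i) then new_reg P (Suc i) else alice_reg P i)"

primrec bob_reg :: "('x, 'y, 'za, 'zb) protocol \<Rightarrow> nat \<Rightarrow> ('y, 'zb) label set" where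
  "bob_reg P 0 = (if rounds P = 0 then new_reg P 0 else input_reg (dim_TB P))"
| "bob_reg P (Suc i) = (if even (Suc i) then new_reg P (Suc i) else bob_reg P i)"

definition is_protocol :: "nat \<Rightarrow> ('x, 'y, 'za, 'zb) protocol \<Rightarrow> bool" where
  "is_protocol r P \<longleftrightarrow>
     rounds P = r \<and>
     (\<Sum>t<dim_TA P. \<Sum>s<dim_TB P. (cmod (shared P t s))\<^sup>2) = 1 \<and>
     (\<forall>i\<in>{1..r + 1}. odd i \<longrightarrow>
        isometry (alice_reg P (i - 1) \<times> msg_reg P (i - 1)) (alice_reg P i \<times> msg_reg P i) (alice_op P i)) \<and>
     (\<forall>i\<in>{1..r + 1}. even i \<longrightarrow>
        isometry (bob_reg P (i - 1) \<times> msg_reg P (i - 1)) (bob_reg P i \<times> msg_reg P i) (bob_op P i)) \<and>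
     (r = 0 \<longrightarrow>
        isometry (input_reg (dim_TB P) \<times> {0}) (bob_reg P 0 \<times> {0}) (bob_op P 0))"


section \<open>Execution\<close>

text \<open>
  A vector on the registers R, Alice, Bob, message is given by its amplitudes \<open>\<psi> q a b c\<close>.
  The input is a vector \<open>\<phi> q x y\<close> on \<open>R A\<^sub>i\<^sub>n B\<^sub>i\<^sub>n\<close>; R has a basis indexed by all of its label type.
\<close>

definition act_alice ::
    "(('i, 'o) label \<times> nat \<Rightarrow> ('i, 'o) label \<times> nat \<Rightarrow> complex) \<Rightarrow> ('i, 'o) label set \<Rightarrow> nat set \<Rightarrow>
     ('q \<Rightarrow> ('i, 'o) label \<Rightarrow> 'b \<Rightarrow> nat \<Rightarrow> complex) \<Rightarrow> 'q \<Rightarrow> ('i, 'o) label \<Rightarrow> 'b \<Rightarrow> nat \<Rightarrow> complex" where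
  "act_alice U A C \<psi> = (\<lambda>q a b c. \<Sum>a'\<in>A. \<Sum>c'\<in>C. U (a, c) (a', c') * \<psi> q a' b c')"

definition act_bob ::
    "(('i, 'o) label \<times> nat \<Rightarrow> ('i, 'o) label \<times> nat \<Rightarrow> complex) \<Rightarrow> ('i, 'o) label set \<Rightarrow> nat set \<Rightarrow>
     ('q \<Rightarrow> 'a \<Rightarrow> ('i, 'o) label \<Rightarrow> nat \<Rightarrow> complex) \<Rightarrow> 'q \<Rightarrow> 'a \<Rightarrow> ('i, 'o) label \<Rightarrow> nat \<Rightarrow> complex" where
  "act_bob U B C \<psi> = (\<lambda>q a b c. \<Sum>b'\<in>B. \<Sum>c'\<in>C. U (b, c) (b', c') * \<psi> q a b' c')"

definition start_state ::
    "('x, 'y, 'za, 'zb) protocol \<Rightarrow> ('q \<Rightarrow> 'x \<Rightarrow> 'y \<Rightarrow> complex) \<Rightarrow>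
     'q \<Rightarrow> ('x, 'za) label \<Rightarrow> ('y, 'zb) label \<Rightarrow> nat \<Rightarrow> complex" where
  "start_state P \<phi> = (\<lambda>q a b c.
     (case (a, b) of (Inp x t, Inp y s) \<Rightarrow> if c = 0 then \<phi> q x y * shared P t s else 0 | _ \<Rightarrow> 0))"

primrec state_after ::
    "('x, 'y, 'za, 'zb) protocol \<Rightarrow> ('q \<Rightarrow> 'x \<Rightarrow> 'y \<Rightarrow> complex) \<Rightarrow> nat \<Rightarrow>
     'q \<Rightarrow> ('x, 'za) label \<Rightarrow> ('y, 'zb) label \<Rightarrow> nat \<Rightarrow> complex" where
  "state_after P \<phi> 0 =
     (if rounds P = 0 then act_bob (bob_op P 0) (input_reg (dim_TB P)) {0} (start_state P \<phi>)
      else start_state P \<phi>)"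
| "state_after P \<phi> (Suc i) =
     (if odd (Suc i) then act_alice (alice_op P (Suc i)) (alice_reg P i) (msg_reg P i) (state_after P \<phi> i)
      else act_bob (bob_op P (Suc i)) (bob_reg P i) (msg_reg P i) (state_after P \<phi> i))"


section \<open>Error and quantum information cost\<close>

text \<open>Measurement of both output registers in the computational basis, on input \<open>|x\<rangle>|y\<rangle>\<close>.\<close>

definition output_prob :: "('x, 'y, 'za, 'zb) protocol \<Rightarrow> 'x \<Rightarrow> 'y \<Rightarrow> 'za \<Rightarrow> 'zb \<Rightarrow> real" where
  "output_prob P x y za zb =
     (let n = rounds P + 1;
          \<psi> = state_after P (\<lambda>(q::unit) x' y'. if x' = x \<and> y' = y then 1 else 0) n
      in \<Sum>a\<in>{Out za k | k. Out za k \<in> alice_reg P n}.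
         \<Sum>b\<in>{Out zb l | l. Out zb l \<in> bob_reg P n}. (cmod (\<psi> () a b 0))\<^sup>2)"

definition error_prob ::
    "('x::finite \<times> 'y::finite \<times> 'za::finite \<times> 'zb::finite) set \<Rightarrow>
     ('x, 'y, 'za, 'zb) protocol \<Rightarrow> 'x \<Rightarrow> 'y \<Rightarrow> real" where
  "error_prob T P x y = (\<Sum>(za, zb)\<in>{(za, zb). (x, y, za, zb) \<notin> T}. output_prob P x y za zb)"

text \<open>
  \<open>\<Sum> sqrt \<mu>(x,y) |xy\<rangle>\<^sub>R |x\<rangle> |y\<rangle>\<close>, a purification of the input state. All purifications are related
  by isometries on R, which do not change any of the entropies below.
\<close>

definition purified_input :: "('x \<times> 'y) pmf \<Rightarrow> 'x \<times> 'y \<Rightarrow> 'x \<Rightarrow> 'y \<Rightarrow> complex" where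
  "purified_input \<mu> q x y = (if q = (x, y) then of_real (sqrt (pmf \<mu> (x, y))) else 0)"

definition QIC :: "('x::finite, 'y::finite, 'za::finite, 'zb::finite) protocol \<Rightarrow> ('x \<times> 'y) pmf \<Rightarrow> real" where
  "QIC P \<mu> =
     (\<Sum>i | i \<in> {1..rounds P} \<and> odd i. 1 / 2 *
        (let \<psi> = state_after P (purified_input \<mu>) i in
         cond_mutual_info (msg_reg P i) UNIV (bob_reg P i)
           (\<lambda>(c, q, b) (c', q', b'). \<Sum>a\<in>alice_reg P i. \<psi> q a b c * cnj (\<psi> q' a b' c')))) +
     (\<Sum>i | i \<in> {1..rounds P} \<and> even i. 1 / 2 *
        (let \<psi> = state_after P (purified_input \<mu>) i in
         cond_mutual_info (msg_reg P i) UNIV (alice_reg P i)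
           (\<lambda>(c, q, a) (c', q', a'). \<Sum>b\<in>bob_reg P i. \<psi> q a b c * cnj (\<psi> q' a' b c'))))"

text \<open>
  The optimised quantities are extended reals: the infimum over an empty set of protocols is
  \<open>\<infinity>\<close>. The maximum over \<mu> is rendered as a supremum.
\<close>

definition QIC_dist ::
    "nat \<Rightarrow> ('x::finite \<times> 'y::finite \<times> 'za::finite \<times> 'zb::finite) set \<Rightarrow> ('x \<times> 'y) pmf \<Rightarrow> real \<Rightarrow> ereal" where
  "QIC_dist r T \<mu> \<epsilon> =
     (INF P \<in> {P. is_protocol r P \<and> measure_pmf.expectation \<mu> (\<lambda>(x, y). error_prob T P x y) \<le> \<epsilon>}.
        ereal (QIC P \<mu>))"

definition QIC_D ::
    "nat \<Rightarrow> ('x::finite \<times> 'y::finite \<times> 'za::finite \<times> 'zb::finite) set \<Rightarrow> real \<Rightarrow> ereal" where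
  "QIC_D r T \<epsilon> = (SUP \<mu>. QIC_dist r T \<mu> \<epsilon>)"

definition QIC_worst ::
    "nat \<Rightarrow> ('x::finite \<times> 'y::finite \<times> 'za::finite \<times> 'zb::finite) set \<Rightarrow> real \<Rightarrow> ereal" where
  "QIC_worst r T \<epsilon> =
     (INF P \<in> {P. is_protocol r P \<and> (\<forall>x y. error_prob T P x y \<le> \<epsilon>)}. SUP \<mu>. ereal (QIC P \<mu>))"

end

theory Submission
  imports Defs
begin

text \<open>
  By Sion-type minimax duality it suffices to exhibit, for every input distribution \<open>\<mu>\<close>, a protocol for
  which a weighted sum of information cost and average error is at most 1; the protocols witnessing
  \<open>QIC\<^sub>D < I\<close> do this for the weights \<open>(1 - \<alpha>) / I\<close> and \<open>\<alpha> / \<epsilon>\<close>. Since both summands are nonnegative,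
  a protocol whose payoff is at most 1 for every \<open>\<mu>\<close> has cost at most \<open>I / (1 - \<alpha>)\<close> and error at most
  \<open>\<epsilon> / \<alpha>\<close>. Slightly enlarging \<open>\<alpha>\<close> absorbs the loss of an arbitrarily small amount in the minimax step,
  so that the error bound is met exactly.

  Minimax needs the payoff to be affine under mixing protocols and concave in \<open>\<mu>\<close>. For the former,
  two protocols are mixed by means of a flag in the shared entanglement that controls all
  isometries. For the latter, as the state is pure, \<open>I(C;R|B) = S(C|B) + S(C|A)\<close>, where the reduced
  states are linear in \<open>\<mu>\<close>; so everything reduces to concavity of conditional entropy, that is, to
  joint convexity of relative entropy. The latter follows from
  \<open>p ln (p/q) - p + q = \<integral>\<^sub>0\<^sup>1 (1 - s) (p - q)\<^sup>2 / (s p + (1 - s) q) ds\<close>, whose matrix version has an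
  integrand that is a supremum of functions linear in both arguments. Nonnegativity of the cost is
  also a consequence of concavity, because the cost vanishes when \<open>\<mu>\<close> is a point mass.
\<close>

section \<open>Entropy and characteristic polynomials\<close>

text \<open>The flag that selects a protocol must not change the information quantities itself. It
  is therefore held by both players. Tracing out one player's register destroys the coherence
  between the two flag values, while the other player's copy lies in the conditioning register. The
  entropy of the flag then enters S(CB) and S(B) with the same weight and cancels, so the cost of a
  mixture is exactly the average of the costs.

  Protocols have unbounded dimension and carry no topology, so the compactness needed for minimax
  has to come from the set of distributions. This is why continuity in \<mu> matters although the
  payoff is to be controlled for every \<mu>.

  Entropy is given by the roots of a characteristic polynomial. All its invariance comes from one
  fact: AB and BA have the same nonzero eigenvalues, even for rectangular A and B. It yields both
  the equality of the entropies of complementary registers of a pure state and the formula in terms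
  of an orthonormal family of eigenvectors.\<close>

definition rect :: "'j set \<Rightarrow> 'k set \<Rightarrow> ('j \<Rightarrow> 'k \<Rightarrow> complex) \<Rightarrow> complex mat" where
  "rect J K A = mat (card J) (card K) (\<lambda>(m, n). A (from_nat_into J m) (from_nat_into K n))"

lemma sum_from_nat_into:
  assumes "finite J"
  shows "(\<Sum>i<card J. g (from_nat_into J i)) = (\<Sum>j\<in>J. g j)"
  using sum.reindex_bij_betw[OF bij_betw_from_nat_into_finite[OF assms], of g] .

lemma op_mat_eq_rect: "op_mat J \<rho> = rect J J \<rho>"
  by (simp add: op_mat_def rect_def)

lemma rect_mult:
  assumes "finite K"
  shows "rect J K A * rect K L B = rect J L (\<lambda>j l. \<Sum>k\<in>K. A j k * B k l)"
  by (rule eq_matI)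
    (auto simp: rect_def scalar_prod_def sum_from_nat_into[OF assms, symmetric] lessThan_atLeast0)

text \<open>Sylvester's identity. The block matrix \<open>M\<close> with diagonal blocks X and 1 and
  off-diagonal blocks A and B has two Schur complements, and its determinant is computed from each.
  The monomials account for the different sizes of AB and BA.\<close>

lemma char_poly_mult_commute:
  fixes A B :: "complex mat"
  assumes A: "A \<in> carrier_mat n m" and B: "B \<in> carrier_mat m n"
  shows "monom 1 m * char_poly (A * B) = monom 1 n * char_poly (B * A)"
proof -
  define X :: "complex poly" where "X = [:0, 1:]"
  define a where "a = map_mat (\<lambda>x. [:x:]) A"
  define b where "b = map_mat (\<lambda>x. [:x:]) B"
  have a: "a \<in> carrier_mat n m" and b: "b \<in> carrier_mat m n"
    using A B by (auto simp: a_def b_def)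
  have ab: "a * b = map_mat (\<lambda>x. [:x:]) (A * B)" and ba: "b * a = map_mat (\<lambda>x. [:x:]) (B * A)"
    unfolding a_def b_def using map_poly_mult(1)[OF A B] map_poly_mult(1)[OF B A] by auto
  have cAB: "char_poly_matrix (A * B) = X \<cdot>\<^sub>m 1\<^sub>m n - a * b"
    unfolding ab char_poly_matrix_def X_def using A B by (intro eq_matI) auto
  have cBA: "char_poly_matrix (B * A) = X \<cdot>\<^sub>m 1\<^sub>m m - b * a"
    unfolding ba char_poly_matrix_def X_def using A B by (intro eq_matI) auto
  define M where "M = four_block_mat (X \<cdot>\<^sub>m 1\<^sub>m n) a b (1\<^sub>m m)"
  have M: "M \<in> carrier_mat (n + m) (n + m)"
    unfolding M_def using a b by auto
  \<comment> \<open>Multiplication by \<open>N\<close> from the right is a column operation that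
    clears the lower left block of \<open>M\<close> and leaves X - AB in the upper left.\<close>
  define N where "N = four_block_mat (1\<^sub>m n) (0\<^sub>m n m) (- b) (1\<^sub>m m)"
  have N: "N \<in> carrier_mat (n + m) (n + m)"
    unfolding N_def using a b by auto
  \<comment> \<open>Multiplication by \<open>L\<close> from the left clears the same block by rows
    and leaves X - BA in the lower right. The lower rows are scaled by X to avoid dividing by X,
    which costs the factor \<open>X ^ m\<close>.\<close>
  define L where "L = four_block_mat (1\<^sub>m n) (0\<^sub>m n m) (- b) (X \<cdot>\<^sub>m 1\<^sub>m m)"
  have L: "L \<in> carrier_mat (n + m) (n + m)"
    unfolding L_def using a b by auto
  have "M * N = four_block_mat (X \<cdot>\<^sub>m 1\<^sub>m n - a * b) a (0\<^sub>m m n) (1\<^sub>m m)"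
    unfolding M_def N_def using a b
    by (subst mult_four_block_mat[of _ n n _ m _ m _ _ n _ m]) 
       (auto simp: minus_add_uminus_mat[of _ n n] uminus_l_inv_mat)
  hence "det (M * N) = det (X \<cdot>\<^sub>m 1\<^sub>m n - a * b)"
    using det_four_block_mat_lower_left_zero[OF minus_carrier_mat[OF mult_carrier_mat[OF a b]] a refl one_carrier_mat]
    by simp
  moreover have "det N = 1"
    unfolding N_def using b by (subst det_four_block_mat_upper_right_zero[of _ n _ m]) auto
  ultimately have 1: "det M = char_poly (A * B)"
    using det_mult[OF M N] by (simp add: char_poly_def cAB)
  have bX: "- b * (X \<cdot>\<^sub>m 1\<^sub>m n) + X \<cdot>\<^sub>m 1\<^sub>m m * b = 0\<^sub>m m n"
    using b by (intro eq_matI) auto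
  have bam: "- b * a + X \<cdot>\<^sub>m 1\<^sub>m m * 1\<^sub>m m = X \<cdot>\<^sub>m 1\<^sub>m m - b * a"
    using a b by (intro eq_matI) (auto simp: scalar_prod_def sum_negf)
  have "L * M = four_block_mat (X \<cdot>\<^sub>m 1\<^sub>m n) a (0\<^sub>m m n) (X \<cdot>\<^sub>m 1\<^sub>m m - b * a)"
    unfolding M_def L_def
    by (subst mult_four_block_mat[OF one_carrier_mat zero_carrier_mat uminus_carrier_mat[OF b]
          smult_carrier_mat[OF one_carrier_mat] smult_carrier_mat[OF one_carrier_mat] a b one_carrier_mat],
        unfold bX bam) (use a b in simp)
  hence "det (L * M) = X ^ n * det (X \<cdot>\<^sub>m 1\<^sub>m m - b * a)"
    using det_four_block_mat_lower_left_zero[OF smult_carrier_mat[OF one_carrier_mat] a refl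
        minus_carrier_mat[OF mult_carrier_mat[OF b a]]]
    by (simp add: det_smult)
  moreover have "det L = X ^ m"
    unfolding L_def using b
    by (subst det_four_block_mat_upper_right_zero[of _ n _ m]) (auto simp: det_smult)
  ultimately have 2: "X ^ m * det M = X ^ n * char_poly (B * A)"
    using det_mult[OF L M] by (simp add: char_poly_def cBA)
  have "X ^ k = monom 1 k" for k
    by (simp add: X_def monom_altdef)
  with 1 2 show ?thesis by simp
qed

text \<open>The monomials in \<open>char_poly_mult_commute\<close> only add zero roots, and these
  contribute nothing to the entropy.\<close>

lemma vn_entropy_swap:
  assumes "finite J" "finite K"
  shows "vn_entropy J (\<lambda>j j'. \<Sum>k\<in>K. A j k * B k j') = vn_entropy K (\<lambda>k k'. \<Sum>j\<in>J. B k j * A j k')"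
proof -
  let ?A = "rect J K A" and ?B = "rect K J B"
  have c: "?A \<in> carrier_mat (card J) (card K)" "?B \<in> carrier_mat (card K) (card J)"
    by (auto simp: rect_def)
  let ?f = "\<lambda>z. Re z * log 2 (Re z)"
  have nz: "char_poly (?A * ?B) \<noteq> 0" "char_poly (?B * ?A) \<noteq> 0"
    using degree_monic_char_poly[of "?A * ?B" "card J"] degree_monic_char_poly[of "?B * ?A" "card K"] c
    by fastforce+
  have z: "(\<Sum>z\<in>#proots (monom (1::complex) n). ?f z) = 0" for n
    by (simp add: monom_altdef proots_power)
  have *: "(\<Sum>z\<in>#proots (monom 1 m * p). ?f z) = (\<Sum>z\<in>#proots p. ?f z)" if "p \<noteq> 0" for m p
    using that z[of m] by (simp add: proots_mult)
  have "(\<Sum>z\<in>#proots (char_poly (?A * ?B)). ?f z) = (\<Sum>z\<in>#proots (char_poly (?B * ?A)). ?f z)"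
    unfolding *[OF nz(1), of "card K", symmetric] *[OF nz(2), of "card J", symmetric]
      char_poly_mult_commute[OF c] ..
  thus ?thesis
    by (simp add: vn_entropy_def op_mat_eq_rect rect_mult assms)
qed

lemma vn_entropy_cong:
  assumes "finite J" "\<And>j j'. j \<in> J \<Longrightarrow> j' \<in> J \<Longrightarrow> \<rho> j j' = \<sigma> j j'"
  shows "vn_entropy J \<rho> = vn_entropy J \<sigma>"
proof -
  have "from_nat_into J i \<in> J" if "i < card J" for i
    using bij_betw_from_nat_into_finite[OF assms(1)] that by (auto simp: bij_betw_def)
  hence "op_mat J \<rho> = op_mat J \<sigma>"
    unfolding op_mat_def by (intro cong_mat) (auto simp: assms(2))
  thus ?thesis by (simp add: vn_entropy_def)
qed

lemma vn_entropy_transpose: "vn_entropy J (\<lambda>j j'. \<rho> j' j) = vn_entropy J \<rho>"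
proof -
  have "op_mat J (\<lambda>j j'. \<rho> j' j) = transpose_mat (op_mat J \<rho>)"
    by (rule eq_matI) (auto simp: op_mat_def)
  moreover have "op_mat J \<rho> \<in> carrier_mat (card J) (card J)"
    by (simp add: op_mat_def)
  ultimately show ?thesis by (simp add: vn_entropy_def)
qed

text \<open>\<open>M\<close> holds the amplitudes of a bipartite pure vector. One marginal is
  \<open>M\<close> times its adjoint, the other is the transpose of the product in the reverse
  order, so their entropies agree.\<close>

lemma vn_entropy_pure:
  assumes "finite J" "finite K"
  shows "vn_entropy J (\<lambda>j j'. \<Sum>k\<in>K. M j k * cnj (M j' k)) =
         vn_entropy K (\<lambda>k k'. \<Sum>j\<in>J. M j k * cnj (M j k'))"
  using vn_entropy_swap[OF assms, of M "\<lambda>k j. cnj (M j k)"]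
    vn_entropy_transpose[of K "\<lambda>k k'. \<Sum>j\<in>J. M j k * cnj (M j k')"]
  by (simp add: mult.commute)

lemma sum_mset_image_sum:
  fixes f :: "'a \<Rightarrow> 'b::comm_monoid_add"
  shows "(\<Sum>z\<in>#(\<Sum>i\<in>I. M i). f z) = (\<Sum>i\<in>I. \<Sum>z\<in>#M i. f z)"
  by (induction I rule: infinite_finite_induct) auto

lemma vn_entropy_diag:
  assumes "finite K"
  shows "vn_entropy K (\<lambda>k k'. if k = k' then of_real (l k) else 0) = - (\<Sum>k\<in>K. l k * log 2 (l k))"
proof -
  let ?D = "op_mat K (\<lambda>k k'. if k = k' then complex_of_real (l k) else 0)"
  let ?e = "from_nat_into K"
  have bij: "bij_betw ?e {..<card K} K"
    by (rule bij_betw_from_nat_into_finite[OF assms])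
  have inj: "?e i = ?e j \<longleftrightarrow> i = j" if "i < card K" "j < card K" for i j
    using bij that by (auto simp: bij_betw_def inj_on_def)
  have D: "?D \<in> carrier_mat (card K) (card K)" by (simp add: op_mat_def)
  have "upper_triangular ?D"
    unfolding upper_triangular_def by (auto simp: op_mat_def inj)
  hence "char_poly ?D = (\<Prod>a\<leftarrow>diag_mat ?D. [:- a, 1:])"
    by (rule char_poly_upper_triangular[OF D])
  also have "diag_mat ?D = map (\<lambda>i. of_real (l (?e i))) [0..<card K]"
    by (auto simp: diag_mat_def op_mat_def)
  also have "(\<Prod>a\<leftarrow>\<dots>. [:- a, 1:]) = (\<Prod>i<card K. [:- complex_of_real (l (?e i)), 1:])"
    by (simp add: prod.list_conv_set_nth lessThan_atLeast0 o_def)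
  finally have cp: "char_poly ?D = (\<Prod>i<card K. [:- complex_of_real (l (?e i)), 1:])" .
  have "(\<Sum>z\<in>#proots (char_poly ?D). Re z * log 2 (Re z)) = (\<Sum>i<card K. l (?e i) * log 2 (l (?e i)))"
    unfolding cp by (subst proots_prod) (auto simp: sum_mset_image_sum)
  thus ?thesis
    by (simp add: vn_entropy_def sum_from_nat_into[OF assms, of "\<lambda>k. l k * log 2 (l k)"])
qed

section \<open>Diagonalization of Hermitian matrices\<close>

definition mm :: "'j set \<Rightarrow> ('i \<Rightarrow> 'j \<Rightarrow> complex) \<Rightarrow> ('j \<Rightarrow> 'k \<Rightarrow> complex) \<Rightarrow> 'i \<Rightarrow> 'k \<Rightarrow> complex" where
  "mm J A B = (\<lambda>i k. \<Sum>j\<in>J. A i j * B j k)"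

definition adj :: "('i \<Rightarrow> 'j \<Rightarrow> complex) \<Rightarrow> 'j \<Rightarrow> 'i \<Rightarrow> complex" where
  "adj A = (\<lambda>j i. cnj (A i j))"

definition idm :: "'j set \<Rightarrow> 'j \<Rightarrow> 'j \<Rightarrow> complex" where
  "idm J = (\<lambda>i j. if i = j \<and> i \<in> J then 1 else 0)"

text \<open>Forcing the entries outside J to vanish turns equality of operators on J into equality
  of functions, so that products can be rewritten without side conditions on indices.\<close>

definition supported :: "'j set \<Rightarrow> ('j \<Rightarrow> 'j \<Rightarrow> complex) \<Rightarrow> bool" where
  "supported J A \<longleftrightarrow> (\<forall>i j. i \<notin> J \<or> j \<notin> J \<longrightarrow> A i j = 0)"

lemma mm_assoc: "mm K (mm J A B) C = mm J A (mm K B C)"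
proof (intro ext)
  fix i l
  show "mm K (mm J A B) C i l = mm J A (mm K B C) i l"
    unfolding mm_def sum_distrib_left sum_distrib_right
    by (subst sum.swap) (simp add: mult.assoc)
qed

lemma adj_mm: "adj (mm J A B) = mm J (adj B) (adj A)"
  by (simp add: adj_def mm_def mult.commute)

lemma adj_adj [simp]: "adj (adj A) = A"
  by (simp add: adj_def)

lemma supported_mm: "supported J A \<Longrightarrow> supported J B \<Longrightarrow> supported J (mm J A B)"
  by (auto simp: supported_def mm_def)

lemma supported_adj: "supported J A \<Longrightarrow> supported J (adj A)"
  by (auto simp: supported_def adj_def)

lemma mm_idm_left:
  assumes "finite J" "supported J A"
  shows "mm J (idm J) A = A"
proof (intro ext)
  fix i k
  have "mm J (idm J) A i k = (\<Sum>j\<in>J. if i = j then A j k else 0)"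
    unfolding mm_def by (intro sum.cong) (auto simp: idm_def)
  thus "mm J (idm J) A i k = A i k"
    using assms by (auto simp: supported_def)
qed

lemma mm_idm_right:
  assumes "finite J" "supported J A"
  shows "mm J A (idm J) = A"
proof (intro ext)
  fix i k
  have "mm J A (idm J) i k = (\<Sum>j\<in>J. if k = j then A i j else 0)"
    unfolding mm_def by (intro sum.cong) (auto simp: idm_def)
  thus "mm J A (idm J) i k = A i k"
    using assms by (auto simp: supported_def)
qed

lemma exists_eigenvector:
  fixes \<rho> :: "'j \<Rightarrow> 'j \<Rightarrow> complex"
  assumes "finite J" "J \<noteq> {}"
  shows "\<exists>e x. (\<exists>j\<in>J. x j \<noteq> 0) \<and> (\<forall>j. j \<notin> J \<longrightarrow> x j = 0) \<and> (\<forall>j\<in>J. (\<Sum>k\<in>J. \<rho> j k * x k) = e * x j)"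
proof -
  let ?n = "card J" and ?f = "from_nat_into J"
  have bij: "bij_betw ?f {..<?n} J"
    by (rule bij_betw_from_nat_into_finite[OF assms(1)])
  have A: "op_mat J \<rho> \<in> carrier_mat ?n ?n" by (simp add: op_mat_def)
  have "degree (char_poly (op_mat J \<rho>)) = ?n"
    using degree_monic_char_poly[OF A] by simp
  hence "\<not> constant (poly (char_poly (op_mat J \<rho>)))"
    using assms by (simp add: constant_degree card_gt_0_iff)
  then obtain e where "poly (char_poly (op_mat J \<rho>)) e = 0"
    using fundamental_theorem_of_algebra by blast
  hence "eigenvalue (op_mat J \<rho>) e"
    using eigenvalue_root_char_poly[OF A] by simp
  then obtain v where v: "v \<in> carrier_vec ?n" "v \<noteq> 0\<^sub>v ?n" "op_mat J \<rho> *\<^sub>v v = e \<cdot>\<^sub>v v"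
    using A by (auto simp: eigenvalue_def eigenvector_def)
  define g where "g = the_inv_into {..<?n} ?f"
  have g: "g (?f i) = i" if "i < ?n" for i
    unfolding g_def using that by (intro the_inv_into_f_f[OF bij_betw_imp_inj_on[OF bij]]) simp
  have fg: "g j < ?n" "?f (g j) = j" if "j \<in> J" for j
  proof -
    have "j \<in> ?f ` {..<?n}" using that bij_betw_imp_surj_on[OF bij] by simp
    then obtain i where "i < ?n" "j = ?f i" by blast
    thus "g j < ?n" "?f (g j) = j" by (simp_all add: g)
  qed
  define x where "x j = (if j \<in> J then vec_index v (g j) else 0)" for j
  have xf: "x (?f i) = vec_index v i" if "i < ?n" for i
    using that g bij_betwE[OF bij] by (simp add: x_def)
  obtain i where i: "i < ?n" "vec_index v i \<noteq> 0"
    using v(1,2) by (metis carrier_vecD eq_vecI index_zero_vec)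
  have "\<exists>j\<in>J. x j \<noteq> 0"
    using i xf[of i] bij_betwE[OF bij] by (intro bexI[of _ "?f i"]) auto
  moreover have "(\<Sum>k\<in>J. \<rho> j k * x k) = e * x j" if j: "j \<in> J" for j
  proof -
    have "(\<Sum>k\<in>J. \<rho> j k * x k) = (\<Sum>i<?n. \<rho> j (?f i) * x (?f i))"
      by (rule sum.reindex_bij_betw[OF bij, symmetric])
    also have "\<dots> = (\<Sum>i<?n. \<rho> (?f (g j)) (?f i) * vec_index v i)"
      using fg[OF j] xf by (intro sum.cong) auto
    also have "\<dots> = vec_index (op_mat J \<rho> *\<^sub>v v) (g j)"
      using fg[OF j] v(1) by (auto simp: op_mat_def scalar_prod_def lessThan_atLeast0)
    also have "\<dots> = e * x j"
      using fg[OF j] v(1) j by (simp add: v(3) x_def)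
    finally show ?thesis .
  qed
  ultimately show ?thesis
    by (intro exI[of _ e] exI[of _ x]) (auto simp: x_def)
qed

text \<open>The witness is a Householder reflection.\<close>

lemma exists_unitary_with_column:
  assumes J: "finite J" "j0 \<in> J" and x: "\<And>j. j \<notin> J \<Longrightarrow> x j = 0"
    and unit: "(\<Sum>j\<in>J. (cmod (x j))\<^sup>2) = 1" and real: "x j0 \<in> \<real>"
  shows "\<exists>W. supported J W \<and> adj W = W \<and> mm J W W = idm J \<and> (\<forall>i. W i j0 = x i)"
proof -
  define w where "w i = x i - (if i = j0 then 1 else 0)" for i
  define N where "N = (\<Sum>j\<in>J. w j * cnj (w j))"
  define W where "W i j = (if i \<in> J \<and> j \<in> J then (if i = j then 1 else 0) - 2 * w i * cnj (w j) / N else 0)" for i j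
  have N': "N = of_real (\<Sum>j\<in>J. (cmod (w j))\<^sup>2)"
    by (simp only: N_def complex_norm_square of_real_sum)
  have cN: "cnj N = N" by (simp add: N')
  have "supported J W" by (auto simp: supported_def W_def)
  moreover have "adj W = W"
    by (intro ext) (auto simp: adj_def W_def cN)
  moreover have "mm J W W = idm J"
  proof (intro ext)
    fix i k
    show "mm J W W i k = idm J i k"
    proof (cases "i \<in> J \<and> k \<in> J")
      case True
      \<comment> \<open>If N = 0 then also a = 0 by the convention for division, so
        \<open>a * a * N = 2 * a\<close> holds in every case.\<close>
      define a where "a = 2 / N"
      have Wa: "W i j = (if i = j then 1 else 0) - a * w i * cnj (w j)" if "i \<in> J" "j \<in> J" for i j
        using that by (simp add: W_def a_def)
      have "mm J W W i k = (\<Sum>j\<in>J. (if i = j then if j = k then 1 else 0 else 0)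
           - (if i = j then a * w i * cnj (w k) else 0) - (if j = k then a * w i * cnj (w k) else 0)
           + a * a * w i * cnj (w k) * (w j * cnj (w j)))"
        unfolding mm_def using True by (intro sum.cong) (auto simp: Wa algebra_simps)
      also have "\<dots> = (if i = k then 1 else 0) - 2 * a * w i * cnj (w k)
           + a * a * w i * cnj (w k) * N"
        using J True by (simp add: sum.distrib sum_subtractf sum_distrib_left[symmetric] N_def[symmetric])
      also have "\<dots> = idm J i k"
        using True by (auto simp: idm_def a_def)
      finally show ?thesis .
    qed (auto simp: mm_def W_def idm_def intro!: sum.neutral)
  qed
  moreover have "W i j0 = x i" for i
  proof (cases "i \<in> J")
    case True
    \<comment> \<open>The reflection along x - e, with e the basis vector of \<open>j0\<close>,
      exchanges the unit vectors x and e because their inner product is real.\<close>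
    obtain r where r: "x j0 = of_real r" using real by (auto elim: Reals_cases)
    have "(\<Sum>j\<in>J. (cmod (w j))\<^sup>2) = (\<Sum>j\<in>J. (cmod (x j))\<^sup>2 + (if j = j0 then 1 - 2 * r else 0))"
    proof (intro sum.cong refl)
      fix j show "(cmod (w j))\<^sup>2 = (cmod (x j))\<^sup>2 + (if j = j0 then 1 - 2 * r else 0)"
        by (simp add: w_def r cmod_power2) (simp add: power2_eq_square algebra_simps)
    qed
    also have "\<dots> = 2 - 2 * r"
      using J unit by (simp add: sum.distrib)
    finally have sN: "(\<Sum>j\<in>J. (cmod (w j))\<^sup>2) = 2 - 2 * r" .
    have NN: "N = of_real (2 - 2 * r)" unfolding N' sN ..
    show ?thesis
    proof (cases "r = 1")
      \<comment> \<open>Here x is the basis vector itself, w vanishes, and the degenerate reflection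
        is the identity.\<close>
      case True
      hence "(cmod (w i))\<^sup>2 = 0"
        using sN J \<open>i \<in> J\<close> by (simp add: sum_nonneg_eq_0_iff)
      thus ?thesis using \<open>i \<in> J\<close> J by (auto simp: W_def w_def split: if_splits)
    next
      case False
      hence "2 - 2 * complex_of_real r \<noteq> 0"
        by (metis diff_eq_diff_eq mult_cancel_left1 mult_cancel_left of_real_eq_1_iff right_minus_eq zero_neq_numeral)
      moreover have "W i j0 = (if i = j0 then 1 else 0) - w i * (2 * (of_real r - 1) / (2 - 2 * of_real r))"
        using True J by (simp add: W_def NN w_def r)
      moreover have "2 * (of_real r - 1) / (2 - 2 * of_real r) = (- 1 :: complex)"
        using calculation(1) by (simp add: divide_eq_eq)
      ultimately have "W i j0 = (if i = j0 then 1 else 0) - w i * (- 1)"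
        by (simp only:)
      thus ?thesis by (simp add: w_def)
    qed
  qed (use x in \<open>auto simp: W_def\<close>)
  ultimately show ?thesis by blast
qed

text \<open>Deflation. Conjugation by a self-adjoint unitary whose column \<open>j0\<close> is a
  unit eigenvector makes column \<open>j0\<close> diagonal; hermiticity does the same for the row,
  and the remaining block falls under the induction hypothesis.\<close>

lemma hermitian_diagonalization:
  assumes "finite J" "supported J \<rho>" "adj \<rho> = \<rho>"
  shows "\<exists>U l. supported J U \<and> mm J (adj U) U = idm J \<and> mm J U (adj U) = idm J \<and>
    \<rho> = (\<lambda>i j. \<Sum>k\<in>J. of_real (l k) * U i k * cnj (U j k))"
  using assms
proof (induction J arbitrary: \<rho> rule: finite_induct)
  case empty
  thus ?case
    by (intro exI[of _ "\<lambda>_ _. 0"] exI[of _ "\<lambda>_. 0"]) (auto simp: supported_def mm_def idm_def fun_eq_iff)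
next
  case (insert j0 F)
  let ?J = "insert j0 F"
  have fin: "finite ?J" using insert by auto
  obtain e x0 where x0: "\<exists>j\<in>?J. x0 j \<noteq> 0" "\<And>j. j \<notin> ?J \<Longrightarrow> x0 j = 0"
      "\<And>j. j \<in> ?J \<Longrightarrow> (\<Sum>k\<in>?J. \<rho> j k * x0 k) = e * x0 j"
    using exists_eigenvector[of ?J \<rho>] fin by blast
  define n where "n = sqrt (\<Sum>j\<in>?J. (cmod (x0 j))\<^sup>2)"
  have n2: "(\<Sum>j\<in>?J. (cmod (x0 j))\<^sup>2) > 0"
  proof -
    obtain j where "j \<in> ?J" "x0 j \<noteq> 0" using x0(1) by blast
    thus ?thesis by (intro sum_pos2[OF fin, of j]) auto
  qed
  hence n: "n > 0" by (simp add: n_def)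
  \<comment> \<open>This phase makes entry \<open>j0\<close> of the eigenvector real, as the
    reflection requires.\<close>
  define ph where "ph = (if x0 j0 = 0 then 1 else cnj (x0 j0) / cmod (x0 j0))"
  have ph: "cmod ph = 1" by (simp add: ph_def norm_divide)
  define x where "x j = ph / n * x0 j" for j
  have x: "x j = 0" if "j \<notin> ?J" for j using x0(2)[OF that] by (simp add: x_def)
  have unit: "(\<Sum>j\<in>?J. (cmod (x j))\<^sup>2) = 1"
  proof -
    have "(\<Sum>j\<in>?J. (cmod (x j))\<^sup>2) = (\<Sum>j\<in>?J. (1 / n\<^sup>2) * (cmod (x0 j))\<^sup>2)"
      using n by (simp only: x_def norm_mult norm_divide ph) (simp add: power_divide)
    also have "\<dots> = 1"
      unfolding sum_distrib_left[symmetric] using n2 by (simp add: n_def)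
    finally show ?thesis .
  qed
  have real: "x j0 \<in> \<real>"
  proof (cases "x0 j0 = 0")
    case False
    hence "x j0 = of_real ((cmod (x0 j0))\<^sup>2 / (cmod (x0 j0) * n))"
      by (simp only: x_def ph_def of_real_divide complex_norm_square) (simp add: mult.commute)
    thus ?thesis by (metis Reals_of_real)
  qed (simp add: x_def)
  have ev: "(\<Sum>k\<in>?J. \<rho> j k * x k) = e * x j" for j
  proof (cases "j \<in> ?J")
    case True
    have "(\<Sum>k\<in>?J. \<rho> j k * x k) = ph / n * (\<Sum>k\<in>?J. \<rho> j k * x0 k)"
      unfolding sum_distrib_left by (intro sum.cong) (auto simp: x_def)
    thus ?thesis by (simp only: x0(3)[OF True]) (simp add: x_def)
  next
    case False
    hence "\<rho> j k = 0" for k using insert.prems(1) by (auto simp: supported_def)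
    thus ?thesis using x[OF False] by simp
  qed
  obtain W where W: "supported ?J W" "adj W = W" "mm ?J W W = idm ?J" "\<And>i. W i j0 = x i"
    using exists_unitary_with_column[OF fin insertI1 x unit real] by blast
  define B where "B = mm ?J W (mm ?J \<rho> W)"
  have sB: "supported ?J B" unfolding B_def by (intro supported_mm W insert.prems)
  have hB: "adj B = B"
    unfolding B_def by (simp add: adj_mm W(2) insert.prems(2) mm_assoc)
  have col: "B i j0 = (if i = j0 then e else 0)" for i
  proof -
    have "mm ?J \<rho> W k j0 = e * W k j0" for k
      unfolding mm_def W(4) by (rule ev)
    hence "B i j0 = e * mm ?J W W i j0"
      unfolding B_def by (subst (1 2) mm_def) (simp add: sum_distrib_left algebra_simps del: sum.insert)
    thus ?thesis by (simp add: W(3) idm_def)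
  qed
  have hB': "B j i = cnj (B i j)" for i j
    using fun_cong[OF fun_cong[OF hB, of j], of i] by (simp add: adj_def)
  have row: "B j0 i = (if i = j0 then e else 0)" for i
  proof (cases "i = j0")
    case False
    thus ?thesis using hB'[of j0 i] col[of i] by simp
  qed (use col in auto)
  \<comment> \<open>The eigenvalue is now a diagonal entry of the Hermitian \<open>B\<close>, hence
    real.\<close>
  have e: "e = of_real (Re e)"
  proof -
    have "e = cnj e" using hB'[of j0 j0] unfolding col by simp
    thus ?thesis by (metis Reals_cnj_iff of_real_Re)
  qed
  define B' where "B' i j = (if i \<in> F \<and> j \<in> F then B i j else 0)" for i j
  have "supported F B'" "adj B' = B'"
    by (auto simp: supported_def B'_def adj_def fun_eq_iff hB'[symmetric])
  from insert.IH[OF this] obtain U l where U: "supported F U" "mm F (adj U) U = idm F" "mm F U (adj U) = idm F"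
      and B': "B' = (\<lambda>i j. \<Sum>k\<in>F. of_real (l k) * U i k * cnj (U j k))" by blast
  define V where "V i j = (if i = j0 \<and> j = j0 then 1 else U i j)" for i j
  have U0: "U j0 j = 0" "U j j0 = 0" for j
    using U(1) insert.hyps by (auto simp: supported_def)
  have sV: "supported ?J V" using U(1) by (auto simp: supported_def V_def)
  have V1: "mm ?J (adj V) V = idm ?J"
  proof (intro ext)
    fix i j
    have "mm ?J (adj V) V i j = cnj (V j0 i) * V j0 j + (\<Sum>k\<in>F. cnj (V k i) * V k j)"
      using insert.hyps by (simp add: mm_def adj_def)
    also have "(\<Sum>k\<in>F. cnj (V k i) * V k j) = mm F (adj U) U i j"
      unfolding mm_def adj_def using insert.hyps by (intro sum.cong) (auto simp: V_def)
    also have "cnj (V j0 i) * V j0 j + mm F (adj U) U i j = idm ?J i j"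
      unfolding U(2) using U0 insert.hyps by (auto simp: V_def idm_def)
    finally show "mm ?J (adj V) V i j = idm ?J i j" .
  qed
  have V2: "mm ?J V (adj V) = idm ?J"
  proof (intro ext)
    fix i j
    have "mm ?J V (adj V) i j = V i j0 * cnj (V j j0) + (\<Sum>k\<in>F. V i k * cnj (V j k))"
      using insert.hyps by (simp add: mm_def adj_def)
    also have "(\<Sum>k\<in>F. V i k * cnj (V j k)) = mm F U (adj U) i j"
      unfolding mm_def adj_def using insert.hyps by (intro sum.cong) (auto simp: V_def)
    also have "V i j0 * cnj (V j j0) + mm F U (adj U) i j = idm ?J i j"
      unfolding U(3) using U0 insert.hyps by (auto simp: V_def idm_def)
    finally show "mm ?J V (adj V) i j = idm ?J i j" .
  qed
  define m where "m = l(j0 := Re e)"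
  define D where "D i j = (if i = j \<and> i \<in> ?J then complex_of_real (m i) else 0)" for i j
  have VD: "mm ?J A D i k * cnj (C j k) = of_real (m k) * A i k * cnj (C j k)" if "k \<in> ?J" for A C i j k
  proof -
    have "mm ?J A D i k = (\<Sum>j\<in>?J. if k = j then A i j * of_real (m j) else 0)"
      unfolding mm_def using that by (intro sum.cong) (auto simp: D_def)
    thus ?thesis using fin that by simp
  qed
  have VDV: "mm ?J (mm ?J A D) (adj C) = (\<lambda>i j. \<Sum>k\<in>?J. of_real (m k) * A i k * cnj (C j k))" for A C :: "_ \<Rightarrow> _ \<Rightarrow> complex"
    by (intro ext, subst mm_def, unfold adj_def, intro sum.cong refl VD)
  have "B = mm ?J (mm ?J V D) (adj V)"
  proof (intro ext)
    fix i j
    have "(\<Sum>k\<in>?J. of_real (m k) * V i k * cnj (V j k)) =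
        of_real (Re e) * V i j0 * cnj (V j j0) + (\<Sum>k\<in>F. of_real (m k) * V i k * cnj (V j k))"
      using insert.hyps by (simp add: m_def)
    also have "(\<Sum>k\<in>F. of_real (m k) * V i k * cnj (V j k)) = B' i j"
      unfolding B' using insert.hyps by (intro sum.cong) (auto simp: V_def m_def)
    also have "of_real (Re e) * V i j0 * cnj (V j j0) + B' i j = B i j"
      using row col sB insert.hyps U0 by (auto simp: e[symmetric] V_def B'_def supported_def)
    finally show "B i j = mm ?J (mm ?J V D) (adj V) i j"
      unfolding VDV by simp
  qed
  moreover have "\<rho> = mm ?J W (mm ?J B W)"
  proof -
    have "mm ?J W (mm ?J B W) = mm ?J (mm ?J W W) (mm ?J \<rho> (mm ?J W W))"
      unfolding B_def mm_assoc ..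
    thus ?thesis
      using fin insert.prems(1) by (simp add: W(3) mm_idm_left mm_idm_right)
  qed
  ultimately have "\<rho> = mm ?J (mm ?J (mm ?J W V) D) (adj (mm ?J W V))"
    by (simp add: adj_mm W(2) mm_assoc)
  moreover have "mm ?J (adj (mm ?J W V)) (mm ?J W V) = idm ?J"
  proof -
    have "mm ?J (adj (mm ?J W V)) (mm ?J W V) = mm ?J (adj V) (mm ?J (mm ?J W W) V)"
      unfolding adj_mm W(2) mm_assoc ..
    thus ?thesis by (simp add: W(3) mm_idm_left[OF fin sV] V1)
  qed
  moreover have "mm ?J (mm ?J W V) (adj (mm ?J W V)) = idm ?J"
  proof -
    have "mm ?J (mm ?J W V) (adj (mm ?J W V)) = mm ?J W (mm ?J (mm ?J V (adj V)) W)"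
      unfolding adj_mm W(2) mm_assoc ..
    thus ?thesis by (simp add: V2 mm_idm_left[OF fin W(1)] W(3))
  qed
  ultimately show ?case
    unfolding VDV using supported_mm[OF W(1) sV] by (intro exI[of _ "mm ?J W V"] exI[of _ m]) blast
qed

section \<open>Unitaries, spectral form and traces\<close>

definition unitary :: "'j set \<Rightarrow> ('j \<Rightarrow> 'j \<Rightarrow> complex) \<Rightarrow> bool" where
  "unitary J U \<longleftrightarrow> supported J U \<and> mm J (adj U) U = idm J \<and> mm J U (adj U) = idm J"

definition diagm :: "'j set \<Rightarrow> ('j \<Rightarrow> real) \<Rightarrow> 'j \<Rightarrow> 'j \<Rightarrow> complex" where
  "diagm J l = (\<lambda>i j. if i = j \<and> i \<in> J then of_real (l i) else 0)"

definition eig :: "'j set \<Rightarrow> ('j \<Rightarrow> 'j \<Rightarrow> complex) \<Rightarrow> ('j \<Rightarrow> real) \<Rightarrow> 'j \<Rightarrow> 'j \<Rightarrow> complex" where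
  "eig J U l = mm J U (mm J (diagm J l) (adj U))"

definition tr :: "'j set \<Rightarrow> ('j \<Rightarrow> 'j \<Rightarrow> complex) \<Rightarrow> complex" where
  "tr J A = (\<Sum>i\<in>J. A i i)"

lemma diagm_mm:
  assumes "finite J"
  shows "mm J (diagm J l) A = (\<lambda>i k. if i \<in> J then of_real (l i) * A i k else 0)"
proof (intro ext)
  fix i k
  have "mm J (diagm J l) A i k = (\<Sum>j\<in>J. if i = j then of_real (l j) * A j k else 0)"
    unfolding mm_def by (intro sum.cong) (auto simp: diagm_def)
  thus "mm J (diagm J l) A i k = (if i \<in> J then of_real (l i) * A i k else 0)"
    using assms by simp
qed

lemma mm_diagm:
  assumes "finite J"
  shows "mm J A (diagm J l) = (\<lambda>i k. if k \<in> J then of_real (l k) * A i k else 0)"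
proof (intro ext)
  fix i k
  have "mm J A (diagm J l) i k = (\<Sum>j\<in>J. if k = j then of_real (l j) * A i j else 0)"
    unfolding mm_def by (intro sum.cong) (auto simp: diagm_def)
  thus "mm J A (diagm J l) i k = (if k \<in> J then of_real (l k) * A i k else 0)"
    using assms by simp
qed

lemma eig_apply:
  assumes "finite J"
  shows "eig J U l i j = (\<Sum>k\<in>J. of_real (l k) * U i k * cnj (U j k))"
  unfolding eig_def diagm_mm[OF assms] by (auto simp: mm_def adj_def intro!: sum.cong)

lemma tr_mm_commute: "tr J (mm J A B) = tr J (mm J B A)"
  unfolding tr_def mm_def by (subst sum.swap) (simp add: mult.commute)

lemma supported_idm [simp]: "supported J (idm J)"
  and supported_diagm [simp]: "supported J (diagm J l)"
  by (auto simp: supported_def idm_def diagm_def)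

lemma supported_eig: "supported J U \<Longrightarrow> supported J (eig J U l)"
  unfolding eig_def by (intro supported_mm supported_adj supported_diagm)

lemma unitary_mm:
  assumes "finite J" "unitary J U" "unitary J V"
  shows "unitary J (mm J (adj U) V)"
proof -
  have "mm J (adj (mm J (adj U) V)) (mm J (adj U) V) = mm J (adj V) (mm J (mm J U (adj U)) V)"
    by (simp only: adj_mm adj_adj mm_assoc)
  moreover have "mm J (mm J (adj U) V) (adj (mm J (adj U) V)) = mm J (adj U) (mm J (mm J V (adj V)) U)"
    by (simp only: adj_mm adj_adj mm_assoc)
  ultimately show ?thesis
    using assms by (simp add: unitary_def supported_mm supported_adj mm_idm_left)
qed

text \<open>Together with the column version this says that the squared overlaps of two orthonormal
  bases form a doubly stochastic matrix, which collapses the double sums in the relative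
  entropy.\<close>

lemma unitary_row_sum:
  assumes "unitary J G" "i \<in> J"
  shows "(\<Sum>j\<in>J. (cmod (G i j))\<^sup>2) = 1"
proof -
  have "complex_of_real (\<Sum>j\<in>J. (cmod (G i j))\<^sup>2) = mm J G (adj G) i i"
    by (simp only: mm_def adj_def of_real_sum complex_norm_square)
  also have "\<dots> = 1" using assms by (simp add: unitary_def idm_def)
  finally show ?thesis by (metis of_real_eq_1_iff)
qed

lemma unitary_column_sum:
  assumes "unitary J G" "j \<in> J"
  shows "(\<Sum>i\<in>J. (cmod (G i j))\<^sup>2) = 1"
proof -
  have "complex_of_real (\<Sum>i\<in>J. (cmod (G i j))\<^sup>2) = mm J (adj G) G j j"
    by (simp only: mm_def adj_def of_real_sum complex_norm_square) (simp only: mult.commute)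
  also have "\<dots> = 1" using assms by (simp add: unitary_def idm_def)
  finally show ?thesis by (metis of_real_eq_1_iff)
qed

lemma tr_eig:
  assumes "finite J" "unitary J U"
  shows "tr J (eig J U l) = of_real (\<Sum>i\<in>J. l i)"
proof -
  have "tr J (eig J U l) = tr J (mm J (diagm J l) (mm J (adj U) U))"
    unfolding eig_def by (subst tr_mm_commute) (simp only: mm_assoc)
  also have "\<dots> = tr J (diagm J l)"
    using assms by (simp add: unitary_def mm_idm_right)
  finally show ?thesis by (simp add: tr_def diagm_def)
qed

text \<open>The vectors \<open>v k\<close> are the columns of an isometry from K into J. Moving it
  to the other side with \<open>vn_entropy_swap\<close> leaves the diagonal operator of the weights,
  so the family may be smaller than a basis of J.\<close>

lemma vn_entropy_orthonormal:
  assumes J: "finite J" and K: "finite K"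
    and on: "\<And>k l. k \<in> K \<Longrightarrow> l \<in> K \<Longrightarrow> (\<Sum>j\<in>J. cnj (v k j) * v l j) = (if k = l then 1 else 0)"
    and \<rho>: "\<And>i j. i \<in> J \<Longrightarrow> j \<in> J \<Longrightarrow> \<rho> i j = (\<Sum>k\<in>K. of_real (l k) * v k i * cnj (v k j))"
  shows "vn_entropy J \<rho> = - (\<Sum>k\<in>K. l k * log 2 (l k))"
proof -
  have "vn_entropy J \<rho> = vn_entropy J (\<lambda>i j. \<Sum>k\<in>K. (of_real (l k) * v k i) * cnj (v k j))"
    by (intro vn_entropy_cong J) (simp add: \<rho>)
  also have "\<dots> = vn_entropy K (\<lambda>k k'. \<Sum>j\<in>J. cnj (v k j) * (of_real (l k') * v k' j))"
    by (rule vn_entropy_swap[OF J K])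
  also have "\<dots> = vn_entropy K (\<lambda>k k'. if k = k' then of_real (l k) else 0)"
  proof (intro vn_entropy_cong K)
    fix k k' assume "k \<in> K" "k' \<in> K"
    have "(\<Sum>j\<in>J. cnj (v k j) * (of_real (l k') * v k' j)) = of_real (l k') * (\<Sum>j\<in>J. cnj (v k j) * v k' j)"
      unfolding sum_distrib_left by (intro sum.cong) auto
    thus "(\<Sum>j\<in>J. cnj (v k j) * (of_real (l k') * v k' j)) = (if k = k' then of_real (l k) else 0)"
      using \<open>k \<in> K\<close> \<open>k' \<in> K\<close> by (simp add: on)
  qed
  also have "\<dots> = - (\<Sum>k\<in>K. l k * log 2 (l k))"
    by (rule vn_entropy_diag[OF K])
  finally show ?thesis .
qed

lemma vn_entropy_eig:
  assumes "finite J" "unitary J U"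
  shows "vn_entropy J (eig J U l) = - (\<Sum>k\<in>J. l k * log 2 (l k))"
proof (rule vn_entropy_orthonormal[OF assms(1,1), of "\<lambda>k j. U j k"])
  fix k l assume "k \<in> J" "l \<in> J"
  have "(\<Sum>j\<in>J. cnj (U j k) * U j l) = mm J (adj U) U k l" by (simp add: mm_def adj_def)
  thus "(\<Sum>j\<in>J. cnj (U j k) * U j l) = (if k = l then 1 else 0)"
    using assms \<open>k \<in> J\<close> by (simp add: unitary_def idm_def)
qed (simp add: eig_apply assms)

section \<open>Positive semidefinite operators\<close>

definition psd :: "'j set \<Rightarrow> ('j \<Rightarrow> 'j \<Rightarrow> complex) \<Rightarrow> bool" where
  "psd J \<rho> \<longleftrightarrow> (\<forall>i\<in>J. \<forall>j\<in>J. cnj (\<rho> i j) = \<rho> j i) \<and>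
     (\<forall>x. 0 \<le> Re (\<Sum>i\<in>J. \<Sum>j\<in>J. cnj (x i) * \<rho> i j * x j))"

lemma psd_gram:
  assumes "finite J" "\<And>i j. i \<in> J \<Longrightarrow> j \<in> J \<Longrightarrow> \<rho> i j = (\<Sum>s\<in>S. of_real (w s) * f s i * cnj (f s j))"
    and w: "\<And>s. s \<in> S \<Longrightarrow> 0 \<le> w s"
  shows "psd J \<rho>"
  unfolding psd_def
proof (intro conjI ballI allI)
  fix i j assume "i \<in> J" "j \<in> J"
  thus "cnj (\<rho> i j) = \<rho> j i"
    by (simp add: assms(2) mult.commute mult.left_commute)
next
  fix x
  have "(\<Sum>i\<in>J. \<Sum>j\<in>J. cnj (x i) * \<rho> i j * x j) =
      (\<Sum>i\<in>J. \<Sum>j\<in>J. \<Sum>s\<in>S. of_real (w s) * ((cnj (x i) * f s i) * (x j * cnj (f s j))))"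
    by (intro sum.cong refl) (simp add: assms(2) sum_distrib_left sum_distrib_right mult_ac)
  also have "\<dots> = (\<Sum>i\<in>J. \<Sum>s\<in>S. \<Sum>j\<in>J. of_real (w s) * ((cnj (x i) * f s i) * (x j * cnj (f s j))))"
    by (intro sum.cong refl sum.swap)
  also have "\<dots> = (\<Sum>s\<in>S. \<Sum>i\<in>J. \<Sum>j\<in>J. of_real (w s) * ((cnj (x i) * f s i) * (x j * cnj (f s j))))"
    by (rule sum.swap)
  also have "\<dots> = (\<Sum>s\<in>S. of_real (w s) * ((\<Sum>i\<in>J. cnj (x i) * f s i) * cnj (\<Sum>i\<in>J. cnj (x i) * f s i)))"
    by (intro sum.cong refl) (simp only: cnj_sum sum_product complex_cnj_mult complex_cnj_cnj, simp only: sum_distrib_left)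
  also have "\<dots> = of_real (\<Sum>s\<in>S. w s * (cmod (\<Sum>i\<in>J. cnj (x i) * f s i))\<^sup>2)"
    by (simp only: complex_norm_square[symmetric] of_real_sum of_real_mult)
  finally show "0 \<le> Re (\<Sum>i\<in>J. \<Sum>j\<in>J. cnj (x i) * \<rho> i j * x j)"
    using w by (auto intro!: sum_nonneg)
qed

lemma psd_diagonalization:
  assumes J: "finite J" and "psd J \<rho>" "supported J \<rho>"
  obtains U l where "unitary J U" "\<And>k. k \<in> J \<Longrightarrow> 0 \<le> l k" "\<rho> = eig J U l"
proof -
  have "adj \<rho> = \<rho>"
  proof (intro ext)
    fix i j show "adj \<rho> i j = \<rho> i j"
      using assms by (cases "i \<in> J \<and> j \<in> J") (auto simp: psd_def adj_def supported_def)
  qed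
  from hermitian_diagonalization[OF J assms(3) this] obtain U l where
    U: "unitary J U" and \<rho>: "\<rho> = (\<lambda>i j. \<Sum>k\<in>J. of_real (l k) * U i k * cnj (U j k))"
    unfolding unitary_def by blast
  have \<rho>': "\<rho> = eig J U l" by (intro ext) (simp add: \<rho> eig_apply J)
  have "0 \<le> l k" if k: "k \<in> J" for k
  proof -
    have "mm J (adj U) (mm J \<rho> U) = mm J (mm J (adj U) U) (mm J (diagm J l) (mm J (adj U) U))"
      unfolding \<rho>' eig_def by (simp only: mm_assoc)
    also have "\<dots> = diagm J l"
      using U J by (simp add: unitary_def mm_idm_left mm_idm_right)
    finally have "mm J (adj U) (mm J \<rho> U) k k = of_real (l k)"
      using k by (simp add: diagm_def)
    moreover have "mm J (adj U) (mm J \<rho> U) k k = (\<Sum>i\<in>J. \<Sum>j\<in>J. cnj (U i k) * \<rho> i j * U j k)"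
      by (simp add: mm_def adj_def sum_distrib_left mult.assoc)
    moreover have "0 \<le> Re (\<Sum>i\<in>J. \<Sum>j\<in>J. cnj (U i k) * \<rho> i j * U j k)"
      using assms(2)[unfolded psd_def, THEN conjunct2, THEN spec, of "\<lambda>i. U i k"] .
    ultimately show ?thesis by simp
  qed
  thus ?thesis using that U \<rho>' by blast
qed

section \<open>Joint convexity of the relative entropy\<close>

text \<open>
  For \<open>\<rho> = eig J U p\<close> and \<open>\<sigma> = eig J V q\<close>, \<open>rel_quad\<close> is
  \<open>\<langle>\<rho> - \<sigma>, (s L\<^sub>\<rho> + (1 - s) R\<^sub>\<sigma>)\<^sup>-\<^sup>1 (\<rho> - \<sigma>)\<rangle>\<close> for the left and right multiplications L and R;
  it is the supremum of \<open>rel_lin\<close> over Z. The last condition of \<open>rel_eig\<close> says that the support of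
  \<open>\<rho>\<close> is contained in that of \<open>\<sigma>\<close>, so that the conventions \<open>ln 0 = 0\<close> and \<open>x / 0 = 0\<close> are harmless.
\<close>

definition rel_eig :: "'j set \<Rightarrow> ('j \<Rightarrow> 'j \<Rightarrow> complex) \<Rightarrow> ('j \<Rightarrow> real) \<Rightarrow> ('j \<Rightarrow> 'j \<Rightarrow> complex) \<Rightarrow> ('j \<Rightarrow> real) \<Rightarrow> bool" where
  "rel_eig J U p V q \<longleftrightarrow> unitary J U \<and> unitary J V \<and> (\<forall>i\<in>J. 0 \<le> p i) \<and> (\<forall>j\<in>J. 0 \<le> q j) \<and>
     (\<forall>i\<in>J. \<forall>j\<in>J. mm J (adj U) V i j \<noteq> 0 \<longrightarrow> q j = 0 \<longrightarrow> p i = 0)"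

definition rel_quad :: "'j set \<Rightarrow> ('j \<Rightarrow> 'j \<Rightarrow> complex) \<Rightarrow> ('j \<Rightarrow> real) \<Rightarrow> ('j \<Rightarrow> 'j \<Rightarrow> complex) \<Rightarrow> ('j \<Rightarrow> real) \<Rightarrow> real \<Rightarrow> real" where
  "rel_quad J U p V q s = (\<Sum>i\<in>J. \<Sum>j\<in>J. (cmod (mm J (adj U) V i j))\<^sup>2 * ((p i - q j)\<^sup>2 / (s * p i + (1 - s) * q j)))"

text \<open>Relative entropy in nats, written in the eigenbases of both operators, plus tr \<sigma>
  - tr \<rho>. The correction makes each summand the scalar divergence p ln (p/q) - p + q, which has
  the integral representation.\<close>

definition rel_ent :: "'j set \<Rightarrow> ('j \<Rightarrow> 'j \<Rightarrow> complex) \<Rightarrow> ('j \<Rightarrow> real) \<Rightarrow> ('j \<Rightarrow> 'j \<Rightarrow> complex) \<Rightarrow> ('j \<Rightarrow> real) \<Rightarrow> real" where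
  "rel_ent J U p V q = (\<Sum>i\<in>J. \<Sum>j\<in>J. (cmod (mm J (adj U) V i j))\<^sup>2 * (p i * ln (p i) - p i * ln (q j) - p i + q j))"

definition rel_lin :: "'j set \<Rightarrow> real \<Rightarrow> ('j \<Rightarrow> 'j \<Rightarrow> complex) \<Rightarrow> ('j \<Rightarrow> 'j \<Rightarrow> complex) \<Rightarrow> ('j \<Rightarrow> 'j \<Rightarrow> complex) \<Rightarrow> real" where
  "rel_lin J s Z \<rho> \<sigma> = 2 * Re (tr J (mm J (adj Z) \<rho>)) - 2 * Re (tr J (mm J (adj Z) \<sigma>))
     - s * Re (tr J (mm J (adj Z) (mm J \<rho> Z))) - (1 - s) * Re (tr J (mm J (adj Z) (mm J Z \<sigma>)))"

lemma rel_lin_linear: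
  "rel_lin J s Z (\<lambda>i j. of_real a * \<rho> i j + of_real b * \<rho>' i j) (\<lambda>i j. of_real a * \<sigma> i j + of_real b * \<sigma>' i j) =
   a * rel_lin J s Z \<rho> \<sigma> + b * rel_lin J s Z \<rho>' \<sigma>'"
proof -
  have 1: "mm J A (\<lambda>i j. of_real a * \<rho> i j + of_real b * \<sigma> i j) = (\<lambda>i j. of_real a * mm J A \<rho> i j + of_real b * mm J A \<sigma> i j)"
    for A \<rho> \<sigma> :: "'a \<Rightarrow> 'a \<Rightarrow> complex"
    by (intro ext) (simp add: mm_def sum_distrib_left sum.distrib algebra_simps)
  have 2: "mm J (\<lambda>i j. of_real a * \<rho> i j + of_real b * \<sigma> i j) A = (\<lambda>i j. of_real a * mm J \<rho> A i j + of_real b * mm J \<sigma> A i j)"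
    for A \<rho> \<sigma> :: "'a \<Rightarrow> 'a \<Rightarrow> complex"
    by (intro ext) (simp add: mm_def sum_distrib_left sum.distrib algebra_simps)
  have 3: "Re (tr J (\<lambda>i j. of_real a * \<rho> i j + of_real b * \<sigma> i j)) = a * Re (tr J \<rho>) + b * Re (tr J \<sigma>)"
    for \<rho> \<sigma> :: "'a \<Rightarrow> 'a \<Rightarrow> complex"
    by (simp add: tr_def sum.distrib sum_distrib_left)
  show ?thesis
    unfolding rel_lin_def 1 2 3 by (simp add: algebra_simps)
qed

text \<open>With rows taken in the eigenbasis of \<rho> and columns in that of \<sigma>, left
  multiplication by \<rho> and right multiplication by \<sigma> are simultaneously diagonal. The
  quadratic problem in Z thus splits into one scalar problem for each pair (i, j); \<open>z\<close>
  and \<open>g\<close> represent Z and the identity in these bases.\<close>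

lemma rel_lin_eig:
  assumes J: "finite J" and U: "unitary J U" and V: "unitary J V" and Z: "supported J Z"
  defines "z \<equiv> mm J (adj U) (mm J Z V)" and "g \<equiv> mm J (adj U) V"
  shows "rel_lin J s Z (eig J U p) (eig J V q) =
    (\<Sum>i\<in>J. \<Sum>j\<in>J. 2 * Re (cnj (z i j) * g i j) * (p i - q j) - (s * p i + (1 - s) * q j) * (cmod (z i j))\<^sup>2)"
proof -
  let ?P = "diagm J p" and ?Q = "diagm J q"
  have s: "supported J U" "supported J (adj U)" "supported J V" "supported J (adj V)" "supported J Z" "supported J (adj Z)"
    using U V Z by (auto simp: unitary_def supported_adj)
  have u: "mm J U (adj U) = idm J" "mm J V (adj V) = idm J"
    using U V by (auto simp: unitary_def)
  \<comment> \<open>Inserting these resolutions of the identity into the traces makes the rotated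
    operator \<open>z\<close> appear.\<close>
  have insU: "mm J U (mm J (adj U) B) = B" and insV: "mm J V (mm J (adj V) B) = B"
    if "supported J B" for B :: "'a \<Rightarrow> 'a \<Rightarrow> complex"
    using mm_assoc[of J J U "adj U" B] mm_assoc[of J J V "adj V" B] that J
    by (simp_all add: u mm_idm_left)
  have z': "adj z = mm J (adj V) (mm J (adj Z) U)"
    by (simp add: z_def adj_mm mm_assoc)
  have t1: "tr J (mm J (adj Z) (eig J U p)) = tr J (mm J (adj z) (mm J ?P g))"
  proof -
    have "tr J (mm J (adj Z) (eig J U p)) = tr J (mm J (mm J (adj Z) U) (mm J ?P (adj U)))"
      by (simp add: eig_def mm_assoc)
    also have "\<dots> = tr J (mm J (mm J ?P (adj U)) (mm J (adj Z) U))"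
      by (rule tr_mm_commute)
    also have "\<dots> = tr J (mm J (mm J ?P (adj U)) (mm J V (mm J (adj V) (mm J (adj Z) U))))"
      by (subst insV) (auto intro: supported_mm s)
    also have "\<dots> = tr J (mm J (mm J ?P g) (adj z))"
      by (simp add: z' g_def mm_assoc)
    finally show ?thesis by (simp add: tr_mm_commute[of J "adj z"])
  qed
  have t2: "tr J (mm J (adj Z) (eig J V q)) = tr J (mm J (adj z) (mm J g ?Q))"
  proof -
    have "tr J (mm J (adj Z) (eig J V q)) = tr J (mm J (adj Z) (mm J U (mm J (adj U) (eig J V q))))"
      by (subst insU) (auto intro: supported_eig s)
    also have "\<dots> = tr J (mm J (mm J (adj Z) (mm J U (mm J (adj U) (mm J V ?Q)))) (adj V))"
      by (simp add: eig_def mm_assoc)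
    also have "\<dots> = tr J (mm J (adj z) (mm J g ?Q))"
      by (subst tr_mm_commute) (simp add: z' g_def mm_assoc)
    finally show ?thesis .
  qed
  have t3: "tr J (mm J (adj Z) (mm J (eig J U p) Z)) = tr J (mm J (adj z) (mm J ?P z))"
  proof -
    have "tr J (mm J (adj Z) (mm J (eig J U p) Z)) = tr J (mm J (mm J (adj Z) U) (mm J ?P (mm J (adj U) Z)))"
      by (simp add: eig_def mm_assoc)
    also have "\<dots> = tr J (mm J (mm J ?P (mm J (adj U) Z)) (mm J (adj Z) U))"
      by (rule tr_mm_commute)
    also have "\<dots> = tr J (mm J (mm J ?P (mm J (adj U) Z)) (mm J V (mm J (adj V) (mm J (adj Z) U))))"
      by (subst insV) (auto intro: supported_mm s)
    also have "\<dots> = tr J (mm J (mm J ?P z) (adj z))"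
      by (simp only: z') (simp only: z_def mm_assoc)
    finally show ?thesis by (simp add: tr_mm_commute[of J "adj z"])
  qed
  have t4: "tr J (mm J (adj Z) (mm J Z (eig J V q))) = tr J (mm J (adj z) (mm J z ?Q))"
  proof -
    have "tr J (mm J (adj Z) (mm J Z (eig J V q))) = tr J (mm J (adj Z) (mm J U (mm J (adj U) (mm J Z (eig J V q)))))"
      by (subst insU) (auto intro: supported_eig supported_mm s)
    also have "\<dots> = tr J (mm J (mm J (adj Z) (mm J U (mm J (adj U) (mm J Z (mm J V ?Q))))) (adj V))"
      by (simp add: eig_def mm_assoc)
    also have "\<dots> = tr J (mm J (adj z) (mm J z ?Q))"
      by (subst tr_mm_commute) (simp only: z', simp only: z_def mm_assoc)
    finally show ?thesis .
  qed
  have e: "tr J (mm J (adj z) (mm J ?P A)) = (\<Sum>i\<in>J. \<Sum>j\<in>J. of_real (p i) * (cnj (z i j) * A i j))"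
    "tr J (mm J (adj z) (mm J A ?Q)) = (\<Sum>i\<in>J. \<Sum>j\<in>J. of_real (q j) * (cnj (z i j) * A i j))" for A
    unfolding tr_def diagm_mm[OF J] mm_diagm[OF J] unfolding mm_def adj_def
    by (rule trans[OF sum.swap], intro sum.cong refl, simp add: mult_ac)+
  have sq: "Re (of_real r * (cnj x * x)) = r * (cmod x)\<^sup>2" for r x
    by (simp add: cmod_power2) (simp add: power2_eq_square)
  have "rel_lin J s Z (eig J U p) (eig J V q) =
     2 * (\<Sum>i\<in>J. \<Sum>j\<in>J. p i * Re (cnj (z i j) * g i j)) - 2 * (\<Sum>i\<in>J. \<Sum>j\<in>J. q j * Re (cnj (z i j) * g i j))
     - s * (\<Sum>i\<in>J. \<Sum>j\<in>J. p i * (cmod (z i j))\<^sup>2) - (1 - s) * (\<Sum>i\<in>J. \<Sum>j\<in>J. q j * (cmod (z i j))\<^sup>2)"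
    unfolding rel_lin_def t1 t2 t3 t4 e Re_sum sq by simp
  also have "\<dots> = (\<Sum>i\<in>J. \<Sum>j\<in>J. 2 * Re (cnj (z i j) * g i j) * (p i - q j) - (s * p i + (1 - s) * q j) * (cmod (z i j))\<^sup>2)"
    by (simp add: sum_subtractf[symmetric] sum_distrib_left sum.distrib[symmetric] algebra_simps)
  finally show ?thesis .
qed

text \<open>Completing the square in z. The second assumption settles d = 0, where the right-hand
  side is 0 by the convention for division.\<close>

lemma quad_bound:
  fixes d r :: real
  assumes "0 \<le> d" "d = 0 \<Longrightarrow> g \<noteq> 0 \<Longrightarrow> r = 0"
  shows "2 * Re (cnj z * g) * r - d * (cmod z)\<^sup>2 \<le> (cmod g)\<^sup>2 * (r\<^sup>2 / d)"
proof (cases "d = 0")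
  case True
  thus ?thesis using assms(2) by (cases "g = 0") auto
next
  case False
  with assms have d: "d > 0" by simp
  have "0 \<le> (cmod (of_real d * z - of_real r * g))\<^sup>2" by simp
  also have "\<dots> = d\<^sup>2 * (cmod z)\<^sup>2 + r\<^sup>2 * (cmod g)\<^sup>2 - d * r * (2 * Re (cnj z * g))"
    by (simp add: cmod_power2) (simp add: power2_eq_square algebra_simps)
  finally have "d * (2 * Re (cnj z * g) * r - d * (cmod z)\<^sup>2) \<le> (cmod g)\<^sup>2 * r\<^sup>2"
    by (simp add: power2_eq_square algebra_simps)
  thus ?thesis using d by (simp add: pos_le_divide_eq mult.commute)
qed

lemma quad_attained:
  fixes d r :: real and g :: complex
  defines "z \<equiv> of_real (r / d) * g"
  shows "2 * Re (cnj z * g) * r - d * (cmod z)\<^sup>2 = (cmod g)\<^sup>2 * (r\<^sup>2 / d)"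
proof (cases "d = 0")
  case False
  have 1: "Re (cnj z * g) = r / d * (cmod g)\<^sup>2"
    by (simp add: z_def cmod_power2) (simp add: power2_eq_square algebra_simps)
  have 2: "(cmod z)\<^sup>2 = (r / d)\<^sup>2 * (cmod g)\<^sup>2"
    by (simp add: z_def norm_mult power_mult_distrib power_divide norm_divide)
  show ?thesis
    unfolding 1 2 using False by (simp add: power2_eq_square field_simps)
qed (simp add: z_def)

lemma rel_lin_le_quad:
  assumes J: "finite J" and R: "rel_eig J U p V q" and Z: "supported J Z" and s: "0 \<le> s" "s < 1"
  shows "rel_lin J s Z (eig J U p) (eig J V q) \<le> rel_quad J U p V q s"
proof -
  have U: "unitary J U" and V: "unitary J V" using R by (auto simp: rel_eig_def)
  show ?thesis
    unfolding rel_lin_eig[OF J U V Z] rel_quad_def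
  proof (intro sum_mono quad_bound)
    fix i j assume ij: "i \<in> J" "j \<in> J"
    hence pq: "0 \<le> p i" "0 \<le> q j" using R by (auto simp: rel_eig_def)
    show "0 \<le> s * p i + (1 - s) * q j" using pq s by simp
    assume "s * p i + (1 - s) * q j = 0" "mm J (adj U) V i j \<noteq> 0"
    \<comment> \<open>As s < 1, the coefficient of \<open>q j\<close> is positive, so a vanishing
      denominator forces \<open>q j = 0\<close>; the support condition then takes care of
      \<open>p i\<close>.\<close>
    hence "q j = 0" using pq s by (simp add: add_nonneg_eq_0_iff)
    moreover from this have "p i = 0" using R ij \<open>mm J (adj U) V i j \<noteq> 0\<close> by (auto simp: rel_eig_def)
    ultimately show "p i - q j = 0" by simp
  qed
qed

lemma rel_quad_attained:
  assumes J: "finite J" and U: "unitary J U" and V: "unitary J V"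
  obtains Z where "supported J Z" "rel_lin J s Z (eig J U p) (eig J V q) = rel_quad J U p V q s"
proof -
  define g where "g = mm J (adj U) V"
  define z where "z i j = complex_of_real ((p i - q j) / (s * p i + (1 - s) * q j)) * g i j" for i j
  have s: "supported J U" "supported J (adj U)" "supported J V" "supported J (adj V)"
    using U V by (auto simp: unitary_def supported_adj)
  have sz: "supported J z"
    using supported_mm[OF s(2,3)] by (auto simp: z_def supported_def g_def)
  define Z where "Z = mm J U (mm J z (adj V))"
  have Z: "supported J Z" unfolding Z_def by (intro supported_mm s sz)
  have "mm J (adj U) (mm J Z V) = mm J (mm J (adj U) U) (mm J z (mm J (adj V) V))"
    by (simp only: Z_def mm_assoc)
  also have "\<dots> = z"
    using U V J sz by (simp add: unitary_def mm_idm_left mm_idm_right)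
  finally have zz: "mm J (adj U) (mm J Z V) = z" .
  have "rel_lin J s Z (eig J U p) (eig J V q) = rel_quad J U p V q s"
    unfolding rel_lin_eig[OF J U V Z] zz rel_quad_def g_def[symmetric]
    unfolding z_def by (intro sum.cong refl quad_attained)
  thus ?thesis using that Z by blast
qed

text \<open>Take the Z that is optimal for the combined pair. At this fixed Z the functional is
  linear, and each of the two terms is at most its own supremum.\<close>

lemma rel_quad_convex:
  assumes J: "finite J" and U: "unitary J U" "unitary J V"
    and R: "rel_eig J U1 p1 V1 q1" "rel_eig J U2 p2 V2 q2"
    and ab: "0 \<le> a" "0 \<le> b" and s: "0 \<le> s" "s < 1"
    and \<rho>: "eig J U p = (\<lambda>i j. of_real a * eig J U1 p1 i j + of_real b * eig J U2 p2 i j)"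
    and \<sigma>: "eig J V q = (\<lambda>i j. of_real a * eig J V1 q1 i j + of_real b * eig J V2 q2 i j)"
  shows "rel_quad J U p V q s \<le> a * rel_quad J U1 p1 V1 q1 s + b * rel_quad J U2 p2 V2 q2 s"
proof -
  obtain Z where Z: "supported J Z" "rel_lin J s Z (eig J U p) (eig J V q) = rel_quad J U p V q s"
    using rel_quad_attained[OF J U] .
  have "rel_quad J U p V q s = a * rel_lin J s Z (eig J U1 p1) (eig J V1 q1) + b * rel_lin J s Z (eig J U2 p2) (eig J V2 q2)"
    unfolding Z(2)[symmetric] \<rho> \<sigma> by (rule rel_lin_linear)
  also have "\<dots> \<le> a * rel_quad J U1 p1 V1 q1 s + b * rel_quad J U2 p2 V2 q2 s"
    by (intro add_mono mult_left_mono rel_lin_le_quad J R Z s ab)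
  finally show ?thesis .
qed

text \<open>With y running linearly from q to p one has p - y = (1 - s) (p - q), hence the integrand
  is the derivative of p ln y - y.\<close>

lemma rel_ent_integral_scalar:
  fixes p q :: real
  assumes "0 \<le> p" "0 \<le> q" "q = 0 \<Longrightarrow> p = 0"
  shows "((\<lambda>s. (1 - s) * ((p - q)\<^sup>2 / (s * p + (1 - s) * q))) has_integral (p * ln p - p * ln q - p + q)) {0..1}"
proof (cases "q = 0")
  case True
  thus ?thesis using assms by simp
next
  case False
  hence q: "q > 0" using assms by simp
  define y where "y s = s * p + (1 - s) * q" for s
  have y: "y s > 0" if "0 \<le> s" "s < 1" for s
    using that q assms by (auto simp: y_def intro!: add_nonneg_pos)
  have y1: "y s > 0" if "0 \<le> s" "s \<le> 1" "p \<noteq> 0" for s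
    using that y[of s] assms by (cases "s = 1") (auto simp: y_def)
  \<comment> \<open>Only p = 0 lets y vanish, namely at s = 1, and then the logarithm drops out of
    the antiderivative. The derivative itself is only taken in the interior.\<close>
  have cont: "continuous_on {0..1} (\<lambda>s. p * ln (y s) - y s)"
  proof (cases "p = 0")
    case False
    thus ?thesis using y1 unfolding y_def by (intro continuous_intros) fastforce+
  qed (auto simp: y_def intro!: continuous_intros)
  have "((\<lambda>s. (1 - s) * ((p - q)\<^sup>2 / y s)) has_integral (p * ln (y 1) - y 1) - (p * ln (y 0) - y 0)) {0..1}"
  proof (rule fundamental_theorem_of_calculus_interior[OF _ cont])
    fix s :: real assume s: "s \<in> {0<..<1}"
    hence ys: "y s > 0" using y by auto
    have "((\<lambda>s. p * ln (y s) - y s) has_real_derivative p * ((p - q) / y s) - (p - q)) (at s)"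
      using ys unfolding y_def by (auto intro!: derivative_eq_intros simp: divide_simps)
    moreover have "p * ((p - q) / y s) - (p - q) = (1 - s) * ((p - q)\<^sup>2 / y s)"
      using ys by (simp add: field_simps) (simp add: y_def power2_eq_square algebra_simps)
    ultimately show "((\<lambda>s. p * ln (y s) - y s) has_vector_derivative (1 - s) * ((p - q)\<^sup>2 / y s)) (at s)"
      by (simp add: has_real_derivative_iff_has_vector_derivative)
  qed simp
  thus ?thesis by (simp add: y_def algebra_simps)
qed

lemma rel_ent_integral:
  assumes J: "finite J" and R: "rel_eig J U p V q"
  shows "((\<lambda>s. (1 - s) * rel_quad J U p V q s) has_integral rel_ent J U p V q) {0..1}"
proof -
  let ?g = "mm J (adj U) V"
  have "((\<lambda>s. \<Sum>i\<in>J. \<Sum>j\<in>J. (cmod (?g i j))\<^sup>2 * ((1 - s) * ((p i - q j)\<^sup>2 / (s * p i + (1 - s) * q j))))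
     has_integral rel_ent J U p V q) {0..1}"
    unfolding rel_ent_def
  proof (intro has_integral_sum J)
    fix i j assume ij: "i \<in> J" "j \<in> J"
    show "((\<lambda>s. (cmod (?g i j))\<^sup>2 * ((1 - s) * ((p i - q j)\<^sup>2 / (s * p i + (1 - s) * q j))))
     has_integral ((cmod (?g i j))\<^sup>2 * (p i * ln (p i) - p i * ln (q j) - p i + q j))) {0..1}"
    \<comment> \<open>The support condition says nothing about pairs without overlap, but their
      terms vanish.\<close>
    proof (cases "?g i j = 0")
      case False
      thus ?thesis using R ij
        by (intro has_integral_mult_right rel_ent_integral_scalar) (auto simp: rel_eig_def)
    qed simp
  qed
  thus ?thesis
    by (simp add: rel_quad_def sum_distrib_left mult.left_commute)
qed

lemma rel_ent_convex:
  assumes J: "finite J" and R: "rel_eig J U p V q" "rel_eig J U1 p1 V1 q1" "rel_eig J U2 p2 V2 q2"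
    and ab: "0 \<le> a" "0 \<le> b"
    and \<rho>: "eig J U p = (\<lambda>i j. of_real a * eig J U1 p1 i j + of_real b * eig J U2 p2 i j)"
    and \<sigma>: "eig J V q = (\<lambda>i j. of_real a * eig J V1 q1 i j + of_real b * eig J V2 q2 i j)"
  shows "rel_ent J U p V q \<le> a * rel_ent J U1 p1 V1 q1 + b * rel_ent J U2 p2 V2 q2"
proof (rule has_integral_le)
  show "((\<lambda>s. (1 - s) * rel_quad J U p V q s) has_integral rel_ent J U p V q) {0..1}"
    by (rule rel_ent_integral[OF J R(1)])
  show "((\<lambda>s. a * ((1 - s) * rel_quad J U1 p1 V1 q1 s) + b * ((1 - s) * rel_quad J U2 p2 V2 q2 s)) has_integral
      a * rel_ent J U1 p1 V1 q1 + b * rel_ent J U2 p2 V2 q2) {0..1}"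
    by (intro has_integral_add has_integral_mult_right rel_ent_integral J R)
  fix s :: real assume s: "s \<in> {0..1}"
  show "(1 - s) * rel_quad J U p V q s \<le>
      a * ((1 - s) * rel_quad J U1 p1 V1 q1 s) + b * ((1 - s) * rel_quad J U2 p2 V2 q2 s)"
  proof (cases "s = 1")
    case False
    have U: "unitary J U" "unitary J V" using R(1) by (auto simp: rel_eig_def)
    have "(1 - s) * rel_quad J U p V q s \<le> (1 - s) * (a * rel_quad J U1 p1 V1 q1 s + b * rel_quad J U2 p2 V2 q2 s)"
      using s False by (intro mult_left_mono rel_quad_convex[OF J U R(2,3) ab _ _ \<rho> \<sigma>]) auto
    thus ?thesis by (simp add: algebra_simps)
  qed simp
qed

section \<open>Concavity of the conditional entropy\<close>

definition partial_trace :: "'c set \<Rightarrow> ('c \<times> 'b \<Rightarrow> 'c \<times> 'b \<Rightarrow> complex) \<Rightarrow> 'b \<Rightarrow> 'b \<Rightarrow> complex" where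
  "partial_trace C \<rho> = (\<lambda>b b'. \<Sum>c\<in>C. \<rho> (c, b) (c, b'))"

definition cond_entropy :: "'c set \<Rightarrow> 'b set \<Rightarrow> ('c \<times> 'b \<Rightarrow> 'c \<times> 'b \<Rightarrow> complex) \<Rightarrow> real" where
  "cond_entropy C B \<rho> = vn_entropy (C \<times> B) \<rho> - vn_entropy B (partial_trace C \<rho>)"

text \<open>The identity on C tensored with A. With the marginal on B in place of A it is the second
  argument of the relative entropy that equals minus the conditional entropy.\<close>

definition tensor_id :: "'c set \<Rightarrow> ('b \<Rightarrow> 'b \<Rightarrow> complex) \<Rightarrow> 'c \<times> 'b \<Rightarrow> 'c \<times> 'b \<Rightarrow> complex" where
  "tensor_id C A = (\<lambda>(c, b) (c', b'). if c = c' \<and> c \<in> C then A b b' else 0)"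

lemma psd_partial_trace:
  assumes "finite C" "finite B" "psd (C \<times> B) \<rho>"
  shows "psd B (partial_trace C \<rho>)"
  unfolding psd_def
proof (intro conjI ballI allI)
  fix i j assume "i \<in> B" "j \<in> B"
  thus "cnj (partial_trace C \<rho> i j) = partial_trace C \<rho> j i"
    using assms(3) by (auto simp: partial_trace_def psd_def intro!: sum.cong)
next
  fix x
  have 1: "0 \<le> Re (\<Sum>i\<in>B. \<Sum>j\<in>B. cnj (x i) * \<rho> (c, i) (c, j) * x j)" if "c \<in> C" for c
  proof -
    let ?y = "\<lambda>(c', b). if c' = c then x b else 0"
    have "(\<Sum>i\<in>C \<times> B. \<Sum>j\<in>C \<times> B. cnj (?y i) * \<rho> i j * ?y j) =
      (\<Sum>c1\<in>C. if c1 = c then \<Sum>b1\<in>B. \<Sum>c2\<in>C. if c2 = c then \<Sum>b2\<in>B. cnj (x b1) * \<rho> (c, b1) (c, b2) * x b2 else 0 else 0)"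
      unfolding sum.cartesian_product'
      by (intro sum.cong refl) (auto intro!: sum.cong)
    also have "\<dots> = (\<Sum>i\<in>B. \<Sum>j\<in>B. cnj (x i) * \<rho> (c, i) (c, j) * x j)"
      using that assms(1) by simp
    finally show ?thesis
      using assms(3)[unfolded psd_def, THEN conjunct2, THEN spec, of ?y] by (simp only:)
  qed
  have "(\<Sum>i\<in>B. \<Sum>j\<in>B. cnj (x i) * partial_trace C \<rho> i j * x j) =
      (\<Sum>i\<in>B. \<Sum>j\<in>B. \<Sum>c\<in>C. cnj (x i) * \<rho> (c, i) (c, j) * x j)"
    by (simp add: partial_trace_def sum_distrib_left sum_distrib_right)
  also have "\<dots> = (\<Sum>i\<in>B. \<Sum>c\<in>C. \<Sum>j\<in>B. cnj (x i) * \<rho> (c, i) (c, j) * x j)"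
    by (intro sum.cong refl sum.swap)
  also have "\<dots> = (\<Sum>c\<in>C. \<Sum>i\<in>B. \<Sum>j\<in>B. cnj (x i) * \<rho> (c, i) (c, j) * x j)"
    by (rule sum.swap)
  finally show "0 \<le> Re (\<Sum>i\<in>B. \<Sum>j\<in>B. cnj (x i) * partial_trace C \<rho> i j * x j)"
    using 1 by (simp only: Re_sum) (simp add: sum_nonneg)
qed

lemma mm_tensor_id:
  assumes "finite C"
  shows "mm (C \<times> B) (tensor_id C X) (tensor_id C Y) = tensor_id C (mm B X Y)"
proof (intro ext, clarify)
  fix c b c' b'
  have "mm (C \<times> B) (tensor_id C X) (tensor_id C Y) (c, b) (c', b') =
      (\<Sum>d\<in>C. if c = d then if d = c' then mm B X Y b b' else 0 else 0)"
    unfolding mm_def sum.cartesian_product'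
    by (intro sum.cong refl) (auto simp: tensor_id_def)
  thus "mm (C \<times> B) (tensor_id C X) (tensor_id C Y) (c, b) (c', b') = tensor_id C (mm B X Y) (c, b) (c', b')"
    using assms by (auto simp: tensor_id_def)
qed

lemma adj_tensor_id: "adj (tensor_id C X) = tensor_id C (adj X)"
  by (intro ext) (auto simp: adj_def tensor_id_def)

lemma tensor_id_idm: "tensor_id C (idm B) = idm (C \<times> B)"
  by (intro ext) (auto simp: idm_def tensor_id_def split: if_splits)

lemma tensor_id_diagm: "tensor_id C (diagm B q) = diagm (C \<times> B) (q \<circ> snd)"
  by (intro ext) (auto simp: diagm_def tensor_id_def split: if_splits)

lemma unitary_tensor_id:
  assumes "finite C" "unitary B V"
  shows "unitary (C \<times> B) (tensor_id C V)"
proof -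
  have "supported (C \<times> B) (tensor_id C V)"
    using assms by (auto simp: unitary_def supported_def tensor_id_def)
  thus ?thesis
    using assms by (simp add: unitary_def adj_tensor_id mm_tensor_id tensor_id_idm)
qed

lemma eig_tensor_id:
  assumes "finite C"
  shows "eig (C \<times> B) (tensor_id C V) (q \<circ> snd) = tensor_id C (eig B V q)"
  unfolding eig_def tensor_id_diagm[symmetric] adj_tensor_id mm_tensor_id[OF assms] ..

text \<open>S(C|B) is minus the relative entropy of \<rho> to the identity tensored with its
  marginal on B; ln 2 converts bits to nats. The trace term arises because that second operator has
  trace card C times tr \<rho>; being linear in \<rho>, it does not affect convexity.\<close>

lemma cond_entropy_rel_ent:
  fixes \<rho> :: "'c \<times> 'b \<Rightarrow> 'c \<times> 'b \<Rightarrow> complex"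
  assumes C: "finite C" and B: "finite B" and \<rho>: "psd (C \<times> B) \<rho>" "supported (C \<times> B) \<rho>"
  obtains U p V q where "rel_eig (C \<times> B) U p V q" "eig (C \<times> B) U p = \<rho>"
    "eig (C \<times> B) V q = tensor_id C (partial_trace C \<rho>)"
    "rel_ent (C \<times> B) U p V q = - ln 2 * cond_entropy C B \<rho> + (real (card C) - 1) * Re (tr (C \<times> B) \<rho>)"
proof -
  let ?J = "C \<times> B"
  have J: "finite ?J" using C B by simp
  obtain U p where U: "unitary ?J U" "\<And>k. k \<in> ?J \<Longrightarrow> 0 \<le> p k" "\<rho> = eig ?J U p"
    using psd_diagonalization[OF J \<rho>] by blast
  have sB: "supported B (partial_trace C \<rho>)"
    using \<rho>(2) by (auto simp: supported_def partial_trace_def)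
  obtain W r where W: "unitary B W" "\<And>k. k \<in> B \<Longrightarrow> 0 \<le> r k" "partial_trace C \<rho> = eig B W r"
    using psd_diagonalization[OF B psd_partial_trace[OF C B \<rho>(1)] sB] by blast
  define V where "V = tensor_id C W"
  define q :: "'c \<times> 'b \<Rightarrow> real" where "q = r \<circ> snd"
  have V: "unitary ?J V" unfolding V_def by (rule unitary_tensor_id[OF C W(1)])
  define g where "g = mm ?J (adj U) V"
  have ug: "unitary ?J g" unfolding g_def by (rule unitary_mm[OF J U(1) V])
  \<comment> \<open>The diagonal of \<rho> in the product basis given by \<open>W\<close>, summed
    over c, is the diagonal of the marginal in its own eigenbasis. This gives both the support
    condition and the value of tr \<rho> ln \<sigma>.\<close>
  have key: "(\<Sum>c\<in>C. \<Sum>i\<in>?J. (cmod (g i (c, b)))\<^sup>2 * p i) = r b" if b: "b \<in> B" for b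
  proof -
    have "complex_of_real (\<Sum>i\<in>?J. (cmod (g i (c, b)))\<^sup>2 * p i) =
        mm B (adj W) (mm B (\<lambda>b b'. \<rho> (c, b) (c, b')) W) b b" if c: "c \<in> C" for c
    proof -
      have "mm ?J (adj g) (mm ?J (diagm ?J p) g) = mm ?J (adj V) (mm ?J \<rho> V)"
        by (simp only: g_def U(3) eig_def adj_mm adj_adj mm_assoc)
      hence "mm ?J (adj g) (mm ?J (diagm ?J p) g) (c, b) (c, b) = mm ?J (adj V) (mm ?J \<rho> V) (c, b) (c, b)"
        by simp
      moreover have "mm ?J (adj g) (mm ?J (diagm ?J p) g) (c, b) (c, b) = complex_of_real (\<Sum>i\<in>?J. (cmod (g i (c, b)))\<^sup>2 * p i)"
        unfolding diagm_mm[OF J] unfolding mm_def adj_def of_real_sum of_real_mult complex_norm_square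
        by (intro sum.cong) (auto simp: mult_ac)
      moreover have rV: "mm ?J \<rho> V x (c, b) = (\<Sum>b'\<in>B. \<rho> x (c, b') * W b' b)" for x
      proof -
        have "mm ?J \<rho> V x (c, b) = (\<Sum>d\<in>C. if c = d then \<Sum>b'\<in>B. \<rho> x (c, b') * W b' b else 0)"
          unfolding mm_def sum.cartesian_product'
          by (intro sum.cong refl) (auto simp: V_def tensor_id_def)
        thus ?thesis using c C by simp
      qed
      moreover have "mm ?J (adj V) (mm ?J \<rho> V) (c, b) (c, b) =
          (\<Sum>d\<in>C. if c = d then \<Sum>b'\<in>B. cnj (W b' b) * mm ?J \<rho> V (c, b') (c, b) else 0)"
        unfolding mm_def[of _ "adj V"] sum.cartesian_product'
        by (intro sum.cong refl) (auto simp: V_def adj_def tensor_id_def)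
      ultimately show ?thesis
        using c C by (simp add: mm_def adj_def)
    qed
    hence "complex_of_real (\<Sum>c\<in>C. \<Sum>i\<in>?J. (cmod (g i (c, b)))\<^sup>2 * p i) =
        (\<Sum>c\<in>C. mm B (adj W) (mm B (\<lambda>b b'. \<rho> (c, b) (c, b')) W) b b)"
      by (subst of_real_sum) (intro sum.cong refl)
    also have "\<dots> = mm B (adj W) (mm B (partial_trace C \<rho>) W) b b"
      unfolding mm_def partial_trace_def sum_distrib_left sum_distrib_right
      by (subst sum.swap, intro sum.cong refl) (subst sum.swap, intro sum.cong refl)
    also have "mm B (adj W) (mm B (partial_trace C \<rho>) W) = mm B (mm B (adj W) W) (mm B (diagm B r) (mm B (adj W) W))"
      unfolding W(3) eig_def by (simp only: mm_assoc)
    also have "\<dots> = diagm B r"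
      using W(1) B by (simp add: unitary_def mm_idm_left mm_idm_right)
    also have "diagm B r b b = complex_of_real (r b)"
      using b by (simp add: diagm_def)
    finally show ?thesis by (rule of_real_eq_iff[THEN iffD1])
  qed
  have R: "rel_eig ?J U p V q"
    unfolding rel_eig_def
  proof (intro conjI ballI impI U(1) V)
    fix i assume "i \<in> ?J" thus "0 \<le> p i" by (rule U(2))
  next
    fix j assume "j \<in> ?J" thus "0 \<le> q j" by (auto simp: q_def W(2))
  next
    fix i j assume i: "i \<in> ?J" and j: "j \<in> ?J" and gne: "mm ?J (adj U) V i j \<noteq> 0" and q0: "q j = 0"
    obtain c b where cb: "j = (c, b)" "c \<in> C" "b \<in> B" using j by auto
    \<comment> \<open>A zero eigenvalue of the marginal is a sum of nonnegative terms, so each of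
      them vanishes; a nonzero overlap leaves only \<open>p i = 0\<close>.\<close>
    have "(\<Sum>c\<in>C. \<Sum>i\<in>?J. (cmod (g i (c, b)))\<^sup>2 * p i) = 0"
      using key[OF cb(3)] q0 by (simp add: cb(1) q_def)
    hence "(\<Sum>i\<in>?J. (cmod (g i (c, b)))\<^sup>2 * p i) = 0"
      using C cb(2) by (subst (asm) sum_nonneg_eq_0_iff) (auto intro!: sum_nonneg simp: U(2))
    hence "(cmod (g i (c, b)))\<^sup>2 * p i = 0"
      using J i by (subst (asm) sum_nonneg_eq_0_iff) (auto simp: U(2))
    thus "p i = 0" using gne by (simp add: g_def cb)
  qed
  have trp: "Re (tr ?J \<rho>) = (\<Sum>i\<in>?J. p i)"
    unfolding U(3) tr_eig[OF J U(1)] by simp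
  have "tr ?J \<rho> = tr B (partial_trace C \<rho>)"
    unfolding tr_def partial_trace_def sum.cartesian_product' by (subst sum.swap) simp
  hence trr: "Re (tr ?J \<rho>) = (\<Sum>b\<in>B. r b)"
    unfolding W(3) tr_eig[OF B W(1)] by simp
  have "rel_ent ?J U p V q = (\<Sum>i\<in>?J. p i * ln (p i) * (\<Sum>j\<in>?J. (cmod (g i j))\<^sup>2))
      - (\<Sum>i\<in>?J. \<Sum>j\<in>?J. ln (q j) * ((cmod (g i j))\<^sup>2 * p i))
      - (\<Sum>i\<in>?J. p i * (\<Sum>j\<in>?J. (cmod (g i j))\<^sup>2)) + (\<Sum>i\<in>?J. \<Sum>j\<in>?J. q j * (cmod (g i j))\<^sup>2)"
    unfolding rel_ent_def g_def[symmetric] sum_distrib_left sum_subtractf[symmetric] sum.distrib[symmetric]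
    by (intro sum.cong refl) (simp add: algebra_simps)
  also have "(\<Sum>i\<in>?J. p i * ln (p i) * (\<Sum>j\<in>?J. (cmod (g i j))\<^sup>2)) = (\<Sum>i\<in>?J. p i * ln (p i))"
    by (intro sum.cong refl) (simp add: unitary_row_sum[OF ug])
  also have "(\<Sum>i\<in>?J. p i * (\<Sum>j\<in>?J. (cmod (g i j))\<^sup>2)) = (\<Sum>i\<in>?J. p i)"
    by (intro sum.cong refl) (simp add: unitary_row_sum[OF ug])
  also have "(\<Sum>i\<in>?J. \<Sum>j\<in>?J. q j * (cmod (g i j))\<^sup>2) = (\<Sum>j\<in>?J. q j * (\<Sum>i\<in>?J. (cmod (g i j))\<^sup>2))"
    unfolding sum_distrib_left by (rule sum.swap)
  also have "\<dots> = (\<Sum>j\<in>?J. q j)"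
    by (intro sum.cong refl) (simp add: unitary_column_sum[OF ug])
  also have "\<dots> = (\<Sum>c\<in>C. \<Sum>b\<in>B. r b)"
    unfolding sum.cartesian_product by (intro sum.cong) (auto simp: q_def)
  also have "\<dots> = real (card C) * Re (tr ?J \<rho>)"
    by (simp add: trr)
  also have "(\<Sum>i\<in>?J. \<Sum>j\<in>?J. ln (q j) * ((cmod (g i j))\<^sup>2 * p i)) = (\<Sum>b\<in>B. ln (r b) * r b)"
  proof -
    have "(\<Sum>i\<in>?J. \<Sum>j\<in>?J. ln (q j) * ((cmod (g i j))\<^sup>2 * p i)) =
        (\<Sum>j\<in>?J. ln (q j) * (\<Sum>i\<in>?J. (cmod (g i j))\<^sup>2 * p i))"
      unfolding sum_distrib_left by (rule sum.swap)
    also have "\<dots> = (\<Sum>c\<in>C. \<Sum>b\<in>B. ln (r b) * (\<Sum>i\<in>?J. (cmod (g i (c, b)))\<^sup>2 * p i))"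
      unfolding sum.cartesian_product by (intro sum.cong) (auto simp: q_def)
    also have "\<dots> = (\<Sum>b\<in>B. ln (r b) * (\<Sum>c\<in>C. \<Sum>i\<in>?J. (cmod (g i (c, b)))\<^sup>2 * p i))"
      by (subst sum.swap) (simp only: sum_distrib_left)
    also have "\<dots> = (\<Sum>b\<in>B. ln (r b) * r b)"
      by (intro sum.cong refl) (simp only: key)
    finally show ?thesis .
  qed
  finally have D: "rel_ent ?J U p V q = (\<Sum>i\<in>?J. p i * ln (p i)) - (\<Sum>b\<in>B. r b * ln (r b))
      + (real (card C) - 1) * Re (tr ?J \<rho>)"
    by (simp only: trp[symmetric]) (simp add: algebra_simps)
  have "ln 2 * vn_entropy ?J \<rho> = - (\<Sum>i\<in>?J. p i * ln (p i))"
    unfolding U(3) vn_entropy_eig[OF J U(1)] by (simp add: sum_distrib_left log_def)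
  moreover have "ln 2 * vn_entropy B (partial_trace C \<rho>) = - (\<Sum>b\<in>B. r b * ln (r b))"
    unfolding W(3) vn_entropy_eig[OF B W(1)] by (simp add: sum_distrib_left log_def)
  ultimately have "rel_ent ?J U p V q = - ln 2 * cond_entropy C B \<rho> + (real (card C) - 1) * Re (tr ?J \<rho>)"
    unfolding D cond_entropy_def by (simp add: algebra_simps)
  moreover have "eig ?J V q = tensor_id C (partial_trace C \<rho>)"
    unfolding V_def q_def eig_tensor_id[OF C] W(3) ..
  ultimately show ?thesis using that R U(3) by blast
qed

lemma cond_entropy_cong:
  assumes "finite C" "finite B" "\<And>i j. i \<in> C \<times> B \<Longrightarrow> j \<in> C \<times> B \<Longrightarrow> \<rho> i j = \<sigma> i j"
  shows "cond_entropy C B \<rho> = cond_entropy C B \<sigma>"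
proof -
  have "vn_entropy (C \<times> B) \<rho> = vn_entropy (C \<times> B) \<sigma>"
    using assms by (intro vn_entropy_cong) auto
  moreover have "vn_entropy B (partial_trace C \<rho>) = vn_entropy B (partial_trace C \<sigma>)"
    using assms by (intro vn_entropy_cong) (auto simp: partial_trace_def intro!: sum.cong)
  ultimately show ?thesis by (simp add: cond_entropy_def)
qed

lemma psd_cong:
  assumes "psd J \<rho>" "\<And>i j. i \<in> J \<Longrightarrow> j \<in> J \<Longrightarrow> \<rho> i j = \<sigma> i j"
  shows "psd J \<sigma>"
proof -
  have "(\<Sum>i\<in>J. \<Sum>j\<in>J. cnj (x i) * \<sigma> i j * x j) = (\<Sum>i\<in>J. \<Sum>j\<in>J. cnj (x i) * \<rho> i j * x j)" for x
    by (intro sum.cong refl) (simp add: assms(2))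
  thus ?thesis using assms by (simp add: psd_def)
qed

lemma psd_linear:
  assumes "psd J \<rho>" "psd J \<sigma>" "0 \<le> a" "0 \<le> b"
  shows "psd J (\<lambda>i j. of_real a * \<rho> i j + of_real b * \<sigma> i j)"
proof -
  have "(\<Sum>i\<in>J. \<Sum>j\<in>J. cnj (x i) * (of_real a * \<rho> i j + of_real b * \<sigma> i j) * x j) =
     of_real a * (\<Sum>i\<in>J. \<Sum>j\<in>J. cnj (x i) * \<rho> i j * x j) + of_real b * (\<Sum>i\<in>J. \<Sum>j\<in>J. cnj (x i) * \<sigma> i j * x j)" for x
    by (simp add: sum_distrib_left sum.distrib algebra_simps)
  thus ?thesis using assms by (simp add: psd_def)
qed

text \<open>Both arguments of the relative entropy depend linearly on the state, so joint convexity
  applies, and the trace terms cancel.\<close>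

lemma cond_entropy_concave:
  assumes C: "finite C" and B: "finite B" and psd: "psd (C \<times> B) \<rho>" "psd (C \<times> B) \<sigma>" and ab: "0 \<le> a" "0 \<le> b"
  shows "a * cond_entropy C B \<rho> + b * cond_entropy C B \<sigma> \<le>
    cond_entropy C B (\<lambda>i j. of_real a * \<rho> i j + of_real b * \<sigma> i j)"
proof -
  let ?J = "C \<times> B"
  have J: "finite ?J" using C B by simp
  \<comment> \<open>Entries outside the basis are arbitrary so far; they are cut off because
    diagonalization works with supported operators.\<close>
  define res where "res \<rho> i j = (if i \<in> ?J \<and> j \<in> ?J then \<rho> i j else 0)" for \<rho> :: "'a \<times> 'b \<Rightarrow> 'a \<times> 'b \<Rightarrow> complex" and i j
  have s: "supported ?J (res \<rho>)" and c: "cond_entropy C B (res \<rho>) = cond_entropy C B \<rho>" 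
    and p: "psd ?J \<rho> \<Longrightarrow> psd ?J (res \<rho>)" for \<rho>
    by (auto simp: supported_def res_def intro!: cond_entropy_cong C B intro: psd_cong)
  let ?\<tau> = "\<lambda>i j. of_real a * \<rho> i j + of_real b * \<sigma> i j"
  have \<tau>: "res ?\<tau> = (\<lambda>i j. of_real a * res \<rho> i j + of_real b * res \<sigma> i j)"
    by (auto simp: res_def fun_eq_iff)
  obtain U p V q where 0: "rel_eig ?J U p V q" "eig ?J U p = res ?\<tau>"
    "eig ?J V q = tensor_id C (partial_trace C (res ?\<tau>))"
    "rel_ent ?J U p V q = - ln 2 * cond_entropy C B (res ?\<tau>) + (real (card C) - 1) * Re (tr ?J (res ?\<tau>))"
    using cond_entropy_rel_ent[OF C B p[OF psd_linear[OF psd ab]] s] .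
  obtain U1 p1 V1 q1 where 1: "rel_eig ?J U1 p1 V1 q1" "eig ?J U1 p1 = res \<rho>"
    "eig ?J V1 q1 = tensor_id C (partial_trace C (res \<rho>))"
    "rel_ent ?J U1 p1 V1 q1 = - ln 2 * cond_entropy C B (res \<rho>) + (real (card C) - 1) * Re (tr ?J (res \<rho>))"
    using cond_entropy_rel_ent[OF C B p[OF psd(1)] s] .
  obtain U2 p2 V2 q2 where 2: "rel_eig ?J U2 p2 V2 q2" "eig ?J U2 p2 = res \<sigma>"
    "eig ?J V2 q2 = tensor_id C (partial_trace C (res \<sigma>))"
    "rel_ent ?J U2 p2 V2 q2 = - ln 2 * cond_entropy C B (res \<sigma>) + (real (card C) - 1) * Re (tr ?J (res \<sigma>))"
    using cond_entropy_rel_ent[OF C B p[OF psd(2)] s] .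
  have t: "Re (tr ?J (res ?\<tau>)) = a * Re (tr ?J (res \<rho>)) + b * Re (tr ?J (res \<sigma>))"
    by (simp add: \<tau> tr_def sum.distrib sum_distrib_left)
  have "rel_ent ?J U p V q \<le> a * rel_ent ?J U1 p1 V1 q1 + b * rel_ent ?J U2 p2 V2 q2"
  proof (rule rel_ent_convex[OF J 0(1) 1(1) 2(1) ab])
    show "eig ?J U p = (\<lambda>i j. of_real a * eig ?J U1 p1 i j + of_real b * eig ?J U2 p2 i j)"
      by (simp add: 0(2) 1(2) 2(2) \<tau>)
    show "eig ?J V q = (\<lambda>i j. of_real a * eig ?J V1 q1 i j + of_real b * eig ?J V2 q2 i j)"
      by (auto simp: 0(3) 1(3) 2(3) \<tau> tensor_id_def partial_trace_def fun_eq_iff sum.distrib sum_distrib_left)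
  qed
  hence "ln 2 * (a * cond_entropy C B \<rho> + b * cond_entropy C B \<sigma>) \<le> ln 2 * cond_entropy C B ?\<tau>"
    unfolding 0(4) 1(4) 2(4) t c by (simp add: algebra_simps)
  thus ?thesis by simp
qed

section \<open>Information cost as a function of the input distribution\<close>

text \<open>
  The input distribution is relaxed to arbitrary nonnegative weights w. On the open orthant concave
  functions are continuous, which is the only continuity in the distribution that is needed.
\<close>

definition reduced :: "'a set \<Rightarrow> ('q::finite \<Rightarrow> real) \<Rightarrow> ('q \<Rightarrow> 'a \<Rightarrow> 'b \<Rightarrow> 'c \<Rightarrow> complex) \<Rightarrow> 'c \<times> 'b \<Rightarrow> 'c \<times> 'b \<Rightarrow> complex" where
  "reduced A w \<psi> = (\<lambda>(c, b) (c', b'). \<Sum>q\<in>UNIV. \<Sum>a\<in>A. of_real (w q) * \<psi> q a b c * cnj (\<psi> q a b' c'))"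

definition swap_players :: "('q \<Rightarrow> 'a \<Rightarrow> 'b \<Rightarrow> 'c \<Rightarrow> complex) \<Rightarrow> 'q \<Rightarrow> 'b \<Rightarrow> 'a \<Rightarrow> 'c \<Rightarrow> complex" where
  "swap_players \<psi> = (\<lambda>q b a c. \<psi> q a b c)"

definition round_info :: "'a set \<Rightarrow> 'b set \<Rightarrow> 'c set \<Rightarrow> ('q::finite \<Rightarrow> real) \<Rightarrow> ('q \<Rightarrow> 'a \<Rightarrow> 'b \<Rightarrow> 'c \<Rightarrow> complex) \<Rightarrow> real" where
  "round_info A B C w \<psi> = cond_entropy C B (reduced A w \<psi>) + cond_entropy C A (reduced B w (swap_players \<psi>))"

text \<open>The state on R, A, B, C is pure, so S(RB) = S(CA) and S(CRB) = S(A). After this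
  replacement R is traced out in all four entropies. That removes the cross terms between different
  inputs, so only w enters and no longer its square root.\<close>

lemma cond_mutual_info_purified:
  fixes w :: "'q::finite \<Rightarrow> real"
  assumes A: "finite A" and B: "finite B" and C: "finite C" and w: "\<And>q. 0 \<le> w q"
    and \<Psi>: "\<And>q a b c. \<Psi> q a b c = of_real (sqrt (w q)) * \<psi> q a b c"
  shows "cond_mutual_info C UNIV B (\<lambda>(c, q, b) (c', q', b'). \<Sum>a\<in>A. \<Psi> q a b c * cnj (\<Psi> q' a b' c')) = round_info A B C w \<psi>"
proof -
  have ww: "\<Psi> q a b c * cnj (\<Psi> q a' b' c') = of_real (w q) * \<psi> q a b c * cnj (\<psi> q a' b' c')" for q a b c a' b' c'
  proof -
    have "complex_of_real (sqrt (w q)) * complex_of_real (sqrt (w q)) = of_real (w q)"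
      using w[of q] by (simp flip: of_real_mult)
    thus ?thesis by (simp add: \<Psi> mult_ac)
  qed
  have 1: "vn_entropy (C \<times> B) (\<lambda>(c, b) (c', b'). \<Sum>q\<in>UNIV. \<Sum>a\<in>A. \<Psi> q a b c * cnj (\<Psi> q a b' c')) =
      vn_entropy (C \<times> B) (reduced A w \<psi>)"
    by (simp add: reduced_def ww)
  have "vn_entropy (UNIV \<times> B) (\<lambda>(q, b) (q', b'). \<Sum>c\<in>C. \<Sum>a\<in>A. \<Psi> q a b c * cnj (\<Psi> q' a b' c)) =
      vn_entropy (UNIV \<times> B) (\<lambda>j j'. \<Sum>k\<in>C \<times> A. \<Psi> (fst j) (snd k) (snd j) (fst k) * cnj (\<Psi> (fst j') (snd k) (snd j') (fst k)))"
    using B by (intro vn_entropy_cong) (auto simp: sum.cartesian_product')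
  also have "\<dots> = vn_entropy (C \<times> A) (\<lambda>k k'. \<Sum>j\<in>UNIV \<times> B. \<Psi> (fst j) (snd k) (snd j) (fst k) * cnj (\<Psi> (fst j) (snd k') (snd j) (fst k')))"
    using A B C by (intro vn_entropy_pure) auto
  also have "\<dots> = vn_entropy (C \<times> A) (reduced B w (swap_players \<psi>))"
    using A C by (intro vn_entropy_cong) (auto simp: sum.cartesian_product' ww reduced_def swap_players_def)
  finally have 2: "vn_entropy (UNIV \<times> B) (\<lambda>(q, b) (q', b'). \<Sum>c\<in>C. \<Sum>a\<in>A. \<Psi> q a b c * cnj (\<Psi> q' a b' c)) =
      vn_entropy (C \<times> A) (reduced B w (swap_players \<psi>))" .
  have 3: "vn_entropy B (\<lambda>b b'. \<Sum>c\<in>C. \<Sum>q\<in>UNIV. \<Sum>a\<in>A. \<Psi> q a b c * cnj (\<Psi> q a b' c)) =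
      vn_entropy B (partial_trace C (reduced A w \<psi>))"
    by (simp add: reduced_def partial_trace_def ww)
  have "vn_entropy (C \<times> UNIV \<times> B) (\<lambda>(c, q, b) (c', q', b'). \<Sum>a\<in>A. \<Psi> q a b c * cnj (\<Psi> q' a b' c')) =
      vn_entropy (C \<times> UNIV \<times> B) (\<lambda>j j'. \<Sum>a\<in>A. \<Psi> (fst (snd j)) a (snd (snd j)) (fst j) * cnj (\<Psi> (fst (snd j')) a (snd (snd j')) (fst j')))"
    using B C by (intro vn_entropy_cong) auto
  also have "\<dots> = vn_entropy A (\<lambda>a a'. \<Sum>j\<in>C \<times> UNIV \<times> B. \<Psi> (fst (snd j)) a (snd (snd j)) (fst j) * cnj (\<Psi> (fst (snd j)) a' (snd (snd j)) (fst j)))"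
    using A B C by (intro vn_entropy_pure) auto
  also have "\<dots> = vn_entropy A (partial_trace C (reduced B w (swap_players \<psi>)))"
    using A by (intro vn_entropy_cong) (auto simp: sum.cartesian_product' ww partial_trace_def reduced_def swap_players_def)
  finally have 4: "vn_entropy (C \<times> UNIV \<times> B) (\<lambda>(c, q, b) (c', q', b'). \<Sum>a\<in>A. \<Psi> q a b c * cnj (\<Psi> q' a b' c')) =
      vn_entropy A (partial_trace C (reduced B w (swap_players \<psi>)))" .
  show ?thesis
    using 1 2 3 4 by (simp add: cond_mutual_info_def round_info_def cond_entropy_def)
qed

lemma psd_reduced:
  fixes w :: "'q::finite \<Rightarrow> real" and \<psi> :: "'q \<Rightarrow> 'a \<Rightarrow> 'b \<Rightarrow> 'c \<Rightarrow> complex"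
  assumes "finite B" "finite C" "\<And>q. 0 \<le> w q"
  shows "psd (C \<times> B) (reduced A w \<psi>)"
proof (rule psd_gram[where S = "UNIV \<times> A" and w = "w \<circ> fst" and f = "\<lambda>s j. \<psi> (fst s) (snd s) (snd j) (fst j)"])
  fix i j :: "'c \<times> 'b"
  show "reduced A w \<psi> i j = (\<Sum>s\<in>UNIV \<times> A. of_real ((w \<circ> fst) s) * \<psi> (fst s) (snd s) (snd i) (fst i) * cnj (\<psi> (fst s) (snd s) (snd j) (fst j)))"
    by (auto simp: reduced_def sum.cartesian_product' split: prod.split)
qed (use assms in auto)

lemma reduced_linear:
  "reduced A (\<lambda>q. s * w q + t * w' q) \<psi> = (\<lambda>i j. of_real s * reduced A w \<psi> i j + of_real t * reduced A w' \<psi> i j)"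
  by (auto simp: reduced_def fun_eq_iff sum_distrib_left sum.distrib[symmetric] algebra_simps)

lemma round_info_concave:
  fixes w w' :: "'q::finite \<Rightarrow> real"
  assumes "finite A" "finite B" "finite C" "\<And>q. 0 \<le> w q" "\<And>q. 0 \<le> w' q" "0 \<le> s" "0 \<le> t"
  shows "s * round_info A B C w \<psi> + t * round_info A B C w' \<psi> \<le> round_info A B C (\<lambda>q. s * w q + t * w' q) \<psi>"
proof -
  have "s * cond_entropy C B (reduced A w \<psi>) + t * cond_entropy C B (reduced A w' \<psi>)
      \<le> cond_entropy C B (reduced A (\<lambda>q. s * w q + t * w' q) \<psi>)"
    unfolding reduced_linear using assms by (intro cond_entropy_concave psd_reduced)
  moreover have "s * cond_entropy C A (reduced B w (swap_players \<psi>)) + t * cond_entropy C A (reduced B w' (swap_players \<psi>))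
      \<le> cond_entropy C A (reduced B (\<lambda>q. s * w q + t * w' q) (swap_players \<psi>))"
    unfolding reduced_linear using assms by (intro cond_entropy_concave psd_reduced)
  ultimately show ?thesis by (simp add: round_info_def algebra_simps)
qed

lemma reduced_pure:
  fixes \<phi> :: "'q::finite \<Rightarrow> 'a \<Rightarrow> 'b \<Rightarrow> 'c \<Rightarrow> complex"
  shows "reduced A (\<lambda>q. if q = q0 then 1 else 0) \<phi> = (\<lambda>(c, b) (c', b'). \<Sum>a\<in>A. \<phi> q0 a b c * cnj (\<phi> q0 a b' c'))"
proof -
  have "(\<Sum>q\<in>UNIV. \<Sum>a\<in>A. of_real (if q = q0 then 1 else 0) * \<phi> q a b c * cnj (\<phi> q a b' c')) =
    (\<Sum>q\<in>UNIV. if q = q0 then \<Sum>a\<in>A. \<phi> q0 a b c * cnj (\<phi> q0 a b' c') else 0)" for b c b' c'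
    by (intro sum.cong) auto
  thus ?thesis by (simp add: reduced_def)
qed

lemma vn_entropy_reduced_pure:
  fixes \<phi> :: "'q::finite \<Rightarrow> 'a \<Rightarrow> 'b \<Rightarrow> 'c \<Rightarrow> complex"
  assumes "finite A" "finite B" "finite C"
  shows "vn_entropy (C \<times> B) (reduced A (\<lambda>q. if q = q0 then 1 else 0) \<phi>) =
    vn_entropy A (partial_trace C (reduced B (\<lambda>q. if q = q0 then 1 else 0) (swap_players \<phi>)))"
proof -
  have "vn_entropy (C \<times> B) (\<lambda>(c, b) (c', b'). \<Sum>a\<in>A. \<phi> q0 a b c * cnj (\<phi> q0 a b' c')) =
    vn_entropy (C \<times> B) (\<lambda>j j'. \<Sum>a\<in>A. \<phi> q0 a (snd j) (fst j) * cnj (\<phi> q0 a (snd j') (fst j')))"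
    using assms by (intro vn_entropy_cong) auto
  also have "\<dots> = vn_entropy A (\<lambda>a a'. \<Sum>j\<in>C \<times> B. \<phi> q0 a (snd j) (fst j) * cnj (\<phi> q0 a' (snd j) (fst j)))"
    using assms by (intro vn_entropy_pure) auto
  finally show ?thesis
    by (simp add: reduced_pure partial_trace_def swap_players_def sum.cartesian_product')
qed

text \<open>For a fixed input the state on A, B, C alone is pure: S(CB) = S(A) and S(CA) = S(B), and
  everything cancels.\<close>

lemma round_info_pure:
  assumes "finite A" "finite B" "finite C"
  shows "round_info A B C (\<lambda>q. if q = q0 then 1 else 0) \<psi> = 0"
  using vn_entropy_reduced_pure[OF assms, of q0 \<psi>]
    vn_entropy_reduced_pure[OF assms(2,1,3), of q0 "swap_players \<psi>"]
  by (simp add: round_info_def cond_entropy_def swap_players_def)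

lemma round_info_nonneg:
  fixes w :: "'q::finite \<Rightarrow> real"
  assumes fin: "finite A" "finite B" "finite C" and w: "\<And>q. 0 \<le> w q"
  shows "0 \<le> round_info A B C w \<psi>"
proof -
  have "0 \<le> round_info A B C (\<lambda>q. if q \<in> Q then w q else 0) \<psi>" if "finite Q" for Q
    using that
  proof (induction Q rule: finite_induct)
    case empty
    \<comment> \<open>With both coefficients 0, concavity reads 0 \<le> the value at the zero
      weight.\<close>
    show ?case using round_info_concave[OF fin, of "\<lambda>_. 0" "\<lambda>_. 0" 0 0 \<psi>] by simp
  next
    case (insert q0 Q)
    have eq: "(\<lambda>q. if q \<in> insert q0 Q then w q else 0) =
        (\<lambda>q. 1 * (if q \<in> Q then w q else 0) + w q0 * (if q = q0 then 1 else 0))"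
      using insert.hyps by auto
    \<comment> \<open>Concavity is available for arbitrary nonnegative coefficients and so includes
      superadditivity: adding the mass at \<open>q0\<close>, which alone has value 0, cannot lower
      the total.\<close>
    have "1 * round_info A B C (\<lambda>q. if q \<in> Q then w q else 0) \<psi> +
        w q0 * round_info A B C (\<lambda>q. if q = q0 then 1 else 0) \<psi> \<le>
      round_info A B C (\<lambda>q. if q \<in> insert q0 Q then w q else 0) \<psi>"
      unfolding eq using w by (intro round_info_concave fin) auto
    thus ?case using insert.IH by (simp add: round_info_pure[OF fin])
  qed
  from this[of UNIV] show ?thesis by simp
qed

section \<open>Linearity of the execution and the cost as a function of weights\<close>

definition basis_state :: "('x, 'y, 'za, 'zb) protocol \<Rightarrow> nat \<Rightarrow> 'x \<times> 'y \<Rightarrow> ('x, 'za) label \<Rightarrow> ('y, 'zb) label \<Rightarrow> nat \<Rightarrow> complex" where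
  "basis_state P i q = state_after P (\<lambda>(u::unit) x y. if x = fst q \<and> y = snd q then 1 else 0) i ()"

lemma sum_swap3: "(\<Sum>a\<in>A. \<Sum>c\<in>C. \<Sum>s\<in>S. f a c s) = (\<Sum>s\<in>S. \<Sum>a\<in>A. \<Sum>c\<in>C. f a c s)"
proof -
  have "(\<Sum>a\<in>A. \<Sum>c\<in>C. \<Sum>s\<in>S. f a c s) = (\<Sum>a\<in>A. \<Sum>s\<in>S. \<Sum>c\<in>C. f a c s)"
    by (intro sum.cong refl sum.swap)
  thus ?thesis by (simp only: sum.swap[of _ A S])
qed

lemma act_alice_sum:
  "act_alice U A C (\<lambda>q a b c. \<Sum>s\<in>S. f q s * \<psi> s a b c) = (\<lambda>q a b c. \<Sum>s\<in>S. f q s * act_alice U A C (\<lambda>_. \<psi> s) () a b c)"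
proof (intro ext)
  fix q a b c
  have "(\<Sum>a'\<in>A. \<Sum>c'\<in>C. \<Sum>s\<in>S. f q s * (U (a, c) (a', c') * \<psi> s a' b c')) =
     (\<Sum>s\<in>S. \<Sum>a'\<in>A. \<Sum>c'\<in>C. f q s * (U (a, c) (a', c') * \<psi> s a' b c'))"
    by (rule sum_swap3)
  thus "act_alice U A C (\<lambda>q a b c. \<Sum>s\<in>S. f q s * \<psi> s a b c) q a b c = (\<Sum>s\<in>S. f q s * act_alice U A C (\<lambda>_. \<psi> s) () a b c)"
    by (simp add: act_alice_def sum_distrib_left mult.left_commute)
qed

lemma act_bob_sum:
  "act_bob U B C (\<lambda>q a b c. \<Sum>s\<in>S. f q s * \<psi> s a b c) = (\<lambda>q a b c. \<Sum>s\<in>S. f q s * act_bob U B C (\<lambda>_. \<psi> s) () a b c)"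
proof (intro ext)
  fix q a b c
  have "(\<Sum>b'\<in>B. \<Sum>c'\<in>C. \<Sum>s\<in>S. f q s * (U (b, c) (b', c') * \<psi> s a b' c')) =
     (\<Sum>s\<in>S. \<Sum>b'\<in>B. \<Sum>c'\<in>C. f q s * (U (b, c) (b', c') * \<psi> s a b' c'))"
    by (rule sum_swap3)
  thus "act_bob U B C (\<lambda>q a b c. \<Sum>s\<in>S. f q s * \<psi> s a b c) q a b c = (\<Sum>s\<in>S. f q s * act_bob U B C (\<lambda>_. \<psi> s) () a b c)"
    by (simp add: act_bob_def sum_distrib_left mult.left_commute)
qed

lemma basis_state_0:
  "basis_state P 0 q = (if rounds P = 0 then act_bob (bob_op P 0) (input_reg (dim_TB P)) {0}
     (start_state P (\<lambda>u x y. if x = fst q \<and> y = snd q then 1 else 0)) ()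
   else start_state P (\<lambda>u x y. if x = fst q \<and> y = snd q then 1 else 0) ())"
  by (simp add: basis_state_def)

lemma basis_state_Suc:
  "basis_state P (Suc i) q =
     (if odd (Suc i) then act_alice (alice_op P (Suc i)) (alice_reg P i) (msg_reg P i) (\<lambda>_. basis_state P i q) ()
      else act_bob (bob_op P (Suc i)) (bob_reg P i) (msg_reg P i) (\<lambda>_. basis_state P i q) ())"
  by (simp add: basis_state_def)

text \<open>No isometry touches R, so a run on a superposition of inputs is the superposition of the
  runs on basis inputs, with coefficients depending only on the label of R.\<close>

lemma state_after_sum:
  fixes P :: "('x::finite, 'y::finite, 'za, 'zb) protocol"
  shows "state_after P \<phi> i = (\<lambda>q a b c. \<Sum>s\<in>UNIV. \<phi> q (fst s) (snd s) * basis_state P i s a b c)"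
proof -
  have st: "start_state P \<phi> = (\<lambda>q a b c. \<Sum>s\<in>UNIV. \<phi> q (fst s) (snd s) *
      start_state P (\<lambda>u x y. if x = fst s \<and> y = snd s then 1 else 0) () a b c)"
  proof (intro ext)
    fix q a b c
    have *: "(\<Sum>s\<in>UNIV. \<phi> q (fst s) (snd s) * (if x = fst s \<and> y = snd s then 1 else 0) * z) = \<phi> q x y * z" for x y z
    proof -
      have "(\<Sum>s\<in>UNIV. \<phi> q (fst s) (snd s) * (if x = fst s \<and> y = snd s then 1 else 0) * z) =
        (\<Sum>s\<in>UNIV. if s = (x, y) then \<phi> q x y * z else 0)"
        by (intro sum.cong) auto
      thus ?thesis by simp
    qed
    show "start_state P \<phi> q a b c = (\<Sum>s\<in>UNIV. \<phi> q (fst s) (snd s) *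
      start_state P (\<lambda>u x y. if x = fst s \<and> y = snd s then 1 else 0) () a b c)"
      using * by (auto simp: start_state_def mult.assoc split: label.split)
  qed
  show ?thesis
  proof (induction i)
    case 0
    show ?case
    proof (cases "rounds P = 0")
      case True
      thus ?thesis
        by (simp add: basis_state_0) (subst st, subst act_bob_sum, simp)
    next
      case False
      thus ?thesis by (simp add: basis_state_0) (subst st, simp)
    qed
  next
    case (Suc i)
    show ?case
      by (simp add: basis_state_Suc Suc.IH act_alice_sum act_bob_sum)
  qed
qed

lemma state_after_purified_input:
  fixes P :: "('x::finite, 'y::finite, 'za, 'zb) protocol"
  shows "state_after P (purified_input \<mu>) i q a b c = of_real (sqrt (pmf \<mu> q)) * basis_state P i q a b c"
proof -
  have "state_after P (purified_input \<mu>) i q a b c =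
      (\<Sum>s\<in>UNIV. if s = q then of_real (sqrt (pmf \<mu> q)) * basis_state P i q a b c else 0)"
    unfolding state_after_sum by (intro sum.cong) (auto simp: purified_input_def)
  thus ?thesis by simp
qed

lemma finite_input_reg [simp]: "finite (input_reg d :: ('i::finite, 'o) label set)"
proof -
  have "(input_reg d :: ('i, 'o) label set) = (\<lambda>(x, t). Inp x t) ` (UNIV \<times> {..<d})"
    by (auto simp: input_reg_def)
  thus ?thesis by simp
qed

lemma finite_new_reg [simp]: "finite (new_reg P i :: ('i, 'o::finite) label set)"
proof -
  have "(new_reg P i :: ('i, 'o) label set) \<subseteq> (\<lambda>(x, t). Out x t) ` (UNIV \<times> {..<mem_dim P i}) \<union> Mem ` {..<mem_dim P i}"
    by (auto simp: new_reg_def)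
  thus ?thesis by (rule finite_subset) simp
qed

lemma finite_msg_reg [simp]: "finite (msg_reg P i)"
  by (simp add: msg_reg_def)

lemma finite_alice_reg [simp]: "finite (alice_reg (P :: ('x::finite, 'y, 'za::finite, 'zb) protocol) i)"
  by (induction i) auto

lemma finite_bob_reg [simp]: "finite (bob_reg (P :: ('x, 'y::finite, 'za, 'zb::finite) protocol) i)"
  by (induction i) auto

definition info_cost :: "('x::finite, 'y::finite, 'za::finite, 'zb::finite) protocol \<Rightarrow> ('x \<times> 'y \<Rightarrow> real) \<Rightarrow> real" where
  "info_cost P w = (\<Sum>i\<in>{1..rounds P}. 1 / 2 * round_info (alice_reg P i) (bob_reg P i) (msg_reg P i) w (basis_state P i))"

lemma round_info_swap: "round_info B A C w (swap_players \<psi>) = round_info A B C w \<psi>"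
  by (simp add: round_info_def swap_players_def)

text \<open>After purification the information in a round is symmetric in the two players, so odd
  and even rounds are given by the same expression and the two sums merge.\<close>

lemma QIC_eq_info_cost: "QIC P \<mu> = info_cost P (pmf \<mu>)"
proof -
  let ?f = "\<lambda>i. 1 / 2 * round_info (alice_reg P i) (bob_reg P i) (msg_reg P i) (pmf \<mu>) (basis_state P i)"
  have 1: "cond_mutual_info (msg_reg P i) UNIV (bob_reg P i)
      (\<lambda>(c, q, b) (c', q', b'). \<Sum>a\<in>alice_reg P i. state_after P (purified_input \<mu>) i q a b c * cnj (state_after P (purified_input \<mu>) i q' a b' c')) =
    round_info (alice_reg P i) (bob_reg P i) (msg_reg P i) (pmf \<mu>) (basis_state P i)" for i
    by (rule cond_mutual_info_purified) (simp_all add: state_after_purified_input)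
  have 2: "cond_mutual_info (msg_reg P i) UNIV (alice_reg P i)
      (\<lambda>(c, q, a) (c', q', a'). \<Sum>b\<in>bob_reg P i. state_after P (purified_input \<mu>) i q a b c * cnj (state_after P (purified_input \<mu>) i q' a' b c')) =
    round_info (alice_reg P i) (bob_reg P i) (msg_reg P i) (pmf \<mu>) (basis_state P i)" for i
    using cond_mutual_info_purified[of "bob_reg P i" "alice_reg P i" "msg_reg P i" "pmf \<mu>"
        "swap_players (state_after P (purified_input \<mu>) i)" "swap_players (basis_state P i)"]
    by (simp add: state_after_purified_input round_info_swap swap_players_def[of "state_after P (purified_input \<mu>) i"])
       (simp add: swap_players_def)
  have "QIC P \<mu> = (\<Sum>i | i \<in> {1..rounds P} \<and> odd i. ?f i) + (\<Sum>i | i \<in> {1..rounds P} \<and> even i. ?f i)"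
    unfolding QIC_def Let_def 1 2 ..
  also have "\<dots> = (\<Sum>i\<in>{i. i \<in> {1..rounds P} \<and> odd i} \<union> {i. i \<in> {1..rounds P} \<and> even i}. ?f i)"
    by (rule sum.union_disjoint[symmetric]) auto
  also have "{i. i \<in> {1..rounds P} \<and> odd i} \<union> {i. i \<in> {1..rounds P} \<and> even i} = {1..rounds P}"
    by auto
  finally show ?thesis by (simp add: info_cost_def)
qed

lemma info_cost_concave:
  assumes "\<And>q. 0 \<le> w q" "\<And>q. 0 \<le> w' q" "0 \<le> s" "0 \<le> t"
  shows "s * info_cost P w + t * info_cost P w' \<le> info_cost P (\<lambda>q. s * w q + t * w' q)"
proof -
  have "s * info_cost P w + t * info_cost P w' = (\<Sum>i\<in>{1..rounds P}. 1 / 2 *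
      (s * round_info (alice_reg P i) (bob_reg P i) (msg_reg P i) w (basis_state P i) +
       t * round_info (alice_reg P i) (bob_reg P i) (msg_reg P i) w' (basis_state P i)))"
    by (simp add: info_cost_def sum_distrib_left sum.distrib[symmetric] algebra_simps)
  also have "\<dots> \<le> info_cost P (\<lambda>q. s * w q + t * w' q)"
    unfolding info_cost_def using assms by (intro sum_mono mult_left_mono round_info_concave) auto
  finally show ?thesis .
qed

lemma info_cost_nonneg:
  assumes "\<And>q. 0 \<le> w q"
  shows "0 \<le> info_cost P w"
  unfolding info_cost_def using assms by (auto intro!: sum_nonneg round_info_nonneg)

text \<open>
  The register of a mixture contains that of protocol f (0 or 1) in the indices congruent to f modulo 3;
  the residue 2 makes room for extending controlled isometries to the rest of their domain.
\<close>

primrec enc :: "nat \<Rightarrow> ('i, 'o) label \<Rightarrow> ('i, 'o) label" where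
  "enc f (Inp x t) = Inp x (3 * t + f)"
| "enc f (Mem k) = Mem (3 * k + f)"
| "enc f (Out z k) = Out z (3 * k + f)"

lemma three_mult_add_eq_iff: "f < 3 \<Longrightarrow> g < 3 \<Longrightarrow> 3 * k + f = 3 * l + g \<longleftrightarrow> k = l \<and> f = (g::nat)"
  by presburger

lemma enc_eq_iff: "f < 3 \<Longrightarrow> g < 3 \<Longrightarrow> enc f a = enc g b \<longleftrightarrow> f = g \<and> a = b"
  by (cases a; cases b) (auto simp: three_mult_add_eq_iff)

text \<open>Collapses a sum over a large register to the disjoint embedded copies that carry its
  nonzero terms, which is how sums over registers of a mixture are evaluated.\<close>

lemma sum_embedded:
  assumes "finite S" "finite F" "\<And>f. f \<in> F \<Longrightarrow> finite (T f)"
    and "\<And>f t. f \<in> F \<Longrightarrow> t \<in> T f \<Longrightarrow> \<iota> f t \<in> S"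
    and inj: "\<And>f g t u. f \<in> F \<Longrightarrow> g \<in> F \<Longrightarrow> t \<in> T f \<Longrightarrow> u \<in> T g \<Longrightarrow> \<iota> f t = \<iota> g u \<Longrightarrow> f = g \<and> t = u"
    and zero: "\<And>s. s \<in> S \<Longrightarrow> (\<And>f t. f \<in> F \<Longrightarrow> t \<in> T f \<Longrightarrow> s \<noteq> \<iota> f t) \<Longrightarrow> h s = 0"
  shows "(\<Sum>s\<in>S. h s) = (\<Sum>f\<in>F. \<Sum>t\<in>T f. h (\<iota> f t))"
proof -
  let ?K = "Sigma F T"
  let ?e = "\<lambda>(f, t). \<iota> f t"
  have "inj_on ?e ?K"
  proof (rule inj_onI, clarify)
    fix f t g u assume "f \<in> F" "t \<in> T f" "g \<in> F" "u \<in> T g" "\<iota> f t = \<iota> g u"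
    thus "f = g \<and> t = u" using inj[of f g t u] by blast
  qed
  hence "(\<Sum>s\<in>?e ` ?K. h s) = (\<Sum>k\<in>?K. h (?e k))"
    by (simp add: sum.reindex)
  also have "(\<Sum>s\<in>?e ` ?K. h s) = (\<Sum>s\<in>S. h s)"
    using assms by (intro sum.mono_neutral_left) (force intro!: zero)+
  also have "(\<Sum>k\<in>?K. h (?e k)) = (\<Sum>f\<in>F. \<Sum>t\<in>T f. h (\<iota> f t))"
    using assms(2,3) by (subst sum.Sigma) (auto intro!: sum.cong)
  finally show ?thesis .
qed

section \<open>Entropy of a block diagonal operator\<close>

text \<open>The direct sum of the operators \<open>p f\<close> times \<open>\<sigma> f\<close>,
  placed along the embeddings. The last condition also makes \<rho> vanish on the part of J that no
  block covers.\<close>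

definition block_diagonal :: "'f set \<Rightarrow> ('f \<Rightarrow> real) \<Rightarrow> ('f \<Rightarrow> 'k \<Rightarrow> 'j) \<Rightarrow> ('f \<Rightarrow> 'k set) \<Rightarrow> 'j set \<Rightarrow>
    ('f \<Rightarrow> 'k \<Rightarrow> 'k \<Rightarrow> complex) \<Rightarrow> ('j \<Rightarrow> 'j \<Rightarrow> complex) \<Rightarrow> bool" where
  "block_diagonal F p \<iota> K J \<sigma> \<rho> \<longleftrightarrow>
     (\<forall>f\<in>F. \<forall>k\<in>K f. \<iota> f k \<in> J) \<and>
     (\<forall>f\<in>F. \<forall>g\<in>F. \<forall>k\<in>K f. \<forall>l\<in>K g. \<iota> f k = \<iota> g l \<longrightarrow> f = g \<and> k = l) \<and>
     (\<forall>f\<in>F. \<forall>k\<in>K f. \<forall>l\<in>K f. \<rho> (\<iota> f k) (\<iota> f l) = of_real (p f) * \<sigma> f k l) \<and>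
     (\<forall>i\<in>J. \<forall>j\<in>J. (\<forall>f\<in>F. i \<in> \<iota> f ` K f \<longrightarrow> j \<notin> \<iota> f ` K f) \<longrightarrow> \<rho> i j = 0)"

text \<open>The eigenvalues of \<rho> are the products \<open>p f * l f k\<close> and zeros. The
  logarithm of the product splits into the entropies of the blocks and the classical entropy of the
  weights, each weight being multiplied by the trace of its block.\<close>

lemma vn_entropy_block_diagonal:
  assumes F: "finite F" and K: "\<And>f. f \<in> F \<Longrightarrow> finite (K f)" and J: "finite J"
    and psd: "\<And>f. f \<in> F \<Longrightarrow> psd (K f) (\<sigma> f)" and b: "block_diagonal F p \<iota> K J \<sigma> \<rho>"
  shows "vn_entropy J \<rho> = (\<Sum>f\<in>F. p f * vn_entropy (K f) (\<sigma> f) - p f * log 2 (p f) * Re (tr (K f) (\<sigma> f)))"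
proof -
  define res where "res f i j = (if i \<in> K f \<and> j \<in> K f then \<sigma> f i j else 0)" for f i j
  have "\<forall>f\<in>F. \<exists>U l. unitary (K f) U \<and> (\<forall>k\<in>K f. 0 \<le> l k) \<and> res f = eig (K f) U l"
  proof
    fix f assume f: "f \<in> F"
    have "psd (K f) (res f)" by (rule psd_cong[OF psd[OF f]]) (simp add: res_def)
    moreover have "supported (K f) (res f)" by (auto simp: supported_def res_def)
    ultimately show "\<exists>U l. unitary (K f) U \<and> (\<forall>k\<in>K f. 0 \<le> l k) \<and> res f = eig (K f) U l"
      using psd_diagonalization[OF K[OF f]] by metis
  qed
  then obtain U l where U: "\<And>f. f \<in> F \<Longrightarrow> unitary (K f) (U f)"
      and l: "\<And>f k. f \<in> F \<Longrightarrow> k \<in> K f \<Longrightarrow> 0 \<le> l f k" and res: "\<And>f. f \<in> F \<Longrightarrow> res f = eig (K f) (U f) (l f)"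
    by metis
  note b' = b[unfolded block_diagonal_def]
  have mem: "\<iota> f k \<in> J" if "f \<in> F" "k \<in> K f" for f k
    using b' that by blast
  have inj: "f = g \<and> k = m" if "f \<in> F" "g \<in> F" "k \<in> K f" "m \<in> K g" "\<iota> f k = \<iota> g m" for f g k m
    using b' that by blast
  have blk: "\<rho> (\<iota> f k) (\<iota> f m) = of_real (p f) * \<sigma> f k m" if "f \<in> F" "k \<in> K f" "m \<in> K f" for f k m
    using b' that by blast
  have off: "\<rho> i j = 0" if "i \<in> J" "j \<in> J" "\<And>f. f \<in> F \<Longrightarrow> i \<in> \<iota> f ` K f \<Longrightarrow> j \<notin> \<iota> f ` K f" for i j
    using b' that by blast
  \<comment> \<open>The eigenvectors of the blocks, transported by the embedding and extended by
    zero.\<close>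
  define v where "v s j = (if j \<in> \<iota> (fst s) ` K (fst s) then U (fst s) (inv_into (K (fst s)) (\<iota> (fst s)) j) (snd s) else 0)" for s j
  have vi: "v (f, k) (\<iota> f m) = U f m k" if "f \<in> F" "m \<in> K f" for f k m
  proof -
    have "inj_on (\<iota> f) (K f)" using inj[OF that(1,1)] by (auto intro: inj_onI)
    thus ?thesis using that by (simp add: v_def)
  qed
  have v0: "v (f, k) j = 0" if "j \<notin> \<iota> f ` K f" for f k j
    using that by (simp add: v_def)
  have "vn_entropy J \<rho> = - (\<Sum>s\<in>Sigma F K. (p (fst s) * l (fst s) (snd s)) * log 2 (p (fst s) * l (fst s) (snd s)))"
  proof (rule vn_entropy_orthonormal[OF J, where v = v])
    show "finite (Sigma F K)" using F K by simp
  next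
    fix s t assume s: "s \<in> Sigma F K" and t: "t \<in> Sigma F K"
    obtain f k g m where st: "s = (f, k)" "t = (g, m)" by (cases s, cases t) auto
    have fk: "f \<in> F" "k \<in> K f" "g \<in> F" "m \<in> K g" using s t st by auto
    show "(\<Sum>j\<in>J. cnj (v s j) * v t j) = (if s = t then 1 else 0)"
    proof (cases "f = g")
      case True
      have "(\<Sum>j\<in>J. cnj (v s j) * v t j) = (\<Sum>h\<in>{f}. \<Sum>j\<in>K h. cnj (v s (\<iota> h j)) * v t (\<iota> h j))"
        using fk True by (intro sum_embedded J K mem) (auto simp: st dest: inj intro!: v0)
      also have "\<dots> = (\<Sum>j\<in>K f. cnj (U f j k) * U f j m)"
        using fk True by (simp add: st vi)
      also have "\<dots> = mm (K f) (adj (U f)) (U f) k m"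
        by (simp add: mm_def adj_def)
      also have "\<dots> = (if s = t then 1 else 0)"
        using U[OF fk(1)] fk True by (simp add: unitary_def idm_def st)
      finally show ?thesis .
    next
      case False
      have "cnj (v s j) * v t j = 0" for j
        using inj[OF fk(1,3)] False v0[of j f k] v0[of j g m] by (auto simp: st)
      hence "(\<Sum>j\<in>J. cnj (v s j) * v t j) = 0" by (intro sum.neutral ballI)
      thus ?thesis using False by (simp add: st)
    qed
  next
    fix i j assume ij: "i \<in> J" "j \<in> J"
    have sig: "(\<Sum>s\<in>Sigma F K. of_real (p (fst s) * l (fst s) (snd s)) * v s i * cnj (v s j)) =
      (\<Sum>f\<in>F. \<Sum>k\<in>K f. of_real (p f * l f k) * v (f, k) i * cnj (v (f, k) j))"
      using F K by (subst sum.Sigma) (auto intro!: sum.cong)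
    show "\<rho> i j = (\<Sum>s\<in>Sigma F K. of_real (p (fst s) * l (fst s) (snd s)) * v s i * cnj (v s j))"
    proof (cases "\<exists>f\<in>F. i \<in> \<iota> f ` K f \<and> j \<in> \<iota> f ` K f")
      case True
      then obtain f k m where f: "f \<in> F" "k \<in> K f" "m \<in> K f" "i = \<iota> f k" "j = \<iota> f m" by blast
      have "(\<Sum>g\<in>F. \<Sum>n\<in>K g. of_real (p g * l g n) * v (g, n) i * cnj (v (g, n) j)) =
        (\<Sum>g\<in>F. if g = f then \<Sum>n\<in>K f. of_real (p f * l f n) * v (f, n) i * cnj (v (f, n) j) else 0)"
      proof (intro sum.cong refl)
        fix g assume g: "g \<in> F"
        show "(\<Sum>n\<in>K g. of_real (p g * l g n) * v (g, n) i * cnj (v (g, n) j)) =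
          (if g = f then \<Sum>n\<in>K f. of_real (p f * l f n) * v (f, n) i * cnj (v (f, n) j) else 0)"
        proof (cases "g = f")
          case False
          hence "i \<notin> \<iota> g ` K g" using inj[OF g f(1)] f by blast
          thus ?thesis using False by (simp add: v0)
        qed simp
      qed
      also have "\<dots> = (\<Sum>n\<in>K f. of_real (p f * l f n) * v (f, n) i * cnj (v (f, n) j))"
        using f F by simp
      also have "\<dots> = of_real (p f) * (\<Sum>n\<in>K f. of_real (l f n) * U f k n * cnj (U f m n))"
        using f by (simp add: vi sum_distrib_left mult.assoc)
      also have "(\<Sum>n\<in>K f. of_real (l f n) * U f k n * cnj (U f m n)) = res f k m"
        using f by (simp add: res eig_apply K)
      also have "of_real (p f) * res f k m = \<rho> i j"
        using f blk[of f k m] by (simp add: res_def)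
      finally show ?thesis unfolding sig by simp
    next
      case False
      hence "v (f, k) i * cnj (v (f, k) j) = 0" if "f \<in> F" for f k
        using that v0[of i f k] v0[of j f k] by auto
      hence "(\<Sum>g\<in>F. \<Sum>n\<in>K g. of_real (p g * l g n) * v (g, n) i * cnj (v (g, n) j)) = 0"
        by (intro sum.neutral ballI) (auto simp: mult.assoc)
      thus ?thesis unfolding sig using off[OF ij] False by auto
    qed
  qed
  also have "\<dots> = - (\<Sum>f\<in>F. \<Sum>k\<in>K f. (p f * l f k) * log 2 (p f * l f k))"
    using F K by (subst sum.Sigma) (auto intro!: sum.cong)
  also have "\<dots> = (\<Sum>f\<in>F. - (\<Sum>k\<in>K f. (p f * l f k) * log 2 (p f * l f k)))"
    by (simp only: sum_negf)
  also have "\<dots> = (\<Sum>f\<in>F. p f * vn_entropy (K f) (\<sigma> f) - p f * log 2 (p f) * Re (tr (K f) (\<sigma> f)))"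
  proof (intro sum.cong refl)
    fix f assume f: "f \<in> F"
    have "vn_entropy (K f) (\<sigma> f) = vn_entropy (K f) (res f)"
      by (intro vn_entropy_cong K f) (simp add: res_def)
    hence S: "vn_entropy (K f) (\<sigma> f) = - (\<Sum>k\<in>K f. l f k * log 2 (l f k))"
      by (simp add: res f vn_entropy_eig K U)
    have "tr (K f) (\<sigma> f) = tr (K f) (res f)"
      by (simp add: tr_def res_def)
    hence T: "Re (tr (K f) (\<sigma> f)) = (\<Sum>k\<in>K f. l f k)"
      using f by (simp add: res tr_eig K U)
    have "(p f * l f k) * log 2 (p f * l f k) = p f * (l f k * log 2 (l f k)) + p f * log 2 (p f) * l f k" if "k \<in> K f" for k
    \<comment> \<open>The product rule for the logarithm needs nonzero factors; in the other cases
      both sides vanish.\<close>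
    proof (cases "p f = 0 \<or> l f k = 0")
      case False
      hence "ln (p f * l f k) = ln (p f) + ln (l f k)" by (simp add: ln_mult)
      thus ?thesis by (simp add: log_def add_divide_distrib algebra_simps)
    qed auto
    thus "- (\<Sum>k\<in>K f. (p f * l f k) * log 2 (p f * l f k)) = p f * vn_entropy (K f) (\<sigma> f) - p f * log 2 (p f) * Re (tr (K f) (\<sigma> f))"
      unfolding S T by (simp add: sum_distrib_left sum.distrib)
  qed
  finally show ?thesis .
qed

lemma tr_partial_trace: "tr B (partial_trace C \<rho>) = tr (C \<times> B) \<rho>"
  unfolding tr_def partial_trace_def sum.cartesian_product' by (rule sum.swap)

text \<open>Here the block is determined by B alone, so the same weights and traces occur for the
  joint operator and for its marginal. The entropies of the weights therefore cancel in S(CB) -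
  S(B). The sets \<open>Cf f\<close> may overlap.\<close>

lemma cond_entropy_block_diagonal:
  assumes F: "finite F" and fin: "\<And>f. f \<in> F \<Longrightarrow> finite (Cf f)" "\<And>f. f \<in> F \<Longrightarrow> finite (Bf f)" "finite C" "finite B"
    and psd: "\<And>f. f \<in> F \<Longrightarrow> psd (Cf f \<times> Bf f) (\<sigma> f)"
    and inj: "\<And>f g b b'. f \<in> F \<Longrightarrow> g \<in> F \<Longrightarrow> b \<in> Bf f \<Longrightarrow> b' \<in> Bf g \<Longrightarrow> \<iota> f b = \<iota> g b' \<Longrightarrow> f = g \<and> b = b'"
    and C: "\<And>f. f \<in> F \<Longrightarrow> Cf f \<subseteq> C" and B: "\<And>f b. f \<in> F \<Longrightarrow> b \<in> Bf f \<Longrightarrow> \<iota> f b \<in> B"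
    and blk: "\<And>f c b c' b'. f \<in> F \<Longrightarrow> c \<in> Cf f \<Longrightarrow> c' \<in> Cf f \<Longrightarrow> b \<in> Bf f \<Longrightarrow> b' \<in> Bf f \<Longrightarrow>
      \<rho> (c, \<iota> f b) (c', \<iota> f b') = of_real (p f) * \<sigma> f (c, b) (c', b')"
    and off: "\<And>c b c' b'. c \<in> C \<Longrightarrow> c' \<in> C \<Longrightarrow> b \<in> B \<Longrightarrow> b' \<in> B \<Longrightarrow>
      (\<And>f. f \<in> F \<Longrightarrow> c \<in> Cf f \<Longrightarrow> c' \<in> Cf f \<Longrightarrow> b \<in> \<iota> f ` Bf f \<Longrightarrow> b' \<in> \<iota> f ` Bf f \<Longrightarrow> False) \<Longrightarrow> \<rho> (c, b) (c', b') = 0"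
  shows "cond_entropy C B \<rho> = (\<Sum>f\<in>F. p f * cond_entropy (Cf f) (Bf f) (\<sigma> f))"
proof -
  have 1: "block_diagonal F p (\<lambda>f (c, b). (c, \<iota> f b)) (\<lambda>f. Cf f \<times> Bf f) (C \<times> B) \<sigma> \<rho>"
    unfolding block_diagonal_def
  proof (intro conjI ballI impI)
    fix f k assume "f \<in> F" "k \<in> Cf f \<times> Bf f"
    thus "(case k of (c, b) \<Rightarrow> (c, \<iota> f b)) \<in> C \<times> B" using C[of f] B[of f "snd k"] by auto
  next
    fix f g k l assume "f \<in> F" "g \<in> F" "k \<in> Cf f \<times> Bf f" "l \<in> Cf g \<times> Bf g"
      "(case k of (c, b) \<Rightarrow> (c, \<iota> f b)) = (case l of (c, b) \<Rightarrow> (c, \<iota> g b))"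
    thus "f = g" "k = l" using inj[of f g "snd k" "snd l"] by auto
  next
    fix f k l assume "f \<in> F" "k \<in> Cf f \<times> Bf f" "l \<in> Cf f \<times> Bf f"
    thus "\<rho> (case k of (c, b) \<Rightarrow> (c, \<iota> f b)) (case l of (c, b) \<Rightarrow> (c, \<iota> f b)) = of_real (p f) * \<sigma> f k l"
      by (auto simp: blk)
  next
    fix i j assume ij: "i \<in> C \<times> B" "j \<in> C \<times> B"
      and h: "\<forall>f\<in>F. i \<in> (\<lambda>(c, b). (c, \<iota> f b)) ` (Cf f \<times> Bf f) \<longrightarrow> j \<notin> (\<lambda>(c, b). (c, \<iota> f b)) ` (Cf f \<times> Bf f)"
    obtain c b c' b' where e: "i = (c, b)" "j = (c', b')" by (cases i, cases j) auto
    show "\<rho> i j = 0" unfolding e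
    proof (rule off)
      fix f assume "f \<in> F" "c \<in> Cf f" "c' \<in> Cf f" "b \<in> \<iota> f ` Bf f" "b' \<in> \<iota> f ` Bf f"
      hence "i \<in> (\<lambda>(c, b). (c, \<iota> f b)) ` (Cf f \<times> Bf f)" "j \<in> (\<lambda>(c, b). (c, \<iota> f b)) ` (Cf f \<times> Bf f)"
        unfolding e by force+
      thus False using h \<open>f \<in> F\<close> by blast
    qed (use ij e in auto)
  qed
  have 2: "block_diagonal F p \<iota> Bf B (\<lambda>f. partial_trace (Cf f) (\<sigma> f)) (partial_trace C \<rho>)"
    unfolding block_diagonal_def
  proof (intro conjI ballI impI)
    fix f k assume "f \<in> F" "k \<in> Bf f"
    thus "\<iota> f k \<in> B" by (rule B)
  next
    fix f g k l assume "f \<in> F" "g \<in> F" "k \<in> Bf f" "l \<in> Bf g" "\<iota> f k = \<iota> g l"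
    thus "f = g" "k = l" using inj by blast+
  next
    fix f k l assume f: "f \<in> F" "k \<in> Bf f" "l \<in> Bf f"
    have "partial_trace C \<rho> (\<iota> f k) (\<iota> f l) = (\<Sum>c\<in>Cf f. \<rho> (c, \<iota> f k) (c, \<iota> f l))"
      unfolding partial_trace_def
    proof (intro sum.mono_neutral_right fin C f ballI)
      \<comment> \<open>The index on B already fixes the block f, so a message outside
        \<open>Cf f\<close> contributes nothing.\<close>
      fix c assume c: "c \<in> C - Cf f"
      show "\<rho> (c, \<iota> f k) (c, \<iota> f l) = 0"
      proof (rule off)
        fix g assume "g \<in> F" "c \<in> Cf g" "\<iota> f k \<in> \<iota> g ` Bf g"
        thus False using c f inj[of f g k] by blast
      qed (use c f B in auto)
    qed
    also have "\<dots> = of_real (p f) * partial_trace (Cf f) (\<sigma> f) k l"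
      using f by (simp add: blk partial_trace_def sum_distrib_left)
    finally show "partial_trace C \<rho> (\<iota> f k) (\<iota> f l) = of_real (p f) * partial_trace (Cf f) (\<sigma> f) k l" .
  next
    fix b b' assume b: "b \<in> B" "b' \<in> B" and h: "\<forall>f\<in>F. b \<in> \<iota> f ` Bf f \<longrightarrow> b' \<notin> \<iota> f ` Bf f"
    have "\<rho> (c, b) (c, b') = 0" if "c \<in> C" for c
      using h by (intro off that b) blast
    thus "partial_trace C \<rho> b b' = 0" by (simp add: partial_trace_def)
  qed
  show ?thesis
    unfolding cond_entropy_def
    using vn_entropy_block_diagonal[OF F _ _ psd 1] vn_entropy_block_diagonal[OF F fin(2,4) psd_partial_trace[OF fin(1,2) psd] 2] fin
    by (simp add: tr_partial_trace sum_subtractf[symmetric] algebra_simps)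
qed

section \<open>Mixtures of states\<close>

text \<open>\<psi> is the superposition of the two vectors with amplitudes
  \<open>sqrt (p f)\<close>, in which both players' labels carry the flag f. The message carries no
  flag.\<close>

definition mixed :: "(nat \<Rightarrow> real) \<Rightarrow> ('i, 'o) label set \<Rightarrow> ('k, 'u) label set \<Rightarrow> nat set \<Rightarrow>
    (nat \<Rightarrow> ('i, 'o) label set) \<Rightarrow> (nat \<Rightarrow> ('k, 'u) label set) \<Rightarrow> (nat \<Rightarrow> nat set) \<Rightarrow>
    (('i, 'o) label \<Rightarrow> ('k, 'u) label \<Rightarrow> nat \<Rightarrow> complex) \<Rightarrow>
    (nat \<Rightarrow> ('i, 'o) label \<Rightarrow> ('k, 'u) label \<Rightarrow> nat \<Rightarrow> complex) \<Rightarrow> bool" where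
  "mixed p A B C Af Bf Cf \<psi> \<psi>f \<longleftrightarrow>
     (\<forall>f<2. \<forall>a\<in>Af f. \<forall>b\<in>Bf f. \<forall>c\<in>Cf f. \<psi> (enc f a) (enc f b) c = of_real (sqrt (p f)) * \<psi>f f a b c) \<and>
     (\<forall>a\<in>A. \<forall>b\<in>B. \<forall>c\<in>C. (\<forall>f<2. a \<in> enc f ` Af f \<longrightarrow> b \<in> enc f ` Bf f \<longrightarrow> c \<notin> Cf f) \<longrightarrow> \<psi> a b c = 0)"

definition reg_embeds :: "(nat \<Rightarrow> ('i, 'o) label set) \<Rightarrow> ('i, 'o) label set \<Rightarrow> bool" where
  "reg_embeds Af A \<longleftrightarrow> finite A \<and> (\<forall>f<2. finite (Af f) \<and> enc f ` Af f \<subseteq> A)"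

definition msg_embeds :: "(nat \<Rightarrow> nat set) \<Rightarrow> nat set \<Rightarrow> bool" where
  "msg_embeds Cf C \<longleftrightarrow> finite C \<and> (\<forall>f<2. Cf f \<subseteq> C)"

lemma mixed_swap:
  assumes "mixed p A B C Af Bf Cf \<psi> \<psi>f"
  shows "mixed p B A C Bf Af Cf (\<lambda>b a. \<psi> a b) (\<lambda>f b a. \<psi>f f a b)"
  using assms unfolding mixed_def by blast

text \<open>The register that is traced out contains a copy of the flag. A nonzero product of
  amplitudes with the same label in A forces equal flags, hence the reduced operator is block
  diagonal with weights \<open>p f\<close>.\<close>

lemma cond_entropy_mixed:
  fixes \<psi> :: "'q::finite \<Rightarrow> ('i, 'o) label \<Rightarrow> ('k, 'u) label \<Rightarrow> nat \<Rightarrow> complex"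
  assumes A: "reg_embeds Af A" and B: "reg_embeds Bf B" and C: "msg_embeds Cf C"
    and m: "\<And>q. mixed p A B C Af Bf Cf (\<psi> q) (\<lambda>f. \<psi>f f q)"
    and p: "\<And>f. f < 2 \<Longrightarrow> 0 \<le> p f" and w: "\<And>q. 0 \<le> w q"
  shows "cond_entropy C B (reduced A w \<psi>) = (\<Sum>f<2. p f * cond_entropy (Cf f) (Bf f) (reduced (Af f) w (\<psi>f f)))"
proof (rule cond_entropy_block_diagonal)
  have fC: "finite (Cf f)" if "f < 2" for f
    using C that by (auto simp: msg_embeds_def intro: finite_subset)
  show "psd (Cf f \<times> Bf f) (reduced (Af f) w (\<psi>f f))" if "f \<in> {..<2}" for f
    using that B fC by (intro psd_reduced w) (auto simp: reg_embeds_def)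
  have val: "\<psi> q (enc f a) (enc f b) c = of_real (sqrt (p f)) * \<psi>f f q a b c"
    if "f < 2" "a \<in> Af f" "b \<in> Bf f" "c \<in> Cf f" for f q a b c
    using m[of q] that by (auto simp: mixed_def)
  have zero: "\<psi> q a b c = 0" if "a \<in> A" "b \<in> B" "c \<in> C" "\<And>f. f < 2 \<Longrightarrow> a \<in> enc f ` Af f \<Longrightarrow> b \<in> enc f ` Bf f \<Longrightarrow> c \<notin> Cf f" for q a b c
    using m[of q] that unfolding mixed_def by blast
  show "reduced A w \<psi> (c, enc f b) (c', enc f b') = of_real (p f) * reduced (Af f) w (\<psi>f f) (c, b) (c', b')"
    if h: "f \<in> {..<2}" "c \<in> Cf f" "c' \<in> Cf f" "b \<in> Bf f" "b' \<in> Bf f" for f c b c' b'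
  proof -
    have f: "f < 2" "f < 3" using h by auto
    have mem: "c \<in> C" "c' \<in> C" "enc f b \<in> B" "enc f b' \<in> B"
      using h B C by (auto simp: reg_embeds_def msg_embeds_def)
    have "(\<Sum>a\<in>A. of_real (w q) * \<psi> q a (enc f b) c * cnj (\<psi> q a (enc f b') c')) =
        of_real (p f) * (\<Sum>a\<in>Af f. of_real (w q) * \<psi>f f q a b c * cnj (\<psi>f f q a b' c'))" for q
    proof -
      have "(\<Sum>a\<in>A. of_real (w q) * \<psi> q a (enc f b) c * cnj (\<psi> q a (enc f b') c')) =
          (\<Sum>g\<in>{f}. \<Sum>a\<in>Af g. of_real (w q) * \<psi> q (enc g a) (enc f b) c * cnj (\<psi> q (enc g a) (enc f b') c'))"
      proof (rule sum_embedded)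
        fix a assume a: "a \<in> A" and na: "\<And>g t. g \<in> {f} \<Longrightarrow> t \<in> Af g \<Longrightarrow> a \<noteq> enc g t"
        have "\<psi> q a (enc f b) c = 0"
        proof (rule zero[OF a mem(3,1)])
          fix g assume "g < 2" "a \<in> enc g ` Af g" "enc f b \<in> enc g ` Bf g"
          hence "f = g" "a \<in> enc g ` Af g" using f by (auto simp: enc_eq_iff)
          thus "c \<notin> Cf g" using na by blast
        qed
        thus "of_real (w q) * \<psi> q a (enc f b) c * cnj (\<psi> q a (enc f b') c') = 0" by simp
      qed (use A f in \<open>auto simp: reg_embeds_def enc_eq_iff\<close>)
      also have "\<dots> = (\<Sum>a\<in>Af f. of_real (sqrt (p f)) * of_real (sqrt (p f)) * (of_real (w q) * \<psi>f f q a b c * cnj (\<psi>f f q a b' c')))"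
        using f h by (simp add: val mult_ac)
      also have "complex_of_real (sqrt (p f)) * of_real (sqrt (p f)) = of_real (p f)"
        using p[OF f(1)] by (simp flip: of_real_mult)
      finally show ?thesis by (simp add: sum_distrib_left)
    qed
    thus ?thesis by (simp add: reduced_def sum_distrib_left)
  qed
  show "reduced A w \<psi> (c, b) (c', b') = 0"
    if h: "c \<in> C" "c' \<in> C" "b \<in> B" "b' \<in> B"
      "\<And>f. f \<in> {..<2} \<Longrightarrow> c \<in> Cf f \<Longrightarrow> c' \<in> Cf f \<Longrightarrow> b \<in> enc f ` Bf f \<Longrightarrow> b' \<in> enc f ` Bf f \<Longrightarrow> False" for c b c' b'
  proof -
    have "\<psi> q a b c * cnj (\<psi> q a b' c') = 0" if a: "a \<in> A" for q a
    proof (rule ccontr)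
      assume "\<psi> q a b c * cnj (\<psi> q a b' c') \<noteq> 0"
      hence nz: "\<psi> q a b c \<noteq> 0" "\<psi> q a b' c' \<noteq> 0" by auto
      obtain f where f: "f < 2" "a \<in> enc f ` Af f" "b \<in> enc f ` Bf f" "c \<in> Cf f"
        using zero[OF a h(3,1)] nz(1) by blast
      obtain g where g: "g < 2" "a \<in> enc g ` Af g" "b' \<in> enc g ` Bf g" "c' \<in> Cf g"
        using zero[OF a h(4,2)] nz(2) by blast
      have "f = g" using f g by (auto simp: enc_eq_iff)
      thus False using h(5)[of f] f g by auto
    qed
    hence "(\<Sum>q\<in>UNIV. \<Sum>a\<in>A. of_real (w q) * (\<psi> q a b c * cnj (\<psi> q a b' c'))) = 0"
      by (intro sum.neutral ballI) (simp only: mult_zero_right)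
    thus ?thesis by (simp add: reduced_def mult.assoc)
  qed
  show "f = g \<and> b = b'" if "f \<in> {..<2}" "g \<in> {..<2}" "enc f b = enc g b'" for f g b b'
    using that by (simp add: enc_eq_iff)
  show "finite (Cf f)" if "f \<in> {..<2}" for f
    using C that by (auto simp: msg_embeds_def intro: finite_subset)
qed (use A B C in \<open>auto simp: reg_embeds_def msg_embeds_def image_subset_iff\<close>)

lemma round_info_mixed:
  fixes \<psi> :: "'q::finite \<Rightarrow> ('i, 'o) label \<Rightarrow> ('k, 'u) label \<Rightarrow> nat \<Rightarrow> complex"
  assumes A: "reg_embeds Af A" and B: "reg_embeds Bf B" and C: "msg_embeds Cf C"
    and m: "\<And>q. mixed p A B C Af Bf Cf (\<psi> q) (\<lambda>f. \<psi>f f q)"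
    and p: "\<And>f. f < 2 \<Longrightarrow> 0 \<le> p f" and w: "\<And>q. 0 \<le> w q"
  shows "round_info A B C w \<psi> = (\<Sum>f<2. p f * round_info (Af f) (Bf f) (Cf f) w (\<psi>f f))"
proof -
  have m': "mixed p B A C Bf Af Cf (swap_players \<psi> q) (\<lambda>f. swap_players (\<psi>f f) q)" for q
    using mixed_swap[OF m[of q]] by (simp add: swap_players_def)
  have "cond_entropy C A (reduced B w (swap_players \<psi>)) =
      (\<Sum>f<2. p f * cond_entropy (Cf f) (Af f) (reduced (Bf f) w (swap_players (\<psi>f f))))"
    by (rule cond_entropy_mixed[OF B A C]) (rule m' p w | assumption)+
  moreover have "cond_entropy C B (reduced A w \<psi>) = (\<Sum>f<2. p f * cond_entropy (Cf f) (Bf f) (reduced (Af f) w (\<psi>f f)))"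
    by (rule cond_entropy_mixed[OF A B C]) (rule m p w | assumption)+
  ultimately show ?thesis by (simp add: round_info_def sum.distrib[symmetric] distrib_left)
qed

lemma finite_out_labels:
  fixes A :: "('i, 'o) label set"
  shows "finite A \<Longrightarrow> finite {Out z k :: ('i, 'o) label | k. Out z k \<in> A}"
  by (rule finite_subset[of _ A]) auto

text \<open>The encoding changes only the left-over index and keeps the output value. Vectors with
  different flags live on disjoint labels, so squared amplitudes add up without cross terms.\<close>

lemma output_mixed:
  fixes A :: "('i, 'o) label set" and B :: "('k, 'u) label set"
  assumes A: "reg_embeds Af A" and B: "reg_embeds Bf B" and C: "0 \<in> C" "\<And>f. f < 2 \<Longrightarrow> 0 \<in> Cf f"
    and m: "mixed p A B C Af Bf Cf \<psi> \<psi>f" and p: "\<And>f. f < 2 \<Longrightarrow> 0 \<le> p f"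
  shows "(\<Sum>a\<in>{Out za k | k. Out za k \<in> A}. \<Sum>b\<in>{Out zb l | l. Out zb l \<in> B}. (cmod (\<psi> a b 0))\<^sup>2) =
    (\<Sum>f<2. p f * (\<Sum>a\<in>{Out za k | k. Out za k \<in> Af f}. \<Sum>b\<in>{Out zb l | l. Out zb l \<in> Bf f}. (cmod (\<psi>f f a b 0))\<^sup>2))"
proof -
  let ?S = "\<lambda>(A :: ('i, 'o) label set) (B :: ('k, 'u) label set).
    {Out za k :: ('i, 'o) label | k. Out za k \<in> A} \<times> {Out zb l :: ('k, 'u) label | l. Out zb l \<in> B}"
  have fA: "finite A" "\<And>f. f < 2 \<Longrightarrow> finite (Af f)" and fB: "finite B" "\<And>f. f < 2 \<Longrightarrow> finite (Bf f)"
    and emb: "\<And>f a. f < 2 \<Longrightarrow> a \<in> Af f \<Longrightarrow> enc f a \<in> A" "\<And>f a. f < 2 \<Longrightarrow> a \<in> Bf f \<Longrightarrow> enc f a \<in> B"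
    using A B by (auto simp: reg_embeds_def image_subset_iff)
  have fin: "finite (?S A' B')" if "finite A'" "finite B'" for A' B'
    using that by (intro finite_cartesian_product finite_out_labels)
  have "(\<Sum>s\<in>?S A B. (cmod (\<psi> (fst s) (snd s) 0))\<^sup>2) =
      (\<Sum>f<2. \<Sum>t\<in>?S (Af f) (Bf f). (cmod (\<psi> (fst (enc f (fst t), enc f (snd t))) (snd (enc f (fst t), enc f (snd t))) 0))\<^sup>2)"
  proof (rule sum_embedded)
    show "finite (?S A B)" using fin fA fB by blast
    show "finite (?S (Af f) (Bf f))" if "f \<in> {..<2}" for f using fin fA fB that by blast
    show "(enc f (fst t), enc f (snd t)) \<in> ?S A B" if "f \<in> {..<2}" "t \<in> ?S (Af f) (Bf f)" for f t
      using that emb(1)[of f "fst t"] emb(2)[of f "snd t"] by auto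
    show "f = g \<and> t = u" if "f \<in> {..<2}" "g \<in> {..<2}" "(enc f (fst t), enc f (snd t)) = (enc g (fst u), enc g (snd u))" for f g t u
      using that by (auto simp: enc_eq_iff prod_eq_iff)
    fix s assume s: "s \<in> ?S A B" and ns: "\<And>f t. f \<in> {..<2} \<Longrightarrow> t \<in> ?S (Af f) (Bf f) \<Longrightarrow> s \<noteq> (enc f (fst t), enc f (snd t))"
    have "\<psi> (fst s) (snd s) 0 = 0"
    proof (rule ccontr)
      assume "\<psi> (fst s) (snd s) 0 \<noteq> 0"
      moreover have "fst s \<in> A" "snd s \<in> B" using s by auto
      ultimately obtain f a b where f: "f < 2" "a \<in> Af f" "b \<in> Bf f" "fst s = enc f a" "snd s = enc f b"
        using m C unfolding mixed_def by blast
      have "\<exists>k. a = Out za k" using f(4) s by (cases a) auto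
      moreover have "\<exists>l. b = Out zb l" using f(5) s by (cases b) auto
      ultimately have "(a, b) \<in> ?S (Af f) (Bf f)" using f(2,3) by auto
      moreover have "s = (enc f (fst (a, b)), enc f (snd (a, b)))"
        by (simp add: prod_eq_iff f(4,5))
      ultimately show False using ns f(1) by blast
    qed
    thus "(cmod (\<psi> (fst s) (snd s) 0))\<^sup>2 = 0" by simp
  qed auto
  also have "\<dots> = (\<Sum>f<2. \<Sum>t\<in>?S (Af f) (Bf f). p f * (cmod (\<psi>f f (fst t) (snd t) 0))\<^sup>2)"
  proof (intro sum.cong refl)
    fix f t assume f: "f \<in> {..<2::nat}" and t: "t \<in> ?S (Af f) (Bf f)"
    have "\<psi> (enc f (fst t)) (enc f (snd t)) 0 = of_real (sqrt (p f)) * \<psi>f f (fst t) (snd t) 0"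
    proof -
      have "fst t \<in> Af f" "snd t \<in> Bf f" "f < 2" using f t by auto
      thus ?thesis using m C(2)[of f] unfolding mixed_def by blast
    qed
    thus "(cmod (\<psi> (fst (enc f (fst t), enc f (snd t))) (snd (enc f (fst t), enc f (snd t))) 0))\<^sup>2 = p f * (cmod (\<psi>f f (fst t) (snd t) 0))\<^sup>2"
      using p[of f] f by (simp add: norm_mult power_mult_distrib)
  qed
  finally show ?thesis by (simp add: sum.cartesian_product' sum_distrib_left)
qed

section \<open>Mixtures of protocols\<close>

text \<open>Prescribed on the embedded copies, the isometry maps every remaining basis vector of D
  to its own basis vector \<open>jk d\<close> of E outside all images. Columns of different kinds
  then have disjoint supports and are orthogonal.\<close>

lemma extend_isometries:
  fixes U :: "'f \<Rightarrow> 'l \<Rightarrow> 'k \<Rightarrow> complex" and \<alpha> :: "'f \<Rightarrow> 'k \<Rightarrow> 'd" and \<beta> :: "'f \<Rightarrow> 'l \<Rightarrow> 'e"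
  assumes E: "finite E"
    and \<beta>: "\<And>f y. f \<in> F \<Longrightarrow> y \<in> Ef f \<Longrightarrow> \<beta> f y \<in> E"
    and inj\<alpha>: "\<And>f g x x'. f \<in> F \<Longrightarrow> g \<in> F \<Longrightarrow> x \<in> Df f \<Longrightarrow> x' \<in> Df g \<Longrightarrow> \<alpha> f x = \<alpha> g x' \<Longrightarrow> f = g \<and> x = x'"
    and inj\<beta>: "\<And>f g y y'. f \<in> F \<Longrightarrow> g \<in> F \<Longrightarrow> y \<in> Ef f \<Longrightarrow> y' \<in> Ef g \<Longrightarrow> \<beta> f y = \<beta> g y' \<Longrightarrow> f = g \<and> y = y'"
    and U: "\<And>f. f \<in> F \<Longrightarrow> isometry (Df f) (Ef f) (U f)"
    and jk: "inj_on jk D" "\<And>d. d \<in> D \<Longrightarrow> jk d \<in> E" "\<And>d f. d \<in> D \<Longrightarrow> f \<in> F \<Longrightarrow> jk d \<notin> \<beta> f ` Ef f"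
  shows "\<exists>V. isometry D E V \<and> (\<forall>f\<in>F. \<forall>x\<in>Df f. (\<forall>y\<in>Ef f. V (\<beta> f y) (\<alpha> f x) = U f y x) \<and>
    (\<forall>e. e \<notin> \<beta> f ` Ef f \<longrightarrow> V e (\<alpha> f x) = 0))"
proof -
  let ?a = "\<lambda>(f, x). \<alpha> f x" and ?b = "\<lambda>(f, y). \<beta> f y"
  let ?D = "Sigma F Df" and ?E = "Sigma F Ef"
  have inj: "inj_on ?a ?D" "inj_on ?b ?E"
    using inj\<alpha> inj\<beta> by (auto simp: inj_on_def)
  have dec: "inv_into ?D ?a (\<alpha> f x) = (f, x)" if "f \<in> F" "x \<in> Df f" for f x
    using inv_into_f_f[OF inj(1), of "(f, x)"] that by simp
  have dec': "inv_into ?E ?b (\<beta> f y) = (f, y)" if "f \<in> F" "y \<in> Ef f" for f y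
    using inv_into_f_f[OF inj(2), of "(f, y)"] that by simp
  define V where "V e d = (if d \<in> ?a ` ?D then
      (let (f, x) = inv_into ?D ?a d; (g, y) = inv_into ?E ?b e
       in if e \<in> ?b ` ?E \<and> g = f then U f y x else 0)
    else if e = jk d then 1 else 0)" for e d
  have mem: "\<alpha> f x \<in> ?a ` ?D" if "f \<in> F" "x \<in> Df f" for f x
    using that by (intro image_eqI[of _ _ "(f, x)"]) auto
  have mem': "\<beta> f y \<in> ?b ` ?E" if "f \<in> F" "y \<in> Ef f" for f y
    using that by (intro image_eqI[of _ _ "(f, y)"]) auto
  have V1: "V (\<beta> f y) (\<alpha> f x) = U f y x" if "f \<in> F" "x \<in> Df f" "y \<in> Ef f" for f x y
    using that by (simp add: V_def dec dec' mem mem')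
  have V2: "V e (\<alpha> f x) = 0" if h: "f \<in> F" "x \<in> Df f" "e \<notin> \<beta> f ` Ef f" for f x e
  proof (cases "e \<in> ?b ` ?E")
    case True
    then obtain g y where g: "g \<in> F" "y \<in> Ef g" "e = \<beta> g y" by auto
    hence "g \<noteq> f" using h by auto
    thus ?thesis using g h by (simp add: V_def dec dec' mem)
  next
    case False
    show ?thesis using h by (simp add: V_def dec mem False split: prod.split)
  qed
  have V3: "V e d = (if e = jk d then 1 else 0)" if "\<And>f x. f \<in> F \<Longrightarrow> x \<in> Df f \<Longrightarrow> d \<noteq> \<alpha> f x" for e d
  proof -
    have "d \<notin> ?a ` ?D" using that by auto
    thus ?thesis by (simp add: V_def)
  qed
  have good: "(\<Sum>e\<in>E. cnj (V e (\<alpha> f x)) * V e (\<alpha> g x')) = (if \<alpha> f x = \<alpha> g x' then 1 else 0)"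
    if h: "f \<in> F" "x \<in> Df f" "g \<in> F" "x' \<in> Df g" for f x g x'
  proof (cases "f = g")
    case True
    have ij: "inj_on (\<beta> f) (Ef f)" using inj\<beta>[OF h(1,1)] by (auto intro: inj_onI)
    have "(\<Sum>e\<in>E. cnj (V e (\<alpha> f x)) * V e (\<alpha> g x')) = (\<Sum>e\<in>\<beta> f ` Ef f. cnj (V e (\<alpha> f x)) * V e (\<alpha> g x'))"
      using h \<beta> V2 by (intro sum.mono_neutral_right E) auto
    also have "\<dots> = (\<Sum>y\<in>Ef f. cnj (U f y x) * U f y x')"
      using h True V1 by (subst sum.reindex[OF ij]) simp
    also have "\<dots> = (if x = x' then 1 else 0)"
      using U[OF h(1)] h True unfolding isometry_def by blast
    also have "x = x' \<longleftrightarrow> \<alpha> f x = \<alpha> g x'"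
      using inj\<alpha>[OF h(1,3,2,4)] True by blast
    finally show ?thesis .
  next
    case False
    have "cnj (V e (\<alpha> f x)) * V e (\<alpha> g x') = 0" for e
    proof (cases "e \<in> \<beta> f ` Ef f")
      case True
      then obtain y where y: "y \<in> Ef f" "e = \<beta> f y" by blast
      have "e \<noteq> \<beta> g y'" if "y' \<in> Ef g" for y'
        using inj\<beta>[OF h(1,3) y(1) that] y(2) False by auto
      hence "e \<notin> \<beta> g ` Ef g" by auto
      thus ?thesis using V2[OF h(3,4)] by simp
    qed (simp add: V2[OF h(1,2)])
    hence "(\<Sum>e\<in>E. cnj (V e (\<alpha> f x)) * V e (\<alpha> g x')) = 0" by (intro sum.neutral ballI)
    thus ?thesis using inj\<alpha>[OF h(1,3,2,4)] False by auto
  qed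
  have mixed_zero: "cnj (V e (\<alpha> f x)) * V e d = 0" "cnj (V e d) * V e (\<alpha> f x) = 0"
    if h: "f \<in> F" "x \<in> Df f" "d \<in> D" "\<And>g x'. g \<in> F \<Longrightarrow> x' \<in> Df g \<Longrightarrow> d \<noteq> \<alpha> g x'" for f x d e
  proof -
    have "V e (\<alpha> f x) = 0 \<or> V e d = 0"
      using V2[OF h(1,2)] V3[OF h(4)] jk(3)[OF h(3,1)] by (cases "e = jk d") auto
    thus "cnj (V e (\<alpha> f x)) * V e d = 0" "cnj (V e d) * V e (\<alpha> f x) = 0" by auto
  qed
  have "isometry D E V"
    unfolding isometry_def
  proof (intro ballI)
    fix d d' assume d: "d \<in> D" "d' \<in> D"
    show "(\<Sum>e\<in>E. cnj (V e d) * V e d') = (if d = d' then 1 else 0)"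
    proof (cases "\<exists>f x. f \<in> F \<and> x \<in> Df f \<and> d = \<alpha> f x")
      case True
      then obtain f x where f: "f \<in> F" "x \<in> Df f" "d = \<alpha> f x" by blast
      show ?thesis
      proof (cases "\<exists>f x. f \<in> F \<and> x \<in> Df f \<and> d' = \<alpha> f x")
        case True
        thus ?thesis using good f by blast
      next
        case False
        hence "(\<Sum>e\<in>E. cnj (V e d) * V e d') = 0"
          unfolding f(3) by (intro sum.neutral ballI mixed_zero[OF f(1,2) d(2)]) blast
        moreover have "d \<noteq> d'" using False f by blast
        ultimately show ?thesis by simp
      qed
    next
      case nd: False
      show ?thesis
      proof (cases "\<exists>f x. f \<in> F \<and> x \<in> Df f \<and> d' = \<alpha> f x")
        case True
        then obtain f x where f: "f \<in> F" "x \<in> Df f" "d' = \<alpha> f x" by blast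
        hence "(\<Sum>e\<in>E. cnj (V e d) * V e d') = 0"
          unfolding f(3) using nd by (intro sum.neutral ballI mixed_zero(2)[OF f(1,2) d(1)]) blast
        moreover have "d \<noteq> d'" using nd f by blast
        ultimately show ?thesis by simp
      next
        case False
        have e: "V e d = (if e = jk d then 1 else 0)" "V e d' = (if e = jk d' then 1 else 0)" for e
          using V3[of d e] V3[of d' e] nd False by blast+
        have "(\<Sum>e\<in>E. cnj (V e d) * V e d') = (\<Sum>e\<in>E. if e = jk d then if jk d = jk d' then 1 else 0 else 0)"
          unfolding e by (intro sum.cong) auto
        thus ?thesis using E jk(2)[OF d(1)] jk(1) d by (simp add: inj_on_eq_iff)
      qed
    qed
  qed
  thus ?thesis using V1 V2 by blast
qed

text \<open>V is controlled by the flag: it acts as \<open>U f\<close> on block f, and the second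
  clause forbids leakage into the other block or into labels outside both.\<close>

definition op_mixes :: "(nat \<Rightarrow> ('i, 'o) label set) \<Rightarrow> (nat \<Rightarrow> nat set) \<Rightarrow> (nat \<Rightarrow> ('i, 'o) label set) \<Rightarrow> (nat \<Rightarrow> nat set) \<Rightarrow>
    (nat \<Rightarrow> ('i, 'o) label \<times> nat \<Rightarrow> ('i, 'o) label \<times> nat \<Rightarrow> complex) \<Rightarrow>
    (('i, 'o) label \<times> nat \<Rightarrow> ('i, 'o) label \<times> nat \<Rightarrow> complex) \<Rightarrow> bool" where
  "op_mixes Af Cf Af' Cf' U V \<longleftrightarrow>
     (\<forall>f<2. \<forall>a\<in>Af f. \<forall>c\<in>Cf f.
        (\<forall>a'\<in>Af' f. \<forall>c'\<in>Cf' f. V (enc f a', c') (enc f a, c) = U f (a', c') (a, c)) \<and>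
        (\<forall>e. (\<forall>a'\<in>Af' f. \<forall>c'\<in>Cf' f. e \<noteq> (enc f a', c')) \<longrightarrow> V e (enc f a, c) = 0))"

lemma mixed_op_exists:
  assumes A: "reg_embeds Af A" and C: "msg_embeds Cf C" and A': "reg_embeds Af' A'" and C': "msg_embeds Cf' C'" "0 \<in> C'"
    and U: "\<And>f. f < 2 \<Longrightarrow> isometry (Af f \<times> Cf f) (Af' f \<times> Cf' f) (U f)"
    and junk: "inj junk" "\<And>n. n < card (A \<times> C) \<Longrightarrow> junk n \<in> A'" "\<And>n f a. f < 2 \<Longrightarrow> junk n \<noteq> enc f a"
  shows "\<exists>V. isometry (A \<times> C) (A' \<times> C') V \<and> op_mixes Af Cf Af' Cf' U V"
proof -
  let ?e = "\<lambda>f (a, c). (enc f a, c::nat)"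
  have fin: "finite (A \<times> C)" using A C by (simp add: reg_embeds_def msg_embeds_def)
  \<comment> \<open>Enumerating the finite domain gives each basis vector its own junk label; the
    message register only has to contain 0.\<close>
  let ?jk = "\<lambda>d. (junk (to_nat_on (A \<times> C) d), 0::nat)"
  have bij: "bij_betw (to_nat_on (A \<times> C)) (A \<times> C) {..<card (A \<times> C)}"
    by (rule to_nat_on_finite[OF fin])
  have inj: "f = g \<and> x = y" if "f < 2" "g < 2" "?e f x = ?e g y" for f g and x y :: "('a, 'b) label \<times> nat"
    using that by (auto simp: enc_eq_iff split: prod.splits)
  have "\<exists>V. isometry (A \<times> C) (A' \<times> C') V \<and> (\<forall>f\<in>{..<2}. \<forall>x\<in>Af f \<times> Cf f. (\<forall>y\<in>Af' f \<times> Cf' f. V (?e f y) (?e f x) = U f y x) \<and>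
    (\<forall>e. e \<notin> ?e f ` (Af' f \<times> Cf' f) \<longrightarrow> V e (?e f x) = 0))"
  proof (rule extend_isometries[where jk = ?jk])
    show "finite (A' \<times> C')" using A' C' by (simp add: reg_embeds_def msg_embeds_def)
    show "?e f y \<in> A' \<times> C'" if "f \<in> {..<2}" "y \<in> Af' f \<times> Cf' f" for f y
      using that A' C' by (auto simp: reg_embeds_def msg_embeds_def image_subset_iff)
    show "f = g \<and> x = y" if "f \<in> {..<2}" "g \<in> {..<2}" "?e f x = ?e g y" for f g and x y :: "('a, 'b) label \<times> nat"
      using inj that by blast
    show "f = g \<and> x = y" if "f \<in> {..<2}" "g \<in> {..<2}" "?e f x = ?e g y" for f g and x y :: "('a, 'b) label \<times> nat"
      using inj that by blast
    show "isometry (Af f \<times> Cf f) (Af' f \<times> Cf' f) (U f)" if "f \<in> {..<2}" for f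
      using U that by simp
    show "inj_on ?jk (A \<times> C)"
    proof (rule inj_onI)
      fix d d' assume d: "d \<in> A \<times> C" "d' \<in> A \<times> C" "?jk d = ?jk d'"
      hence "to_nat_on (A \<times> C) d = to_nat_on (A \<times> C) d'" using injD[OF junk(1)] by blast
      thus "d = d'" using inj_onD[OF bij_betw_imp_inj_on[OF bij]] d by blast
    qed
    show "?jk d \<in> A' \<times> C'" if "d \<in> A \<times> C" for d
      using bij_betwE[OF bij] that junk(2) C'(2) by blast
    show "?jk d \<notin> ?e f ` (Af' f \<times> Cf' f)" if "f \<in> {..<2}" for d f
      using that junk(3) by auto
  qed
  then obtain V where V0: "isometry (A \<times> C) (A' \<times> C') V \<and> (\<forall>f\<in>{..<2}. \<forall>x\<in>Af f \<times> Cf f. (\<forall>y\<in>Af' f \<times> Cf' f. V (?e f y) (?e f x) = U f y x) \<and>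
    (\<forall>e. e \<notin> ?e f ` (Af' f \<times> Cf' f) \<longrightarrow> V e (?e f x) = 0))" ..
  note V1 = V0[THEN conjunct1] and V' = V0[THEN conjunct2]
  have V2: "V (?e f y) (?e f x) = U f y x" if "f < 2" "x \<in> Af f \<times> Cf f" "y \<in> Af' f \<times> Cf' f" for f x y
    using bspec[OF bspec[OF V', of f], of x] that by blast
  have V3: "V e (?e f x) = 0" if "f < 2" "x \<in> Af f \<times> Cf f" "e \<notin> ?e f ` (Af' f \<times> Cf' f)" for f x e
    using bspec[OF bspec[OF V', of f], of x] that by blast
  have "op_mixes Af Cf Af' Cf' U V"
    unfolding op_mixes_def
  proof (intro allI impI ballI conjI)
    fix f a c a' c' assume "f < (2::nat)" "a \<in> Af f" "c \<in> Cf f" "a' \<in> Af' f" "c' \<in> Cf' f"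
    thus "V (enc f a', c') (enc f a, c) = U f (a', c') (a, c)"
      using V2[of f "(a, c)" "(a', c')"] by simp
  next
    fix f a c e assume h: "f < (2::nat)" "a \<in> Af f" "c \<in> Cf f" "\<forall>a'\<in>Af' f. \<forall>c'\<in>Cf' f. e \<noteq> (enc f a', c')"
    have "e \<notin> ?e f ` (Af' f \<times> Cf' f)" using h(4) by auto
    thus "V e (enc f a, c) = 0"
      using V3[of f "(a, c)" e] h by simp
  qed
  thus ?thesis using V1 by blast
qed

text \<open>Alice's isometry leaves Bob's label alone, and this label pins down the flag of every
  contributing label of Alice. Her sum over the old register therefore shrinks to one block, on
  which V acts as \<open>U f\<close>.\<close>

lemma mixed_act_alice:
  assumes A: "reg_embeds Af A" and B: "reg_embeds Bf B" and C: "msg_embeds Cf C"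
    and V: "op_mixes Af Cf Af' Cf' U V" and m: "mixed p A B C Af Bf Cf \<psi> \<psi>f"
  shows "mixed p A' B C' Af' Bf Cf' (act_alice V A C (\<lambda>_. \<psi>) ()) (\<lambda>f. act_alice (U f) (Af f) (Cf f) (\<lambda>_. \<psi>f f) ())"
proof -
  have zero: "\<psi> a b c = 0" if "a \<in> A" "b \<in> B" "c \<in> C" "\<And>f. f < 2 \<Longrightarrow> a \<in> enc f ` Af f \<Longrightarrow> b \<in> enc f ` Bf f \<Longrightarrow> c \<notin> Cf f" for a b c
    using m that unfolding mixed_def by blast
  have val: "\<psi> (enc f a) (enc f b) c = of_real (sqrt (p f)) * \<psi>f f a b c" if "f < 2" "a \<in> Af f" "b \<in> Bf f" "c \<in> Cf f" for f a b c
    using m that unfolding mixed_def by blast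
  have Vval: "V (enc f a', c') (enc f a, c) = U f (a', c') (a, c)"
    if "f < 2" "a \<in> Af f" "c \<in> Cf f" "a' \<in> Af' f" "c' \<in> Cf' f" for f a c a' c'
    using V that unfolding op_mixes_def by blast
  have Vzero: "V (a', c') (enc f a, c) = 0"
    if "f < 2" "a \<in> Af f" "c \<in> Cf f" "a' \<in> enc f ` Af' f \<Longrightarrow> c' \<notin> Cf' f" for f a c a' c'
    using V that unfolding op_mixes_def by blast
  have main: "act_alice V A C (\<lambda>_. \<psi>) () a (enc f b) c =
      (\<Sum>a'\<in>Af f. \<Sum>c'\<in>Cf f. V (a, c) (enc f a', c') * (of_real (sqrt (p f)) * \<psi>f f a' b c'))"
    if f: "f < 2" and b: "b \<in> Bf f" for a f b c
  proof -
    have bB: "enc f b \<in> B" using B f b by (auto simp: reg_embeds_def image_subset_iff)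
    have "act_alice V A C (\<lambda>_. \<psi>) () a (enc f b) c = (\<Sum>d\<in>A \<times> C. V (a, c) d * \<psi> (fst d) (enc f b) (snd d))"
      by (simp add: act_alice_def sum.cartesian_product')
    also have "\<dots> = (\<Sum>g\<in>{f}. \<Sum>d\<in>Af g \<times> Cf g. V (a, c) (enc g (fst d), snd d) * \<psi> (fst (enc g (fst d), snd d)) (enc f b) (snd (enc g (fst d), snd d)))"
    proof (rule sum_embedded)
      show "finite (A \<times> C)"
        using A C by (simp add: reg_embeds_def msg_embeds_def)
      show "finite (Af g \<times> Cf g)" if "g \<in> {f}" for g
        using A C f that finite_subset[of "Cf f" C] by (simp add: reg_embeds_def msg_embeds_def)
      show "(enc g (fst d), snd d) \<in> A \<times> C" if "g \<in> {f}" "d \<in> Af g \<times> Cf g" for g d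
      proof -
        have "enc f (fst d) \<in> A" "Cf f \<subseteq> C" using A C f that by (auto simp: reg_embeds_def msg_embeds_def image_subset_iff)
        thus ?thesis using that by auto
      qed
      show "g = h \<and> d = d'" if "g \<in> {f}" "h \<in> {f}" "(enc g (fst d), snd d) = (enc h (fst d'), snd d')" for g h d d'
        using that f by (auto simp: enc_eq_iff prod_eq_iff)
      fix d assume d: "d \<in> A \<times> C" and nd: "\<And>g t. g \<in> {f} \<Longrightarrow> t \<in> Af g \<times> Cf g \<Longrightarrow> d \<noteq> (enc g (fst t), snd t)"
      have "\<psi> (fst d) (enc f b) (snd d) = 0"
      proof (rule zero)
        fix g assume g: "g < 2" "fst d \<in> enc g ` Af g" "enc f b \<in> enc g ` Bf g"
        have "g = f" using g f by (auto simp: enc_eq_iff)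
        moreover obtain x where "x \<in> Af g" "fst d = enc g x" using g(2) by blast
        ultimately show "snd d \<notin> Cf g" using nd[of f "(x, snd d)"] by (auto simp: prod_eq_iff)
      qed (use d bB in auto)
      thus "V (a, c) d * \<psi> (fst d) (enc f b) (snd d) = 0" by simp
    qed simp
    also have "\<dots> = (\<Sum>a'\<in>Af f. \<Sum>c'\<in>Cf f. V (a, c) (enc f a', c') * (of_real (sqrt (p f)) * \<psi>f f a' b c'))"
      using f b by (simp add: sum.cartesian_product' val)
    finally show ?thesis .
  qed
  show ?thesis
    unfolding mixed_def
  proof (intro conjI allI impI ballI)
    fix f a b c assume f: "f < (2::nat)" and h: "a \<in> Af' f" "b \<in> Bf f" "c \<in> Cf' f"
    have "act_alice V A C (\<lambda>_. \<psi>) () (enc f a) (enc f b) c =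
      (\<Sum>a'\<in>Af f. \<Sum>c'\<in>Cf f. U f (a, c) (a', c') * (of_real (sqrt (p f)) * \<psi>f f a' b c'))"
      unfolding main[OF f h(2)] using f h by (intro sum.cong refl) (simp add: Vval)
    thus "act_alice V A C (\<lambda>_. \<psi>) () (enc f a) (enc f b) c = of_real (sqrt (p f)) * act_alice (U f) (Af f) (Cf f) (\<lambda>_. \<psi>f f) () a b c"
      by (simp add: act_alice_def sum_distrib_left mult.left_commute)
  next
    fix a b c assume h: "b \<in> B" "\<forall>f<2. a \<in> enc f ` Af' f \<longrightarrow> b \<in> enc f ` Bf f \<longrightarrow> c \<notin> Cf' f"
    show "act_alice V A C (\<lambda>_. \<psi>) () a b c = 0"
    proof (cases "\<exists>f<2. b \<in> enc f ` Bf f")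
      case True
      then obtain f b0 where f: "f < 2" "b0 \<in> Bf f" "b = enc f b0" by blast
      have "V (a, c) (enc f a', c') = 0" if "a' \<in> Af f" "c' \<in> Cf f" for a' c'
        using h(2) f that by (intro Vzero) blast+
      thus ?thesis unfolding f(3) main[OF f(1,2)] by simp
    next
      \<comment> \<open>A label of Bob without a flag already has amplitude 0 before Alice
        acts.\<close>
      case False
      hence "\<psi> a' b c' = 0" if "a' \<in> A" "c' \<in> C" for a' c'
        using that h(1) by (intro zero) blast+
      thus ?thesis by (simp add: act_alice_def)
    qed
  qed
qed

lemma act_bob_eq_act_alice: "act_bob V B C (\<lambda>_. \<psi>) () = (\<lambda>a b. act_alice V B C (\<lambda>_ b a. \<psi> a b) () b a)"
  by (simp add: act_bob_def act_alice_def)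

lemma mixed_act_bob:
  assumes A: "reg_embeds Af A" and B: "reg_embeds Bf B" and C: "msg_embeds Cf C"
    and V: "op_mixes Bf Cf Bf' Cf' U V" and m: "mixed p A B C Af Bf Cf \<psi> \<psi>f"
  shows "mixed p A B' C' Af Bf' Cf' (act_bob V B C (\<lambda>_. \<psi>) ()) (\<lambda>f. act_bob (U f) (Bf f) (Cf f) (\<lambda>_. \<psi>f f) ())"
  using mixed_swap[OF mixed_act_alice[OF B A C V mixed_swap[OF m]]] by (simp only: act_bob_eq_act_alice)

section \<open>Registers and controlled isometries of a mixture of two protocols\<close>

locale protocol_mixture =
  fixes r :: nat and Ps :: "nat \<Rightarrow> ('x::finite, 'y::finite, 'za::finite, 'zb::finite) protocol" and p :: "nat \<Rightarrow> real"
  assumes Ps: "\<And>f. f < 2 \<Longrightarrow> is_protocol r (Ps f)"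
    and p: "\<And>f. f < 2 \<Longrightarrow> 0 \<le> p f" "(\<Sum>f<2. p f) = 1"
begin

definition dA :: nat where "dA = 3 * (\<Sum>f<2. dim_TA (Ps f))"
definition dB :: nat where "dB = 3 * (\<Sum>f<2. dim_TB (Ps f))"
text \<open>The sum dominates the dimensions of both protocols; the extra 1 guarantees that message
  0 exists, where junk vectors are sent.\<close>

definition msg_bound :: "nat \<Rightarrow> nat" where "msg_bound i = 1 + (\<Sum>f<2. msg_dim (Ps f) i)"
text \<open>Bounds, for either player, how many labels of a register share an index: one per input
  value, or one per output value and one for \<open>Mem\<close>.\<close>

definition labels :: nat where "labels = 1 + CARD('x) + CARD('y) + CARD('za) + CARD('zb)"

text \<open>
  Large enough for the indices of residue 2 in the register created by isometry i to absorb the whole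
  domain of that isometry.
\<close>

primrec mem :: "nat \<Rightarrow> nat" where
  "mem 0 = labels * (dA + dB) + (\<Sum>f<2. mem_dim (Ps f) 0)"
| "mem (Suc i) = 3 * labels * mem i * msg_bound i + (\<Sum>f<2. mem_dim (Ps f) (Suc i))"

text \<open>Superposition of the two shared states with amplitudes \<open>sqrt (p f)\<close>,
  perfectly correlated in the flag, which both halves store as residue modulo 3.\<close>

definition mixed_shared :: "nat \<Rightarrow> nat \<Rightarrow> complex" where
  "mixed_shared t s = (if \<exists>f t' s'. f < 2 \<and> t' < dim_TA (Ps f) \<and> s' < dim_TB (Ps f) \<and> t = 3 * t' + f \<and> s = 3 * s' + f
     then of_real (sqrt (p (t mod 3))) * shared (Ps (t mod 3)) (t div 3) (s div 3) else 0)"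

text \<open>Registers depend only on the number of rounds and the dimensions. Fixing these first,
  with dummy operators, allows the isometries to be chosen afterwards between known
  registers.\<close>

definition frame :: "('x, 'y, 'za, 'zb) protocol" where
  "frame = \<lparr>rounds = r, dim_TA = dA, dim_TB = dB, shared = mixed_shared, mem_dim = (\<lambda>i. 3 * mem i), msg_dim = msg_bound,
     alice_op = (\<lambda>_ _ _. 0), bob_op = (\<lambda>_ _ _. 0)\<rparr>"

lemma rounds_Ps: "f < 2 \<Longrightarrow> rounds (Ps f) = r"
  using Ps by (auto simp: is_protocol_def)

lemma le_sum_two: "f < 2 \<Longrightarrow> g f \<le> (\<Sum>f<2. g f)" for g :: "nat \<Rightarrow> nat"
  by (rule member_le_sum) auto

lemma mem_dim_le: "f < 2 \<Longrightarrow> mem_dim (Ps f) i \<le> mem i"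
  using le_sum_two[of f "\<lambda>f. mem_dim (Ps f) i"] by (cases i) auto

lemma frame_simps [simp]:
  "rounds frame = r" "dim_TA frame = dA" "dim_TB frame = dB" "shared frame = mixed_shared"
  "mem_dim frame i = 3 * mem i" "msg_dim frame i = msg_bound i"
  by (simp_all add: frame_def)

lemma msg_embeds_frame: "msg_embeds (\<lambda>f. msg_reg (Ps f) i) (msg_reg frame i)"
  using le_sum_two[of _ "\<lambda>f. msg_dim (Ps f) i"]
  by (fastforce simp: msg_embeds_def msg_reg_def rounds_Ps msg_bound_def)

lemma zero_in_msg_reg: "0 \<in> msg_reg frame i"
  by (simp add: msg_reg_def msg_bound_def)

lemma input_embeds:
  assumes "\<And>f. f < 2 \<Longrightarrow> 3 * d f \<le> D"
  shows "reg_embeds (\<lambda>f. input_reg (d f)) (input_reg D :: ('i::finite, 'o) label set)"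
proof -
  have "enc f ` input_reg (d f) \<subseteq> (input_reg D :: ('i, 'o) label set)" if "f < 2" for f
  proof
    fix l :: "('i, 'o) label" assume "l \<in> enc f ` input_reg (d f)"
    then obtain x t where "t < d f" "l = Inp x (3 * t + f)" by (auto simp: input_reg_def)
    moreover have "3 * t + f < D" using assms[OF that] that \<open>t < d f\<close> by linarith
    ultimately show "l \<in> input_reg D" by (auto simp: input_reg_def)
  qed
  thus ?thesis by (simp add: reg_embeds_def)
qed

lemma new_embeds: "reg_embeds (\<lambda>f. new_reg (Ps f) i) (new_reg frame i :: ('i, 'o::finite) label set)"
proof -
  have "enc f ` new_reg (Ps f) i \<subseteq> (new_reg frame i :: ('i, 'o) label set)" if f: "f < 2" for f
  proof
    fix l :: "('i, 'o) label" assume l: "l \<in> enc f ` new_reg (Ps f) i"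
    have lt: "3 * k + f < 3 * mem i" if "k < mem_dim (Ps f) i" for k
      using mem_dim_le[OF f, of i] that f by linarith
    show "l \<in> new_reg frame i"
      using l lt by (auto simp: new_reg_def rounds_Ps[OF f] split: if_splits)
  qed
  thus ?thesis by (simp add: reg_embeds_def)
qed

lemma alice_embeds: "reg_embeds (\<lambda>f. alice_reg (Ps f) i) (alice_reg frame i)"
proof (induction i)
  case 0
  show ?case using le_sum_two[of _ "\<lambda>f. dim_TA (Ps f)"] by (simp add: input_embeds dA_def)
next
  case (Suc i)
  thus ?case by (simp add: new_embeds)
qed

lemma input_B_embeds: "reg_embeds (\<lambda>f. input_reg (dim_TB (Ps f))) (input_reg dB :: ('y, 'zb) label set)"
  using le_sum_two[of _ "\<lambda>f. dim_TB (Ps f)"] by (simp add: input_embeds dB_def)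

lemma reg_embeds_cong: "(\<And>f. f < 2 \<Longrightarrow> Af f = Bf f) \<Longrightarrow> reg_embeds Af A = reg_embeds Bf A"
  by (auto simp: reg_embeds_def)

lemma bob_reg_0: "bob_reg frame 0 = (if r = 0 then new_reg frame 0 else input_reg dB)"
  by simp

lemma bob_embeds: "reg_embeds (\<lambda>f. bob_reg (Ps f) i) (bob_reg frame i)"
proof (induction i)
  case 0
  have "bob_reg (Ps f) 0 = (if r = 0 then new_reg (Ps f) 0 else input_reg (dim_TB (Ps f)))" if "f < 2" for f
    using rounds_Ps[OF that] by simp
  hence "reg_embeds (\<lambda>f. bob_reg (Ps f) 0) (bob_reg frame 0) =
    reg_embeds (\<lambda>f. if r = 0 then new_reg (Ps f) 0 else input_reg (dim_TB (Ps f))) (bob_reg frame 0)"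
    by (rule reg_embeds_cong)
  also have "\<dots>"
  proof (cases "r = 0")
    case True
    show ?thesis unfolding bob_reg_0 if_P[OF True] by (rule new_embeds)
  next
    case False
    show ?thesis unfolding bob_reg_0 if_not_P[OF False] by (rule input_B_embeds)
  qed
  finally show ?case .
next
  case (Suc i)
  thus ?case by (simp add: new_embeds)
qed

lemma card_input_reg: "card (input_reg d :: ('i::finite, 'o) label set) \<le> CARD('i) * d"
proof -
  have "(input_reg d :: ('i, 'o) label set) = (\<lambda>(x, t). Inp x t) ` (UNIV \<times> {..<d})"
    by (auto simp: input_reg_def)
  hence "card (input_reg d :: ('i, 'o) label set) \<le> card ((UNIV :: 'i set) \<times> {..<d})"
    by (simp only:) (intro card_image_le, simp)
  thus ?thesis by simp
qed

lemma card_new_reg: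
  assumes "1 + CARD('o) \<le> labels"
  shows "card (new_reg frame i :: ('i, 'o::finite) label set) \<le> 3 * labels * mem i"
proof -
  have "(new_reg frame i :: ('i, 'o) label set) \<subseteq> (\<lambda>(x, t). Out x t) ` (UNIV \<times> {..<3 * mem i}) \<union> Mem ` {..<3 * mem i}"
    by (auto simp: new_reg_def)
  hence "card (new_reg frame i :: ('i, 'o) label set) \<le>
      card ((\<lambda>(x, t). Out x t) ` ((UNIV :: 'o set) \<times> {..<3 * mem i}) \<union> (Mem ` {..<3 * mem i} :: ('i, 'o) label set))"
    by (intro card_mono) auto
  also have "\<dots> \<le> card ((\<lambda>(x, t). Out x t :: ('i, 'o) label) ` ((UNIV :: 'o set) \<times> {..<3 * mem i})) + card (Mem ` {..<3 * mem i} :: ('i, 'o) label set)"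
    by (rule card_Un_le)
  also have "\<dots> \<le> card ((UNIV :: 'o set) \<times> {..<3 * mem i}) + card {..<3 * mem i}"
    by (intro add_mono card_image_le) auto
  also have "\<dots> = (1 + CARD('o)) * (3 * mem i)" by simp
  also have "\<dots> \<le> labels * (3 * mem i)" by (intro mult_le_mono assms order_refl)
  finally show ?thesis by (simp only: mult.commute mult.left_commute)
qed

lemma card_input_reg_le:
  assumes "CARD('i) \<le> labels" "d \<le> dA + dB"
  shows "card (input_reg d :: ('i::finite, 'o) label set) \<le> mem 0"
proof -
  have "card (input_reg d :: ('i, 'o) label set) \<le> CARD('i) * d" by (rule card_input_reg)
  also have "\<dots> \<le> labels * (dA + dB)" by (intro mult_le_mono assms)
  finally show ?thesis by simp
qed

text \<open>A player's register stays the same during the other player's round, so its size bound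
  has to remain valid when i grows.\<close>

lemma mem_mono: "mem i \<le> mem (Suc i)"
proof -
  have "1 * mem i * 1 \<le> (3 * labels) * mem i * msg_bound i"
    by (intro mult_le_mono) (auto simp: labels_def msg_bound_def)
  hence "mem i \<le> 3 * labels * mem i * msg_bound i" by (simp only: mult_1_left mult_1_right)
  thus ?thesis unfolding mem.simps by (rule trans_le_add1)
qed

lemma mem_le: "mem i \<le> 3 * labels * mem i"
  by (simp add: labels_def)

lemma card_mono_step: "card A \<le> 3 * labels * mem i \<Longrightarrow> card A \<le> 3 * labels * mem (Suc i)"
  using mem_mono[of i] by (meson le_trans mult_le_mono2)

lemma card_alice_reg: "card (alice_reg frame i) \<le> 3 * labels * mem i"
proof (induction i)
  case 0
  have "card (alice_reg frame 0) \<le> mem 0"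
    unfolding alice_reg.simps frame_simps by (rule card_input_reg_le) (auto simp: labels_def)
  thus ?case using mem_le by (rule le_trans)
next
  case (Suc i)
  have "card (new_reg frame (Suc i) :: ('x, 'za) label set) \<le> 3 * labels * mem (Suc i)"
    by (rule card_new_reg) (simp add: labels_def)
  thus ?case using card_mono_step[OF Suc.IH] by simp
qed

lemma card_bob_reg: "card (bob_reg frame i) \<le> 3 * labels * mem i"
proof (induction i)
  case 0
  have "card (input_reg dB :: ('y, 'zb) label set) \<le> 3 * labels * mem 0"
    by (rule le_trans[OF card_input_reg_le mem_le]) (auto simp: labels_def)
  moreover have "card (new_reg frame 0 :: ('y, 'zb) label set) \<le> 3 * labels * mem 0"
    by (rule card_new_reg) (simp add: labels_def)
  ultimately show ?case unfolding bob_reg_0 by (rule if_split[THEN iffD2, OF conjI, OF impI impI, rotated])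
next
  case (Suc i)
  have "card (new_reg frame (Suc i) :: ('y, 'zb) label set) \<le> 3 * labels * mem (Suc i)"
    by (rule card_new_reg) (simp add: labels_def)
  thus ?case using card_mono_step[OF Suc.IH] by simp
qed

lemma card_msg_reg: "card (msg_reg frame i) \<le> msg_bound i"
  by (simp add: msg_reg_def msg_bound_def)

lemma card_domain_le:
  assumes "card A \<le> 3 * labels * mem i"
  shows "card (A \<times> msg_reg frame i) \<le> mem (Suc i)"
proof -
  have "card (A \<times> msg_reg frame i) \<le> (3 * labels * mem i) * msg_bound i"
    unfolding card_cartesian_product by (intro mult_le_mono assms card_msg_reg)
  thus ?thesis by simp
qed

lemma new_op_exists:
  fixes Af :: "nat \<Rightarrow> ('i, 'o::finite) label set"
  assumes A: "reg_embeds Af A" and C: "msg_embeds Cf C" and C': "msg_embeds Cf' C'" "0 \<in> C'" and card: "card (A \<times> C) \<le> mem i"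
    and U: "\<And>f. f < 2 \<Longrightarrow> isometry (Af f \<times> Cf f) (new_reg (Ps f) i \<times> Cf' f) (U f)"
  shows "\<exists>V. isometry (A \<times> C) (new_reg frame i \<times> C') V \<and> op_mixes Af Cf (\<lambda>f. new_reg (Ps f) i) Cf' U V"
proof (rule mixed_op_exists[OF A C new_embeds C' U])
  \<comment> \<open>Residue 2 is never produced by \<open>enc f\<close> with f < 2. For n <
    \<open>mem i\<close> the index 3 n + 2 lies below 3 \<open>mem i\<close>, the dimension of the
    new register; the output value attached to it is arbitrary.\<close>
  let ?junk = "\<lambda>n. if r \<le> i then Out undefined (3 * n + 2) else Mem (3 * n + 2) :: ('i, 'o) label"
  show "inj ?junk" by (auto simp: inj_def)
  show "?junk n \<in> new_reg frame i" if "n < card (A \<times> C)" for n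
    using that card by (auto simp: new_reg_def)
  show "?junk n \<noteq> enc f a" if "f < 2" for n f a
    using that three_mult_add_eq_iff[of 2 f] by (cases a) auto
qed

lemma isometry_alice: "f < 2 \<Longrightarrow> i \<in> {1..r + 1} \<Longrightarrow> odd i \<Longrightarrow>
    isometry (alice_reg (Ps f) (i - 1) \<times> msg_reg (Ps f) (i - 1)) (alice_reg (Ps f) i \<times> msg_reg (Ps f) i) (alice_op (Ps f) i)"
  using Ps[of f] unfolding is_protocol_def by blast

lemma isometry_bob: "f < 2 \<Longrightarrow> i \<in> {1..r + 1} \<Longrightarrow> even i \<Longrightarrow>
    isometry (bob_reg (Ps f) (i - 1) \<times> msg_reg (Ps f) (i - 1)) (bob_reg (Ps f) i \<times> msg_reg (Ps f) i) (bob_op (Ps f) i)"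
  using Ps[of f] unfolding is_protocol_def by blast

lemma isometry_bob_0: "f < 2 \<Longrightarrow> r = 0 \<Longrightarrow>
    isometry (input_reg (dim_TB (Ps f)) \<times> {0}) (bob_reg (Ps f) 0 \<times> {0}) (bob_op (Ps f) 0)"
  using Ps[of f] unfolding is_protocol_def by blast

text \<open>Chooses all isometries of one player at once; Q is the parity of that player's
  rounds.\<close>

lemma new_ops_exist:
  fixes A :: "nat \<Rightarrow> ('i, 'o::finite) label set"
  assumes A: "\<And>i. reg_embeds (\<lambda>f. Af f i) (A i)" and card: "\<And>i. card (A i) \<le> 3 * labels * mem i"
    and U: "\<And>i f. f < 2 \<Longrightarrow> Suc i \<in> {1..r + 1} \<Longrightarrow> Q (Suc i) \<Longrightarrow>
      isometry (Af f i \<times> msg_reg (Ps f) i) (new_reg (Ps f) (Suc i) \<times> msg_reg (Ps f) (Suc i)) (U f (Suc i))"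
  shows "\<exists>V. \<forall>i. Suc i \<in> {1..r + 1} \<longrightarrow> Q (Suc i) \<longrightarrow>
      isometry (A i \<times> msg_reg frame i) (new_reg frame (Suc i) \<times> msg_reg frame (Suc i)) (V (Suc i)) \<and>
      op_mixes (\<lambda>f. Af f i) (\<lambda>f. msg_reg (Ps f) i) (\<lambda>f. new_reg (Ps f) (Suc i)) (\<lambda>f. msg_reg (Ps f) (Suc i))
        (\<lambda>f. U f (Suc i)) (V (Suc i))"
proof -
  let ?S = "\<lambda>i V. isometry (A i \<times> msg_reg frame i) (new_reg frame (Suc i) \<times> msg_reg frame (Suc i)) V \<and>
      op_mixes (\<lambda>f. Af f i) (\<lambda>f. msg_reg (Ps f) i) (\<lambda>f. new_reg (Ps f) (Suc i)) (\<lambda>f. msg_reg (Ps f) (Suc i))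
        (\<lambda>f. U f (Suc i)) V"
  have "\<exists>V. ?S i V" if "Suc i \<in> {1..r + 1}" "Q (Suc i)" for i
    by (rule new_op_exists[OF A msg_embeds_frame msg_embeds_frame zero_in_msg_reg card_domain_le[OF card]]) (rule U[OF _ that])
  hence "\<forall>i. \<exists>V. Suc i \<in> {1..r + 1} \<longrightarrow> Q (Suc i) \<longrightarrow> ?S i V" by blast
  from choice[OF this] obtain W where W: "\<forall>i. Suc i \<in> {1..r + 1} \<longrightarrow> Q (Suc i) \<longrightarrow> ?S i (W i)" ..
  show ?thesis by (rule exI[of _ "\<lambda>j. W (j - 1)"]) (use W in \<open>simp only: diff_Suc_1\<close>)
qed

lemma bob_op_0_exists:
  assumes "r = 0"
  shows "\<exists>V. isometry (input_reg dB \<times> {0}) (bob_reg frame 0 \<times> {0}) V \<and>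
     op_mixes (\<lambda>f. input_reg (dim_TB (Ps f))) (\<lambda>f. {0}) (\<lambda>f. new_reg (Ps f) 0) (\<lambda>f. {0}) (\<lambda>f. bob_op (Ps f) 0) V"
proof -
  have c: "card ((input_reg dB :: ('y, 'zb) label set) \<times> {0::nat}) \<le> mem 0"
    unfolding card_cartesian_product card_1_singleton_iff
    by (simp del: mem.simps) (rule card_input_reg_le, auto simp: labels_def)
  have m: "msg_embeds (\<lambda>_. {0}) {0}" by (simp add: msg_embeds_def)
  have "\<exists>V. isometry (input_reg dB \<times> {0}) (new_reg frame 0 \<times> {0}) V \<and>
     op_mixes (\<lambda>f. input_reg (dim_TB (Ps f))) (\<lambda>f. {0}) (\<lambda>f. new_reg (Ps f) 0) (\<lambda>f. {0}) (\<lambda>f. bob_op (Ps f) 0) V"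
  proof (rule new_op_exists[OF input_B_embeds m m _ c])
    show "isometry (input_reg (dim_TB (Ps f)) \<times> {0}) (new_reg (Ps f) 0 \<times> {0}) (bob_op (Ps f) 0)" if "f < 2" for f
      using isometry_bob_0[OF that assms] rounds_Ps[OF that] assms by simp
  qed simp
  thus ?thesis unfolding bob_reg_0 if_P[OF assms] .
qed

lemma mixed_shared_enc:
  assumes "f < 2" "t < dim_TA (Ps f)" "s < dim_TB (Ps f)"
  shows "mixed_shared (3 * t + f) (3 * s + f) = of_real (sqrt (p f)) * shared (Ps f) t s"
proof -
  have "(3 * t + f) mod 3 = f" "(3 * t + f) div 3 = t" "(3 * s + f) div 3 = s" using assms(1) by auto
  thus ?thesis using assms unfolding mixed_shared_def by auto
qed

lemma mixed_shared_norm: "(\<Sum>t<dA. \<Sum>s<dB. (cmod (mixed_shared t s))\<^sup>2) = 1"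
proof -
  have "(\<Sum>t<dA. \<Sum>s<dB. (cmod (mixed_shared t s))\<^sup>2) = (\<Sum>u\<in>{..<dA} \<times> {..<dB}. (cmod (mixed_shared (fst u) (snd u)))\<^sup>2)"
    by (simp add: sum.cartesian_product')
  also have "\<dots> = (\<Sum>f<2. \<Sum>u\<in>{..<dim_TA (Ps f)} \<times> {..<dim_TB (Ps f)}.
      (cmod (mixed_shared (fst (3 * fst u + f, 3 * snd u + f)) (snd (3 * fst u + f, 3 * snd u + f))))\<^sup>2)"
  proof (rule sum_embedded)
    fix f :: nat and u assume f: "f \<in> {..<2}" and u: "u \<in> {..<dim_TA (Ps f)} \<times> {..<dim_TB (Ps f)}"
    have "dim_TA (Ps f) \<le> (\<Sum>f<2. dim_TA (Ps f))" "dim_TB (Ps f) \<le> (\<Sum>f<2. dim_TB (Ps f))"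
      using f le_sum_two[of f "\<lambda>f. dim_TA (Ps f)"] le_sum_two[of f "\<lambda>f. dim_TB (Ps f)"] by auto
    moreover have "fst u < dim_TA (Ps f)" "snd u < dim_TB (Ps f)" "f < 2" using f u by auto
    ultimately have "3 * fst u + f < dA" "3 * snd u + f < dB" unfolding dA_def dB_def by linarith+
    thus "(3 * fst u + f, 3 * snd u + f) \<in> {..<dA} \<times> {..<dB}" by simp
  next
    fix f g :: nat and u v :: "nat \<times> nat" assume "f \<in> {..<2}" "g \<in> {..<2}" "(3 * fst u + f, 3 * snd u + f) = (3 * fst v + g, 3 * snd v + g)"
    thus "f = g \<and> u = v" by (auto simp: three_mult_add_eq_iff prod_eq_iff)
  next
    fix u assume nu: "\<And>f t. f \<in> {..<2} \<Longrightarrow> t \<in> {..<dim_TA (Ps f)} \<times> {..<dim_TB (Ps f)} \<Longrightarrow> u \<noteq> (3 * fst t + f, 3 * snd t + f)"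
    have "mixed_shared (fst u) (snd u) = 0"
    proof (rule ccontr)
      assume "mixed_shared (fst u) (snd u) \<noteq> 0"
      then obtain f t s where "f < 2" "t < dim_TA (Ps f)" "s < dim_TB (Ps f)" "fst u = 3 * t + f" "snd u = 3 * s + f"
        unfolding mixed_shared_def by (auto split: if_splits)
      thus False using nu[of f "(t, s)"] by (simp add: prod_eq_iff)
    qed
    thus "(cmod (mixed_shared (fst u) (snd u)))\<^sup>2 = 0" by simp
  qed auto
  also have "\<dots> = (\<Sum>f<2. p f)"
  proof (intro sum.cong refl)
    fix f :: nat assume f: "f \<in> {..<2}"
    have "(\<Sum>u\<in>{..<dim_TA (Ps f)} \<times> {..<dim_TB (Ps f)}.
        (cmod (mixed_shared (fst (3 * fst u + f, 3 * snd u + f)) (snd (3 * fst u + f, 3 * snd u + f))))\<^sup>2) =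
      (\<Sum>t<dim_TA (Ps f). \<Sum>s<dim_TB (Ps f). p f * (cmod (shared (Ps f) t s))\<^sup>2)"
      unfolding sum.cartesian_product' using f p(1)[of f]
      by (intro sum.cong refl) (simp add: mixed_shared_enc norm_mult power_mult_distrib)
    also have "\<dots> = p f * (\<Sum>t<dim_TA (Ps f). \<Sum>s<dim_TB (Ps f). (cmod (shared (Ps f) t s))\<^sup>2)"
      by (simp add: sum_distrib_left)
    also have "\<dots> = p f" using Ps[of f] f by (simp add: is_protocol_def)
    finally show "(\<Sum>u\<in>{..<dim_TA (Ps f)} \<times> {..<dim_TB (Ps f)}.
        (cmod (mixed_shared (fst (3 * fst u + f, 3 * snd u + f)) (snd (3 * fst u + f, 3 * snd u + f))))\<^sup>2) = p f" .
  qed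
  finally show ?thesis using p(2) by simp
qed

end

lemma new_reg_update [simp]: "new_reg (P\<lparr>alice_op := u, bob_op := v\<rparr>) i = new_reg P i"
  by (simp add: new_reg_def)

lemma msg_reg_update [simp]: "msg_reg (P\<lparr>alice_op := u, bob_op := v\<rparr>) i = msg_reg P i"
  by (simp add: msg_reg_def)

lemma alice_reg_update [simp]: "alice_reg (P\<lparr>alice_op := u, bob_op := v\<rparr>) i = alice_reg P i"
  by (induction i) simp_all

lemma bob_reg_update [simp]: "bob_reg (P\<lparr>alice_op := u, bob_op := v\<rparr>) i = bob_reg P i"
  by (induction i) simp_all

section \<open>Execution, error and cost of the mixture\<close>

context protocol_mixture
begin

lemma mixed_start:
  assumes "shared R = mixed_shared"
  shows "mixed p (input_reg dA) (input_reg dB) {0} (\<lambda>f. input_reg (dim_TA (Ps f))) (\<lambda>f. input_reg (dim_TB (Ps f))) (\<lambda>f. {0})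
    (start_state R \<phi> ()) (\<lambda>f. start_state (Ps f) \<phi> ())"
  unfolding mixed_def
proof (intro conjI allI impI ballI)
  fix f and a :: "('x, 'za) label" and b :: "('y, 'zb) label" and c
  assume f: "f < (2::nat)" and "a \<in> input_reg (dim_TA (Ps f))" "b \<in> input_reg (dim_TB (Ps f))" "c \<in> {0::nat}"
  then obtain x t y s where "a = Inp x t" "t < dim_TA (Ps f)" "b = Inp y s" "s < dim_TB (Ps f)" "c = 0"
    by (auto simp: input_reg_def)
  thus "start_state R \<phi> () (enc f a) (enc f b) c = of_real (sqrt (p f)) * start_state (Ps f) \<phi> () a b c"
    using f by (simp add: start_state_def assms mixed_shared_enc)
next
  fix a :: "('x, 'za) label" and b :: "('y, 'zb) label" and c assume ab: "a \<in> input_reg dA" "b \<in> input_reg dB" and c: "c \<in> {0::nat}"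
    and h: "\<forall>f<2. a \<in> enc f ` input_reg (dim_TA (Ps f)) \<longrightarrow> b \<in> enc f ` input_reg (dim_TB (Ps f)) \<longrightarrow> c \<notin> {0}"
  obtain x t y s where xy: "a = Inp x t" "b = Inp y s" using ab by (auto simp: input_reg_def)
  have "mixed_shared t s = 0"
  proof (rule ccontr)
    assume "mixed_shared t s \<noteq> 0"
    then obtain f t' s' where f: "f < 2" "t' < dim_TA (Ps f)" "s' < dim_TB (Ps f)" "t = 3 * t' + f" "s = 3 * s' + f"
      unfolding mixed_shared_def by (auto split: if_splits)
    have "a = enc f (Inp x t')" "b = enc f (Inp y s')" using xy f by simp_all
    moreover have "Inp x t' \<in> input_reg (dim_TA (Ps f))" "Inp y s' \<in> input_reg (dim_TB (Ps f))"
      using f by (auto simp: input_reg_def)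
    ultimately show False using h f(1) c by blast
  qed
  thus "start_state R \<phi> () a b c = 0" by (simp add: start_state_def assms xy)
qed

lemma mixed_cong:
  assumes "\<And>f. f < 2 \<Longrightarrow> Af f = Af' f" "\<And>f. f < 2 \<Longrightarrow> Bf f = Bf' f" "\<And>f. f < 2 \<Longrightarrow> Cf f = Cf' f" "\<And>f. f < 2 \<Longrightarrow> \<psi>f f = \<psi>f' f"
    and "mixed p A B C Af' Bf' Cf' \<psi> \<psi>f'"
  shows "mixed p A B C Af Bf Cf \<psi> \<psi>f"
  using assms(5) unfolding mixed_def by (simp add: assms(1-4))

text \<open>Controlled isometries preserve the superposition of flagged runs round by round. Output
  probabilities and the information of each round are then averages with weights \<open>p f\<close>,
  and errors and costs inherit this.\<close>

lemma mixture_exists: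
  "\<exists>R. is_protocol r R \<and> (\<forall>x y. error_prob T R x y = (\<Sum>f<2. p f * error_prob T (Ps f) x y)) \<and>
     (\<forall>w. (\<forall>q. 0 \<le> w q) \<longrightarrow> info_cost R w = (\<Sum>f<2. p f * info_cost (Ps f) w))"
proof -
  have IA: "isometry (alice_reg (Ps f) i \<times> msg_reg (Ps f) i) (new_reg (Ps f) (Suc i) \<times> msg_reg (Ps f) (Suc i)) (alice_op (Ps f) (Suc i))"
    if "f < 2" "Suc i \<in> {1..r + 1}" "odd (Suc i)" for f i
    using isometry_alice[OF that] that(3) by simp
  obtain VA where VA: "\<And>i. Suc i \<in> {1..r + 1} \<Longrightarrow> odd (Suc i) \<Longrightarrow>
     isometry (alice_reg frame i \<times> msg_reg frame i) (new_reg frame (Suc i) \<times> msg_reg frame (Suc i)) (VA (Suc i)) \<and>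
     op_mixes (\<lambda>f. alice_reg (Ps f) i) (\<lambda>f. msg_reg (Ps f) i) (\<lambda>f. new_reg (Ps f) (Suc i)) (\<lambda>f. msg_reg (Ps f) (Suc i))
       (\<lambda>f. alice_op (Ps f) (Suc i)) (VA (Suc i))"
    using new_ops_exist[where Q = odd, OF alice_embeds card_alice_reg IA] by blast
  have IB: "isometry (bob_reg (Ps f) i \<times> msg_reg (Ps f) i) (new_reg (Ps f) (Suc i) \<times> msg_reg (Ps f) (Suc i)) (bob_op (Ps f) (Suc i))"
    if "f < 2" "Suc i \<in> {1..r + 1}" "even (Suc i)" for f i
    using isometry_bob[OF that] that(3) by simp
  obtain VB where VB: "\<And>i. Suc i \<in> {1..r + 1} \<Longrightarrow> even (Suc i) \<Longrightarrow>
     isometry (bob_reg frame i \<times> msg_reg frame i) (new_reg frame (Suc i) \<times> msg_reg frame (Suc i)) (VB (Suc i)) \<and>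
     op_mixes (\<lambda>f. bob_reg (Ps f) i) (\<lambda>f. msg_reg (Ps f) i) (\<lambda>f. new_reg (Ps f) (Suc i)) (\<lambda>f. msg_reg (Ps f) (Suc i))
       (\<lambda>f. bob_op (Ps f) (Suc i)) (VB (Suc i))"
    using new_ops_exist[where Q = even, OF bob_embeds card_bob_reg IB] by blast
  obtain V0 where V0: "r = 0 \<Longrightarrow> isometry (input_reg dB \<times> {0}) (bob_reg frame 0 \<times> {0}) V0 \<and>
     op_mixes (\<lambda>f. input_reg (dim_TB (Ps f))) (\<lambda>f. {0}) (\<lambda>f. new_reg (Ps f) 0) (\<lambda>f. {0}) (\<lambda>f. bob_op (Ps f) 0) V0"
    using bob_op_0_exists by blast
  \<comment> \<open>Index 0 holds the local isometry by which Bob produces his output when there are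
    no rounds.\<close>
  define W where "W i = (if i = 0 then V0 else VB i)" for i
  define R where "R = frame\<lparr>alice_op := VA, bob_op := W\<rparr>"
  have regs: "alice_reg R i = alice_reg frame i" "bob_reg R i = bob_reg frame i" "msg_reg R i = msg_reg frame i" for i
    unfolding R_def by (rule alice_reg_update bob_reg_update msg_reg_update)+
  have R: "rounds R = r" "dim_TA R = dA" "dim_TB R = dB" "shared R = mixed_shared" "alice_op R = VA" "bob_op R = W"
    by (simp_all add: R_def)
  have prot: "is_protocol r R"
    unfolding is_protocol_def
  proof (intro conjI ballI impI)
    show "rounds R = r" by (rule R)
    show "(\<Sum>t<dim_TA R. \<Sum>s<dim_TB R. (cmod (shared R t s))\<^sup>2) = 1"
      unfolding R by (rule mixed_shared_norm)
  next
    fix i assume i: "i \<in> {1..r + 1}" "odd i"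
    then obtain j where j: "i = Suc j" by (cases i) auto
    show "isometry (alice_reg R (i - 1) \<times> msg_reg R (i - 1)) (alice_reg R i \<times> msg_reg R i) (alice_op R i)"
      using VA[of j] i unfolding regs R j by simp
  next
    fix i assume i: "i \<in> {1..r + 1}" "even i"
    then obtain j where j: "i = Suc j" by (cases i) auto
    show "isometry (bob_reg R (i - 1) \<times> msg_reg R (i - 1)) (bob_reg R i \<times> msg_reg R i) (bob_op R i)"
      using VB[of j] i unfolding regs R j by (simp add: W_def)
  next
    assume "r = 0"
    thus "isometry (input_reg (dim_TB R) \<times> {0}) (bob_reg R 0 \<times> {0}) (bob_op R 0)"
      unfolding regs R W_def if_P[OF refl] by (rule conjunct1[OF V0])
  qed
  have states: "mixed p (alice_reg frame i) (bob_reg frame i) (msg_reg frame i) (\<lambda>f. alice_reg (Ps f) i) (\<lambda>f. bob_reg (Ps f) i)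
      (\<lambda>f. msg_reg (Ps f) i) (basis_state R i q) (\<lambda>f. basis_state (Ps f) i q)" if "i \<le> r + 1" for i q
    using that
  proof (induction i)
    case 0
    let ?\<phi> = "\<lambda>u x y. if x = fst q \<and> y = snd q then 1 else 0 :: complex"
    have m0: "msg_reg frame 0 = {0}" "alice_reg frame 0 = input_reg dA" and mf: "msg_reg (Ps f) 0 = {0}" for f
      by (simp_all add: msg_reg_def)
    note st = mixed_start[OF R(4), of ?\<phi>]
    show ?case
    \<comment> \<open>Without rounds, the state with index 0 already includes Bob's output isometry,
      so it is not yet the plain starting state.\<close>
    proof (cases "r = 0")
      case True
      have "op_mixes (\<lambda>f. input_reg (dim_TB (Ps f))) (\<lambda>f. {0}) (\<lambda>f. new_reg (Ps f) 0) (\<lambda>f. {0}) (\<lambda>f. bob_op (Ps f) 0) V0"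
        using V0[OF True] by (rule conjunct2)
      from mixed_act_bob[OF _ input_B_embeds _ this st, of "bob_reg frame 0" "{0}"] alice_embeds[of 0]
      have *: "mixed p (input_reg dA) (bob_reg frame 0) {0} (\<lambda>f. input_reg (dim_TA (Ps f))) (\<lambda>f. new_reg (Ps f) 0) (\<lambda>f. {0})
        (act_bob V0 (input_reg dB) {0} (\<lambda>_. start_state R ?\<phi> ()) ())
        (\<lambda>f. act_bob (bob_op (Ps f) 0) (input_reg (dim_TB (Ps f))) {0} (\<lambda>_. start_state (Ps f) ?\<phi> ()) ())"
        by (simp add: msg_embeds_def)
      have bR: "basis_state R 0 q = act_bob V0 (input_reg dB) {0} (\<lambda>_. start_state R ?\<phi> ()) ()"
        unfolding basis_state_0 R if_P[OF True] by (simp add: W_def act_bob_def)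
      have bP: "basis_state (Ps f) 0 q = act_bob (bob_op (Ps f) 0) (input_reg (dim_TB (Ps f))) {0} (\<lambda>_. start_state (Ps f) ?\<phi> ()) ()"
        "bob_reg (Ps f) 0 = new_reg (Ps f) 0" if "f < 2" for f
        unfolding basis_state_0 bob_reg.simps rounds_Ps[OF that] if_P[OF True] by (simp_all add: act_bob_def)
      show ?thesis
        unfolding m0 bR by (rule mixed_cong[OF _ _ _ _ *]) (simp_all add: bP mf del: bob_reg.simps)
    next
      case False
      have bR: "basis_state R 0 q = start_state R ?\<phi> ()" "bob_reg frame 0 = input_reg dB"
        unfolding basis_state_0 R bob_reg_0 if_not_P[OF False] by (rule refl)+
      have bP: "basis_state (Ps f) 0 q = start_state (Ps f) ?\<phi> ()" "bob_reg (Ps f) 0 = input_reg (dim_TB (Ps f))" if "f < 2" for f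
        unfolding basis_state_0 bob_reg.simps rounds_Ps[OF that] if_not_P[OF False] by (rule refl)+
      show ?thesis
        unfolding m0 bR by (rule mixed_cong[OF _ _ _ _ st]) (simp_all add: bP mf del: bob_reg.simps)
    qed
  next
    case (Suc i)
    hence IH: "mixed p (alice_reg frame i) (bob_reg frame i) (msg_reg frame i) (\<lambda>f. alice_reg (Ps f) i) (\<lambda>f. bob_reg (Ps f) i)
      (\<lambda>f. msg_reg (Ps f) i) (basis_state R i q) (\<lambda>f. basis_state (Ps f) i q)" and i: "Suc i \<in> {1..r + 1}"
      by auto
    show ?case
    proof (cases "odd (Suc i)")
      case True
      note mixed_act_alice[OF alice_embeds bob_embeds msg_embeds_frame conjunct2[OF VA[OF i True]] IH,
          of "new_reg frame (Suc i)" "msg_reg frame (Suc i)"]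
      thus ?thesis using True by (simp add: basis_state_Suc regs R)
    next
      case False
      hence "even (Suc i)" by simp
      note mixed_act_bob[OF alice_embeds bob_embeds msg_embeds_frame conjunct2[OF VB[OF i this]] IH,
          of "new_reg frame (Suc i)" "msg_reg frame (Suc i)"]
      thus ?thesis using False by (simp add: basis_state_Suc regs R W_def)
    qed
  qed
  have out: "output_prob P x y za zb = (\<Sum>a\<in>{Out za k | k. Out za k \<in> alice_reg P (rounds P + 1)}.
      \<Sum>b\<in>{Out zb l | l. Out zb l \<in> bob_reg P (rounds P + 1)}. (cmod (basis_state P (rounds P + 1) (x, y) a b 0))\<^sup>2)"
    for P :: "('x, 'y, 'za, 'zb) protocol" and x y za zb
    by (simp add: output_prob_def basis_state_def Let_def)
  have "output_prob R x y za zb = (\<Sum>f<2. p f * output_prob (Ps f) x y za zb)" for x y za zb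
  proof -
    have "output_prob R x y za zb = (\<Sum>f<2. p f * (\<Sum>a\<in>{Out za k | k. Out za k \<in> alice_reg (Ps f) (r + 1)}.
      \<Sum>b\<in>{Out zb l | l. Out zb l \<in> bob_reg (Ps f) (r + 1)}. (cmod (basis_state (Ps f) (r + 1) (x, y) a b 0))\<^sup>2))"
      unfolding out R regs
      by (rule output_mixed[OF alice_embeds bob_embeds zero_in_msg_reg _ states p(1)])
         (simp_all add: msg_reg_def rounds_Ps)
    thus ?thesis by (simp add: out rounds_Ps)
  qed
  hence "error_prob T R x y = (\<Sum>f<2. p f * error_prob T (Ps f) x y)" for x y
    by (simp add: error_prob_def case_prod_beta sum_distrib_left sum.swap[of _ "{..<2}"])
  moreover have "info_cost R w = (\<Sum>f<2. p f * info_cost (Ps f) w)" if "\<forall>q. 0 \<le> w q" for w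
  proof -
    have "info_cost R w = (\<Sum>i\<in>{1..r}. \<Sum>f<2. p f * (1 / 2 * round_info (alice_reg (Ps f) i) (bob_reg (Ps f) i) (msg_reg (Ps f) i) w (basis_state (Ps f) i)))"
      unfolding info_cost_def R regs
    proof (intro sum.cong refl)
      fix i assume "i \<in> {1..r}"
      hence i: "i \<le> r + 1" by simp
      have "round_info (alice_reg frame i) (bob_reg frame i) (msg_reg frame i) w (basis_state R i) =
        (\<Sum>f<2. p f * round_info (alice_reg (Ps f) i) (bob_reg (Ps f) i) (msg_reg (Ps f) i) w (basis_state (Ps f) i))"
        by (rule round_info_mixed[OF alice_embeds bob_embeds msg_embeds_frame states[OF i] p(1)]) (use that in auto)
      thus "1 / 2 * round_info (alice_reg frame i) (bob_reg frame i) (msg_reg frame i) w (basis_state R i) =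
        (\<Sum>f<2. p f * (1 / 2 * round_info (alice_reg (Ps f) i) (bob_reg (Ps f) i) (msg_reg (Ps f) i) w (basis_state (Ps f) i)))"
        by (simp add: sum_distrib_left)
    qed
    also have "\<dots> = (\<Sum>f<2. p f * info_cost (Ps f) w)"
      by (subst sum.swap) (simp add: info_cost_def rounds_Ps sum_distrib_left)
    finally show ?thesis .
  qed
  ultimately show ?thesis using prot by blast
qed

end

section \<open>A minimax theorem\<close>

text \<open>Concavity makes the set of pairs lying below some (f x, g x) convex, and it misses the
  quadrant of pairs with both entries at least d. The normalized normal of a separating line
  provides the weights t and 1 - t.\<close>

lemma minimax_two:
  fixes f g :: "'a::euclidean_space \<Rightarrow> real"
  assumes K: "compact K" "convex K" and f: "concave_on K f" "continuous_on K f"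
    and g: "concave_on K g" "continuous_on K g" and lt: "\<And>x. x \<in> K \<Longrightarrow> min (f x) (g x) < c"
  shows "\<exists>t\<in>{0..1}. \<forall>x\<in>K. t * f x + (1 - t) * g x < c"
proof (cases "K = {}")
  case False
  have "continuous_on K (\<lambda>x. min (f x) (g x))" by (intro continuous_intros f g)
  then obtain x0 where x0: "x0 \<in> K" "\<And>x. x \<in> K \<Longrightarrow> min (f x) (g x) \<le> min (f x0) (g x0)"
    using continuous_attains_sup[OF K(1) False] by blast
  \<comment> \<open>The gap between the attained maximum and c leaves room for d; it turns the weak
    inequality from separation into a strict one.\<close>
  obtain d where d: "min (f x0) (g x0) < d" "d < c"
    using dense[OF lt[OF x0(1)]] by blast
  define S where "S = {p. \<exists>x\<in>K. fst p \<le> f x \<and> snd p \<le> g x}"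
  define Q where "Q = {d..} \<times> {d..}"
  have "convex S"
    unfolding convex_def
  proof (intro ballI allI impI)
    fix p q and s t :: real assume p: "p \<in> S" and q: "q \<in> S" and st: "0 \<le> s" "0 \<le> t" "s + t = 1"
    obtain x y where x: "x \<in> K" "fst p \<le> f x" "snd p \<le> g x" and y: "y \<in> K" "fst q \<le> f y" "snd q \<le> g y"
      using p q by (auto simp: S_def)
    have "s *\<^sub>R x + t *\<^sub>R y \<in> K" using K(2) x y st by (simp add: convexD)
    moreover have "s * fst p + t * fst q \<le> f (s *\<^sub>R x + t *\<^sub>R y)"
    proof -
      have "s * fst p + t * fst q \<le> s * f x + t * f y" using x y st by (intro add_mono mult_left_mono)
      also have "\<dots> \<le> f (s *\<^sub>R x + t *\<^sub>R y)" using f(1) x y st by (auto simp: concave_on_iff)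
      finally show ?thesis .
    qed
    moreover have "s * snd p + t * snd q \<le> g (s *\<^sub>R x + t *\<^sub>R y)"
    proof -
      have "s * snd p + t * snd q \<le> s * g x + t * g y" using x y st by (intro add_mono mult_left_mono)
      also have "\<dots> \<le> g (s *\<^sub>R x + t *\<^sub>R y)" using g(1) x y st by (auto simp: concave_on_iff)
      finally show ?thesis .
    qed
    ultimately show "s *\<^sub>R p + t *\<^sub>R q \<in> S"
      unfolding S_def by (intro CollectI bexI[of _ "s *\<^sub>R x + t *\<^sub>R y"]) auto
  qed
  moreover have "convex Q" unfolding Q_def by (intro convex_Times convex_real_interval)
  moreover have "(f x0, g x0) \<in> S" using x0(1) by (auto simp: S_def)
  hence "S \<noteq> {}" by blast
  moreover have "Q \<noteq> {}" unfolding Q_def by auto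
  moreover have "S \<inter> Q = {}"
  proof -
    have False if "x \<in> K" "d \<le> f x" "d \<le> g x" for x
      using x0(2)[OF that(1)] d that by linarith
    thus ?thesis by (force simp: S_def Q_def)
  qed
  ultimately obtain a b where a: "a \<noteq> 0" and S: "\<And>p. p \<in> S \<Longrightarrow> inner a p \<le> b" and Q: "\<And>p. p \<in> Q \<Longrightarrow> b \<le> inner a p"
    using separating_hyperplane_sets[of S Q] by blast
  obtain a1 a2 where a12: "a = (a1, a2)" by (cases a)
  have b: "b \<le> (a1 + a2) * d"
    using Q[of "(d, d)"] by (simp add: Q_def a12 algebra_simps)
  have Sx: "a1 * f x + a2 * g x \<le> b" if "x \<in> K" for x
    using S[of "(f x, g x)"] that by (auto simp: S_def a12)
  \<comment> \<open>The quadrant is unbounded in both coordinate directions, so a negative component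
    of the normal would contradict the lower bound on it.\<close>
  have lim: "0 \<le> r" if "\<And>n::nat. m \<le> r * real n" for m r :: real
  proof (rule ccontr)
    assume "\<not> 0 \<le> r"
    then obtain n :: nat where "real n * (- r) > - m" using reals_Archimedean3[of "- r", THEN spec, of "- m"] by auto
    thus False using that[of n] by (simp add: algebra_simps)
  qed
  have a1: "0 \<le> a1"
  proof (rule lim)
    fix n :: nat
    have "b \<le> a1 * (d + n) + a2 * d" using Q[of "(d + n, d)"] by (simp add: Q_def a12)
    thus "b - (a1 + a2) * d \<le> a1 * n" by (simp add: algebra_simps)
  qed
  have a2: "0 \<le> a2"
  proof (rule lim)
    fix n :: nat
    have "b \<le> a1 * d + a2 * (d + n)" using Q[of "(d, d + n)"] by (simp add: Q_def a12)
    thus "b - (a1 + a2) * d \<le> a2 * n" by (simp add: algebra_simps)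
  qed
  have pos: "0 < a1 + a2" using a a1 a2 by (auto simp: a12 zero_prod_def)
  define t where "t = a1 / (a1 + a2)"
  have t: "t \<in> {0..1}" "1 - t = a2 / (a1 + a2)" using a1 a2 pos by (auto simp: t_def field_simps)
  have "t * f x + (1 - t) * g x < c" if "x \<in> K" for x
  proof -
    have "t * f x + (1 - t) * g x = (a1 * f x + a2 * g x) / (a1 + a2)"
      unfolding t(2) by (simp add: t_def add_divide_distrib)
    also have "\<dots> \<le> d" using Sx[OF that] b pos by (simp add: pos_divide_le_eq algebra_simps)
    finally show ?thesis using d(2) by simp
  qed
  thus ?thesis using t(1) by blast
qed (auto intro: bexI[of _ 0])

text \<open>Induction on S over all compact convex subsets L of K. The points that P fails to bring
  below c form such a subset again, the induction hypothesis supplies one Q for them, and the case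
  of two functions combines P with Q on L.\<close>

lemma minimax_finite:
  fixes F :: "'p \<Rightarrow> 'a::euclidean_space \<Rightarrow> real"
  assumes K: "compact K" "convex K" and S: "finite S" "S \<subseteq> X" "S \<noteq> {}"
    and F: "\<And>P. P \<in> X \<Longrightarrow> concave_on K (F P)" "\<And>P. P \<in> X \<Longrightarrow> continuous_on K (F P)"
    and mix: "\<And>P Q t. P \<in> X \<Longrightarrow> Q \<in> X \<Longrightarrow> t \<in> {0..1} \<Longrightarrow> \<exists>R\<in>X. \<forall>x\<in>K. F R x = t * F P x + (1 - t) * F Q x"
    and lt: "\<And>x. x \<in> K \<Longrightarrow> \<exists>P\<in>S. F P x < c"
  shows "\<exists>R\<in>X. \<forall>x\<in>K. F R x < c"
proof -
  have "\<exists>R\<in>X. \<forall>x\<in>L. F R x < c" if "compact L" "convex L" "L \<subseteq> K" "\<And>x. x \<in> L \<Longrightarrow> \<exists>P\<in>S. F P x < c" for L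
    using S(1,3,2) that
  proof (induction S arbitrary: L rule: finite_ne_induct)
    case (singleton P)
    thus ?case by blast
  next
    case (insert P S)
    \<comment> \<open>A superlevel set: concavity makes it convex, and continuity on the compact L
      makes it compact.\<close>
    define M where "M = {x \<in> L. c \<le> F P x}"
    have P: "P \<in> X" using insert.prems by auto
    have cont: "continuous_on L (F P)" using F(2)[OF P] insert.prems continuous_on_subset by blast
    have "M = L \<inter> F P -` {c..}" by (auto simp: M_def)
    moreover have "closed (L \<inter> F P -` {c..})"
      by (rule continuous_closed_preimage[OF cont compact_imp_closed[OF insert.prems(2)] closed_atLeast])
    ultimately have "compact M"
      using insert.prems(2) by (metis compact_Int_closed inf.absorb2 inf_le1)
    moreover have "convex M"
      unfolding convex_def
    proof (intro ballI allI impI)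
      fix x y and s t :: real assume xy: "x \<in> M" "y \<in> M" and st: "0 \<le> s" "0 \<le> t" "s + t = 1"
      have "x \<in> K" "y \<in> K" using xy insert.prems(4) by (auto simp: M_def)
      hence "s * F P x + t * F P y \<le> F P (s *\<^sub>R x + t *\<^sub>R y)"
        using F(1)[OF P] st by (auto simp: concave_on_iff)
      moreover have "s * c + t * c \<le> s * F P x + t * F P y"
        using xy st by (intro add_mono mult_left_mono) (auto simp: M_def)
      moreover have "s * c + t * c = c" using st by (simp add: distrib_right[symmetric])
      moreover have "s *\<^sub>R x + t *\<^sub>R y \<in> L" using insert.prems(3) xy st by (auto simp: M_def convexD)
      ultimately show "s *\<^sub>R x + t *\<^sub>R y \<in> M" by (simp add: M_def)
    qed
    moreover have "M \<subseteq> K" using insert.prems(4) by (auto simp: M_def)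
    moreover have "\<exists>Q\<in>S. F Q x < c" if "x \<in> M" for x
      using insert.prems(5)[of x] that by (auto simp: M_def)
    ultimately obtain Q where Q: "Q \<in> X" "\<And>x. x \<in> M \<Longrightarrow> F Q x < c"
      using insert.IH[of M] insert.prems(1) by auto
    have "min (F P x) (F Q x) < c" if "x \<in> L" for x
      using Q(2)[of x] that by (cases "x \<in> M") (auto simp: M_def min_less_iff_disj)
    moreover have "concave_on L (F R)" "continuous_on L (F R)" if "R \<in> X" for R
      using F(1)[OF that] F(2)[OF that] insert.prems(3,4) continuous_on_subset
      by (auto simp: concave_on_iff subset_iff)
    ultimately obtain t where t: "t \<in> {0..1}" "\<And>x. x \<in> L \<Longrightarrow> t * F P x + (1 - t) * F Q x < c"
      using minimax_two[of L "F P" "F Q" c] insert.prems(2,3) P Q(1) by blast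
    obtain R where "R \<in> X" "\<And>x. x \<in> K \<Longrightarrow> F R x = t * F P x + (1 - t) * F Q x"
      using mix[OF P Q(1) t(1)] by blast
    thus ?case using t(2) insert.prems(4) by (intro bexI[of _ R]) auto
  qed
  from this[OF K] lt show ?thesis by simp
qed

text \<open>The sets where some \<open>F P\<close> is below c form an open cover of K, so finitely
  many members of X already suffice.\<close>

lemma minimax_compact:
  fixes F :: "'p \<Rightarrow> 'a::euclidean_space \<Rightarrow> real"
  assumes K: "compact K" "convex K" "K \<noteq> {}"
    and F: "\<And>P. P \<in> X \<Longrightarrow> concave_on K (F P)" "\<And>P. P \<in> X \<Longrightarrow> continuous_on K (F P)"
    and mix: "\<And>P Q t. P \<in> X \<Longrightarrow> Q \<in> X \<Longrightarrow> t \<in> {0..1} \<Longrightarrow> \<exists>R\<in>X. \<forall>x\<in>K. F R x = t * F P x + (1 - t) * F Q x"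
    and lt: "\<And>x. x \<in> K \<Longrightarrow> \<exists>P\<in>X. F P x < c"
  shows "\<exists>R\<in>X. \<forall>x\<in>K. F R x < c"
proof -
  have "\<exists>T. open T \<and> T \<inter> K = {x \<in> K. F P x < c}" if "P \<in> X" for P
  proof -
    have "F P -` {..<c} \<inter> K = {x \<in> K. F P x < c}" by auto
    thus ?thesis
      using F(2)[OF that] unfolding continuous_on_open_invariant by (metis open_lessThan)
  qed
  then obtain T where T: "\<And>P. P \<in> X \<Longrightarrow> open (T P)" "\<And>P. P \<in> X \<Longrightarrow> T P \<inter> K = {x \<in> K. F P x < c}"
    by metis
  have "K \<subseteq> (\<Union>P\<in>X. T P)"
  proof
    fix x assume x: "x \<in> K"
    obtain P where P: "P \<in> X" "F P x < c" using lt[OF x] by blast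
    hence "x \<in> T P \<inter> K" using T(2)[OF P(1)] x by auto
    thus "x \<in> (\<Union>P\<in>X. T P)" using P(1) by blast
  qed
  then obtain S where S: "S \<subseteq> X" "finite S" "K \<subseteq> (\<Union>P\<in>S. T P)"
    using compactE_image[OF K(1), of X T] T(1) by metis
  have ne: "S \<noteq> {}" using S(3) K(3) by auto
  show ?thesis
  proof (rule minimax_finite[OF K(1,2) S(2,1) ne])
    fix x assume x: "x \<in> K"
    then obtain P where P: "P \<in> S" "x \<in> T P" using S(3) by blast
    hence "x \<in> {x \<in> K. F P x < c}" using T(2)[of P] S(1) x by blast
    thus "\<exists>P\<in>S. F P x < c" using P(1) by blast
  qed (use F mix in auto)
qed

section \<open>Minimax over the probability simplex\<close>

lemma exists_pmf:
  fixes w :: "'a::finite \<Rightarrow> real"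
  assumes "\<And>q. 0 \<le> w q" "(\<Sum>q\<in>UNIV. w q) = 1"
  shows "\<exists>\<mu>. pmf \<mu> = w"
proof -
  have "(\<integral>\<^sup>+ q. ennreal (w q) \<partial>count_space UNIV) = 1"
    using assms by (simp add: nn_integral_count_space_finite)
  hence "pmf (embed_pmf w) q = w q" for q
    using assms(1) by (intro pmf_embed_pmf) auto
  thus ?thesis by blast
qed

text \<open>
  F may be discontinuous at the boundary of the simplex. Minimax is therefore applied to distributions
  bounded away from 0; concavity and nonnegativity extend the bound to all of them, at the price of c.
\<close>

lemma minimax_simplex:
  fixes F :: "'p \<Rightarrow> ('q::finite \<Rightarrow> real) \<Rightarrow> real"
  assumes concave: "\<And>P w w' a b. P \<in> X \<Longrightarrow> (\<And>q. 0 \<le> w q) \<Longrightarrow> (\<And>q. 0 \<le> w' q) \<Longrightarrow> 0 \<le> a \<Longrightarrow> 0 \<le> b \<Longrightarrow>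
      a * F P w + b * F P w' \<le> F P (\<lambda>q. a * w q + b * w' q)"
    and nonneg: "\<And>P w. P \<in> X \<Longrightarrow> (\<And>q. 0 \<le> w q) \<Longrightarrow> 0 \<le> F P w"
    and mix: "\<And>P P' a. P \<in> X \<Longrightarrow> P' \<in> X \<Longrightarrow> a \<in> {0..1} \<Longrightarrow>
      \<exists>R\<in>X. \<forall>w. (\<forall>q. 0 \<le> w q) \<longrightarrow> F R w = a * F P w + (1 - a) * F P' w"
    and good: "\<And>\<mu>. \<exists>P\<in>X. F P (pmf \<mu>) \<le> 1" and c: "1 < c"
  shows "\<exists>R\<in>X. \<forall>\<mu>. F R (pmf \<mu>) \<le> c"
proof -
  define N where "N = real CARD('q)"
  have N: "N > 0" by (simp add: N_def)
  \<comment> \<open>The allowed factor c is split as d * d: one d > 1 is the strict bound in the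
    minimax step on K, the other is 1 / (1 - \<theta>), the price for passing from K to all
    distributions.\<close>
  define d where "d = sqrt c"
  have d: "1 < d" "d * d = c" using c by (auto simp: d_def)
  define \<theta> where "\<theta> = 1 - 1 / d"
  have \<theta>: "0 < \<theta>" "\<theta> < 1" "1 - \<theta> = 1 / d" using d by (auto simp: \<theta>_def)
  define K where "K = {v :: real ^ 'q. (\<forall>q. \<theta> / N \<le> vec_nth v q) \<and> (\<Sum>q\<in>UNIV. vec_nth v q) = 1}"
  \<comment> \<open>K lies in a hyperplane and has empty interior, so continuity is derived on this
    open set around it.\<close>
  define Q where "Q = {v :: real ^ 'q. \<forall>q. 0 < vec_nth v q}"
  have KQ: "K \<subseteq> Q"
  proof
    fix v assume "v \<in> K"
    hence "\<theta> / N \<le> vec_nth v q" for q unfolding K_def by blast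
    moreover have "0 < \<theta> / N" using \<theta> N by simp
    ultimately show "v \<in> Q" unfolding Q_def using less_le_trans by blast
  qed
  have Qc: "convex Q"
    unfolding convex_def Q_def
  proof (intro ballI allI impI CollectI)
    fix x y :: "real ^ 'q" and a b :: real and q
    assume h: "x \<in> {v. \<forall>q. 0 < vec_nth v q}" "y \<in> {v. \<forall>q. 0 < vec_nth v q}" "0 \<le> a" "0 \<le> b" "a + b = 1"
    show "0 < vec_nth (a *\<^sub>R x + b *\<^sub>R y) q"
    proof (cases "a = 0")
      case False
      hence "0 < a * vec_nth x q" "0 \<le> b * vec_nth y q" using h by (auto simp: less_imp_le)
      thus ?thesis by simp
    qed (use h in auto)
  qed
  have Qo: "open Q"
  proof -
    have "Q = (\<Inter>q\<in>UNIV. {v. 0 < vec_nth v q})" by (auto simp: Q_def)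
    moreover have "open {v :: real ^ 'q. 0 < vec_nth v q}" for q
      by (intro open_Collect_less continuous_intros)
    ultimately show ?thesis by auto
  qed
  have Fc: "concave_on Q (\<lambda>v. F P (vec_nth v))" if P: "P \<in> X" for P
    unfolding concave_on_iff
  proof (intro conjI Qc ballI allI impI)
    fix x y :: "real ^ 'q" and a b :: real
    assume "x \<in> Q" "y \<in> Q" "0 \<le> a" "0 \<le> b"
    hence "a * F P (vec_nth x) + b * F P (vec_nth y) \<le> F P (\<lambda>q. a * vec_nth x q + b * vec_nth y q)"
      by (intro concave P) (auto simp: Q_def less_imp_le)
    moreover have "vec_nth (a *\<^sub>R x + b *\<^sub>R y) = (\<lambda>q. a * vec_nth x q + b * vec_nth y q)" by auto
    ultimately show "a * F P (vec_nth x) + b * F P (vec_nth y) \<le> F P (vec_nth (a *\<^sub>R x + b *\<^sub>R y))" by simp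
  qed
  have Fcont: "continuous_on Q (\<lambda>v. F P (vec_nth v))" if P: "P \<in> X" for P
    using convex_on_continuous[OF Qo, of "\<lambda>v. - F P (vec_nth v)"] Fc[OF P]
      continuous_on_minus[of Q "\<lambda>v. - F P (vec_nth v)"]
    by (simp add: concave_on_def)
  have Kconv: "convex K"
    unfolding convex_def K_def
  proof (intro ballI allI impI CollectI conjI)
    fix x y :: "real ^ 'q" and a b :: real and q
    assume h: "x \<in> {v. (\<forall>q. \<theta> / N \<le> vec_nth v q) \<and> (\<Sum>q\<in>UNIV. vec_nth v q) = 1}"
      "y \<in> {v. (\<forall>q. \<theta> / N \<le> vec_nth v q) \<and> (\<Sum>q\<in>UNIV. vec_nth v q) = 1}" "0 \<le> a" "0 \<le> b" "a + b = 1"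
    have "a * (\<theta> / N) + b * (\<theta> / N) \<le> a * vec_nth x q + b * vec_nth y q"
      using h by (intro add_mono mult_left_mono) auto
    moreover have "a * (\<theta> / N) + b * (\<theta> / N) = \<theta> / N" using h(5) by (simp only: distrib_right[symmetric])
    ultimately show "\<theta> / N \<le> vec_nth (a *\<^sub>R x + b *\<^sub>R y) q" by simp
    show "(\<Sum>q\<in>UNIV. vec_nth (a *\<^sub>R x + b *\<^sub>R y) q) = 1"
      using h by (simp add: sum.distrib sum_distrib_left[symmetric])
  qed
  have Kcomp: "compact K"
    unfolding compact_eq_bounded_closed
  proof
    have "norm v \<le> 1" if v: "v \<in> K" for v
    proof -
      have "norm v \<le> (\<Sum>q\<in>UNIV. \<bar>vec_nth v q\<bar>)"
        by (rule norm_le_l1_cart)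
      also have "\<dots> = (\<Sum>q\<in>UNIV. vec_nth v q)"
        using KQ v by (intro sum.cong) (auto simp: Q_def less_imp_le)
      finally show ?thesis using v by (simp add: K_def)
    qed
    thus "bounded K" by (auto simp: bounded_iff)
    have "K = (\<Inter>q\<in>UNIV. {v. \<theta> / N \<le> vec_nth v q}) \<inter> {v. (\<Sum>q\<in>UNIV. vec_nth v q) = 1}" by (auto simp: K_def)
    moreover have "closed {v :: real ^ 'q. \<theta> / N \<le> vec_nth v q}" for q
      by (intro closed_Collect_le continuous_intros)
    moreover have "closed {v :: real ^ 'q. (\<Sum>q\<in>UNIV. vec_nth v q) = 1}"
      by (intro closed_Collect_eq continuous_intros)
    ultimately show "closed K" by auto
  qed
  have inK: "vec_lambda (\<lambda>q. (1 - \<theta>) * pmf \<mu> q + \<theta> * (1 / N)) \<in> K" for \<mu> :: "'q pmf"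
  proof -
    have "(\<Sum>q\<in>UNIV. pmf \<mu> q) = 1" by (rule sum_pmf_eq_1) auto
    hence "(\<Sum>q\<in>UNIV. (1 - \<theta>) * pmf \<mu> q + \<theta> * (1 / N)) = 1"
      using N by (simp add: sum.distrib sum_distrib_left[symmetric] N_def)
    thus ?thesis using \<theta>(1,2) by (auto simp: K_def)
  qed
  have "\<exists>R\<in>X. \<forall>v\<in>K. F R (vec_nth v) < d"
  proof (rule minimax_compact[OF Kcomp Kconv])
    show "K \<noteq> {}" using inK by blast
    show "concave_on K (\<lambda>v. F P (vec_nth v))" if "P \<in> X" for P
      using Fc[OF that] KQ Kconv by (auto simp: concave_on_iff subset_iff)
    show "continuous_on K (\<lambda>v. F P (vec_nth v))" if "P \<in> X" for P
      using Fcont[OF that] KQ continuous_on_subset by blast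
    show "\<exists>R\<in>X. \<forall>v\<in>K. F R (vec_nth v) = a * F P (vec_nth v) + (1 - a) * F P' (vec_nth v)"
      if PX: "P \<in> X" "P' \<in> X" "a \<in> {0..1}" for P P' a
    proof -
      have "\<forall>q. 0 \<le> vec_nth v q" if "v \<in> K" for v
        using KQ that by (auto simp: Q_def less_imp_le)
      thus ?thesis using mix[OF PX] by blast
    qed
    show "\<exists>P\<in>X. F P (vec_nth v) < d" if v: "v \<in> K" for v
    proof -
      have "\<And>q. 0 \<le> vec_nth v q" "(\<Sum>q\<in>UNIV. vec_nth v q) = 1"
        using KQ v by (auto simp: Q_def K_def less_imp_le)
      then obtain \<mu> where \<mu>: "pmf \<mu> = vec_nth v" using exists_pmf by blast
      obtain P where "P \<in> X" "F P (pmf \<mu>) \<le> 1" using good by blast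
      thus ?thesis using d(1) unfolding \<mu> by (intro bexI[of _ P]) auto
    qed
  qed
  then obtain R where R: "R \<in> X" "\<And>v. v \<in> K \<Longrightarrow> F R (vec_nth v) < d" by blast
  have "F R (pmf \<mu>) \<le> c" for \<mu>
  proof -
    have "(1 - \<theta>) * F R (pmf \<mu>) \<le> (1 - \<theta>) * F R (pmf \<mu>) + \<theta> * F R (\<lambda>_. 1 / N)"
      using \<theta>(1,2) N R(1) by (simp add: nonneg)
    also have "\<dots> \<le> F R (\<lambda>q. (1 - \<theta>) * pmf \<mu> q + \<theta> * (1 / N))"
      using \<theta>(1,2) N by (intro concave R(1)) auto
    also have "\<dots> < d" using R(2)[OF inK[of \<mu>]] by (simp add: vec_lambda_inverse)
    finally have "F R (pmf \<mu>) / d < d" using \<theta>(3) by simp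
    thus ?thesis using d by (simp add: pos_divide_less_eq)
  qed
  thus ?thesis using R(1) by blast
qed

section \<open>The main inequality\<close>

lemma mixture_of_two_exists:
  fixes P Q :: "('x::finite, 'y::finite, 'za::finite, 'zb::finite) protocol"
  assumes "is_protocol r P" "is_protocol r Q" "0 \<le> t" "t \<le> 1"
  shows "\<exists>R. is_protocol r R \<and> (\<forall>x y. error_prob T R x y = t * error_prob T P x y + (1 - t) * error_prob T Q x y) \<and>
     (\<forall>w. (\<forall>q. 0 \<le> w q) \<longrightarrow> info_cost R w = t * info_cost P w + (1 - t) * info_cost Q w)"
proof -
  interpret protocol_mixture r "\<lambda>f. if f = 0 then P else Q" "\<lambda>f. if f = 0 then t else 1 - t"
    by unfold_locales (use assms in \<open>auto simp: numeral_2_eq_2\<close>)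
  show ?thesis using mixture_exists[of T] by (simp add: numeral_2_eq_2)
qed

lemma error_prob_nonneg: "0 \<le> error_prob T P x y"
  unfolding error_prob_def output_prob_def Let_def by (auto intro!: sum_nonneg)

text \<open>Merges the two requirements into the single number that minimax can treat. The error
  part is linear in w, so concavity and nonnegativity are those of the cost.\<close>

definition payoff ::
    "('x::finite \<times> 'y::finite \<times> 'za::finite \<times> 'zb::finite) set \<Rightarrow> real \<Rightarrow> real \<Rightarrow>
     ('x, 'y, 'za, 'zb) protocol \<Rightarrow> ('x \<times> 'y \<Rightarrow> real) \<Rightarrow> real" where
  "payoff T s t P w = s * info_cost P w + t * (\<Sum>q\<in>UNIV. w q * error_prob T P (fst q) (snd q))"

lemma payoff_concave:
  assumes "\<And>q. 0 \<le> w q" "\<And>q. 0 \<le> w' q" "0 \<le> a" "0 \<le> b" "0 \<le> s"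
  shows "a * payoff T s t P w + b * payoff T s t P w' \<le> payoff T s t P (\<lambda>q. a * w q + b * w' q)"
proof -
  have "s * (a * info_cost P w + b * info_cost P w') \<le> s * info_cost P (\<lambda>q. a * w q + b * w' q)"
    using assms by (intro mult_left_mono info_cost_concave)
  moreover have "(\<Sum>q\<in>UNIV. (a * w q + b * w' q) * error_prob T P (fst q) (snd q)) =
      a * (\<Sum>q\<in>UNIV. w q * error_prob T P (fst q) (snd q)) + b * (\<Sum>q\<in>UNIV. w' q * error_prob T P (fst q) (snd q))"
    by (simp add: sum_distrib_left sum.distrib algebra_simps)
  ultimately show ?thesis by (simp add: payoff_def algebra_simps)
qed

lemma payoff_nonneg:
  assumes "\<And>q. 0 \<le> w q" "0 \<le> s" "0 \<le> t"
  shows "0 \<le> payoff T s t P w"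
  unfolding payoff_def using assms
  by (intro add_nonneg_nonneg mult_nonneg_nonneg sum_nonneg info_cost_nonneg error_prob_nonneg)

lemma payoff_pmf:
  "payoff T s t P (pmf \<mu>) = s * QIC P \<mu> + t * measure_pmf.expectation \<mu> (\<lambda>(x, y). error_prob T P x y)"
proof -
  have "measure_pmf.expectation \<mu> (\<lambda>(x, y). error_prob T P x y) = (\<Sum>q\<in>UNIV. pmf \<mu> q * error_prob T P (fst q) (snd q))"
    by (subst integral_measure_pmf[where A = UNIV]) (auto simp: case_prod_beta)
  thus ?thesis by (simp add: payoff_def QIC_eq_info_cost)
qed

lemma exists_uniformly_good_protocol:
  fixes T :: "('x::finite \<times> 'y::finite \<times> 'za::finite \<times> 'zb::finite) set"
  assumes st: "0 \<le> s" "0 \<le> t" and c: "1 < c"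
    and good: "\<And>\<mu>. \<exists>P. is_protocol r P \<and> payoff T s t P (pmf \<mu>) \<le> 1"
  shows "\<exists>P. is_protocol r P \<and> (\<forall>\<mu>. payoff T s t P (pmf \<mu>) \<le> c)"
proof -
  have "\<exists>P\<in>{P. is_protocol r P}. \<forall>\<mu>. payoff T s t P (pmf \<mu>) \<le> c"
  proof (rule minimax_simplex[OF _ _ _ _ c])
    show "\<exists>R\<in>{P. is_protocol r P}. \<forall>w. (\<forall>q. 0 \<le> w q) \<longrightarrow>
        payoff T s t R w = a * payoff T s t P w + (1 - a) * payoff T s t P' w"
      if PX: "P \<in> {P. is_protocol r P}" "P' \<in> {P. is_protocol r P}" "a \<in> {0..1}" for P P' a
    proof -
      obtain R where R: "is_protocol r R" "\<And>x y. error_prob T R x y = a * error_prob T P x y + (1 - a) * error_prob T P' x y"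
        "\<And>w. (\<forall>q. 0 \<le> w q) \<Longrightarrow> info_cost R w = a * info_cost P w + (1 - a) * info_cost P' w"
        using mixture_of_two_exists[of r P P' a T] PX by auto
      have "payoff T s t R w = a * payoff T s t P w + (1 - a) * payoff T s t P' w" if "\<forall>q. 0 \<le> w q" for w
      proof -
        have e: "(\<Sum>q\<in>UNIV. w q * error_prob T R (fst q) (snd q)) =
          a * (\<Sum>q\<in>UNIV. w q * error_prob T P (fst q) (snd q)) + (1 - a) * (\<Sum>q\<in>UNIV. w q * error_prob T P' (fst q) (snd q))"
          by (simp only: R(2) sum_distrib_left sum.distrib[symmetric] distrib_left mult.left_commute)
        show ?thesis unfolding payoff_def e R(3)[OF that] by (simp add: algebra_simps)
      qed
      thus ?thesis using R(1) by blast
    qed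
  qed (use st good in \<open>auto intro: payoff_concave payoff_nonneg\<close>)
  thus ?thesis by simp
qed

lemma QIC_nonneg: "0 \<le> QIC P \<mu>"
  unfolding QIC_eq_info_cost by (rule info_cost_nonneg) simp

text \<open>c is the loss of the minimax step and I a strict upper bound, since the infimum over
  protocols need not be attained. Using \<alpha> c in place of \<alpha> in the weights moves the
  whole loss into the cost.\<close>

lemma QIC_worst_le:
  fixes T :: "('x::finite \<times> 'y::finite \<times> 'za::finite \<times> 'zb::finite) set"
  assumes \<epsilon>: "0 < \<epsilon>" and \<alpha>: "0 < \<alpha>" and c: "1 < c" "\<alpha> * c < 1" and I: "0 < I" "QIC_D r T \<epsilon> < ereal I"
  shows "QIC_worst r T (\<epsilon> / \<alpha>) \<le> ereal (c * I / (1 - \<alpha> * c))"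
proof -
  define s where "s = (1 - \<alpha> * c) / I"
  \<comment> \<open>Chosen so that c / t is exactly \<epsilon> / \<alpha>; together with
    \<open>s\<close> this gives \<open>s * I + t * \<epsilon> = 1\<close>.\<close>
  define t where "t = \<alpha> * c / \<epsilon>"
  have st: "0 < s" "0 < t" using assms by (auto simp: s_def t_def)
  have "\<exists>P. is_protocol r P \<and> payoff T s t P (pmf \<mu>) \<le> 1" for \<mu>
  proof -
    have "QIC_dist r T \<mu> \<epsilon> \<le> QIC_D r T \<epsilon>" unfolding QIC_D_def by (rule SUP_upper) simp
    hence "QIC_dist r T \<mu> \<epsilon> < ereal I" using I(2) by (rule le_less_trans)
    then obtain P where P: "is_protocol r P" "measure_pmf.expectation \<mu> (\<lambda>(x, y). error_prob T P x y) \<le> \<epsilon>" "QIC P \<mu> < I"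
      unfolding QIC_dist_def by (auto simp: INF_less_iff)
    have "payoff T s t P (pmf \<mu>) \<le> s * I + t * \<epsilon>"
      unfolding payoff_pmf using P st by (intro add_mono mult_left_mono) auto
    also have "\<dots> = 1" using I \<epsilon> by (simp add: s_def t_def)
    finally show ?thesis using P(1) by blast
  qed
  then obtain P where P: "is_protocol r P" "\<And>\<mu>. payoff T s t P (pmf \<mu>) \<le> c"
    using exists_uniformly_good_protocol[of s t c r T] st c by auto
  have "error_prob T P x y \<le> \<epsilon> / \<alpha>" for x y
  proof -
    have "t * error_prob T P x y \<le> payoff T s t P (pmf (return_pmf (x, y)))"
      unfolding payoff_pmf using st QIC_nonneg[of P "return_pmf (x, y)"] by simp
    also have "\<dots> \<le> c" by (rule P(2))
    finally show ?thesis using \<epsilon> \<alpha> c by (simp add: t_def field_simps)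
  qed
  hence "QIC_worst r T (\<epsilon> / \<alpha>) \<le> (SUP \<mu>. ereal (QIC P \<mu>))"
    unfolding QIC_worst_def using P(1) by (intro INF_lower) simp
  also have "\<dots> \<le> ereal (c * I / (1 - \<alpha> * c))"
  proof (rule SUP_least)
    fix \<mu>
    have "0 \<le> measure_pmf.expectation \<mu> (\<lambda>(x, y). error_prob T P x y)"
      by (rule Bochner_Integration.integral_nonneg) (auto simp: error_prob_nonneg)
    hence "s * QIC P \<mu> \<le> payoff T s t P (pmf \<mu>)"
      unfolding payoff_pmf using st by simp
    \<comment> \<open>The average error is nonnegative and was dropped, so the cost is at most c / s
      for every distribution.\<close>
    also have "\<dots> \<le> c" by (rule P(2))
    finally show "ereal (QIC P \<mu>) \<le> ereal (c * I / (1 - \<alpha> * c))"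
      using I(1) c by (simp add: s_def field_simps)
  qed
  finally show ?thesis .
qed

theorem theorem4p10:
  fixes T :: "('x::finite \<times> 'y::finite \<times> 'za::finite \<times> 'zb::finite) set"
    and \<epsilon> \<alpha> :: real and r :: nat
  assumes "0 < \<epsilon>" "\<epsilon> < 1" "0 < \<alpha>" "\<alpha> < 1"
  shows "QIC_worst r T (\<epsilon> / \<alpha>) \<le> QIC_D r T \<epsilon> / ereal (1 - \<alpha>)"
proof (cases "QIC_D r T \<epsilon> = \<infinity>")
  case True
  thus ?thesis using assms by simp
next
  case False
  \<comment> \<open>Any distribution serves here; nonnegativity excludes minus infinity and leaves a
    real value D.\<close>
  have "0 \<le> QIC_dist r T undefined \<epsilon>"
    unfolding QIC_dist_def by (rule INF_greatest) (simp add: QIC_nonneg)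
  also have "\<dots> \<le> QIC_D r T \<epsilon>" unfolding QIC_D_def by (rule SUP_upper) simp
  finally have "0 \<le> QIC_D r T \<epsilon>" .
  with False obtain D where D: "QIC_D r T \<epsilon> = ereal D" "0 \<le> D"
    by (cases "QIC_D r T \<epsilon>") auto
  \<comment> \<open>The bound with I = D + (c - 1), which is positive, exceeds D strictly and tends
    to D as c decreases to 1.\<close>
  let ?bound = "\<lambda>c. c * (D + (c - 1)) / (1 - \<alpha> * c)"
  have "(?bound \<longlongrightarrow> 1 * (D + (1 - 1)) / (1 - \<alpha> * 1)) (at_right 1)"
    using assms(4) by (intro tendsto_intros) auto
  hence "((\<lambda>c. ereal (?bound c)) \<longlongrightarrow> ereal (D / (1 - \<alpha>))) (at_right 1)"
    by (simp add: lim_ereal)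
  moreover have "eventually (\<lambda>c. QIC_worst r T (\<epsilon> / \<alpha>) \<le> ereal (?bound c)) (at_right 1)"
  proof -
    \<comment> \<open>Below 1 / \<alpha> the modified weight \<alpha> c stays smaller than
      1.\<close>
    have "eventually (\<lambda>c. c \<in> {1<..<1 / \<alpha>}) (at_right 1)"
      using assms by (intro eventually_at_right_real) (simp add: field_simps)
    thus ?thesis
    proof eventually_elim
      case (elim c)
      hence "1 < c" "\<alpha> * c < 1" using assms by (auto simp: field_simps)
      thus ?case using assms D by (intro QIC_worst_le) auto
    qed
  qed
  ultimately have "QIC_worst r T (\<epsilon> / \<alpha>) \<le> ereal (D / (1 - \<alpha>))"
    by (rule tendsto_lowerbound) simp
  thus ?thesis using assms(4) by (simp add: D(1))
qed

end
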